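(* Let $\tau$ be the trace on $C[0,1]$ given by integration with respect to Lebesgue measure, and consider the following formal power series in a variable $g\in C[0,1]$ (where the multilinear maps $\Lambda_\pi$ and the sets of partitions are as defined in the context): $$A(g)=\sum_{n=1}^\infty\sum_{\pi\in\mathrm{PC}(n)}\Lambda_\pi(g,\ldots,g)g,\qquad B(g)=\sum_{n=1}^\infty\sum_{\pi\in\mathrm{PC}^+(n)}\Lambda_\pi(g,\ldots,g)g,$$ $$C(g)=\sum_{n=1}^\infty\sum_{\pi\in\mathrm{CO}(n)}\Lambda_\pi(g,\ldots,g)g,\qquad D(g)=1+\sum_{n=1}^\infty\sum_{\pi\in\mathcal{P}(n)}\Lambda_\pi(g,\ldots,g)g,$$ where in the $n$-th term $\Lambda_\pi$ is evaluated at $n-1$ copies of $g$. Then, as formal power series, $$B(g)=g+\tau(A(g))g+A(g),$$ $$C(g)=B\big(g/(1-\tau(g))\big),$$ $$D(g)=1+C(gD(g)).$$ Thus, letting $F(g)=gD(g)$ and letting $F^{\langle-1\rangle}$ be its inverse with respect to composition, $$F^{\langle-1\rangle}(h)=h\big(1+C(h)\big)^{-1}.$$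
   Context: Partitions. $[n]=\{1,\ldots,n\}$; $\mathcal{P}(n)$ is the set of all set partitions of $[n]$. For $\pi\in\mathcal{P}(n)$ write $i\overset{\pi}{\sim}j$ if $i,j$ lie in the same block of $\pi$. A subset $S\subseteq[n]$ splits $\pi$ if $S$ is a union of some of the blocks of $\pi$. Consider the conditions: (a) no proper subinterval $\{p+1,\ldots,p+q\}$ of $[n]$ (with $0\le p<p+q\le n$ and $q<n$) splits $\pi$; (b) $k\not\overset{\pi}{\sim}k+1$ for all $k\in[n-1]$; (c) $1\not\overset{\pi}{\sim}n$. $\mathrm{PC}(n)$ is the set of $\pi\in\mathcal{P}(n)$ satisfying (a), (b), (c); $\mathrm{PC}^+(n)$ is the set of those satisfying (a), (b); $\mathrm{CO}(n)$ is the set of those satisfying (a). The maps $\Lambda_\pi$. $C[0,1]$ is the algebra of continuous complex-valued functions on $[0,1]$. For $\pi\in\mathcal{P}(n)$, $\Lambda_\pi$ is the $\mathbb{C}$-multilinear map from $n-1$ copies of $C[0,1]$ to $C[0,1]$ defined as follows. Let $V_\pi$ be the real vector space of all $(t_0,t_1,\ldots,t_{n-1})\in\mathbb{R}^n$ such that, with the convention $t_n=t_0$, $$\sum_{k\in S}(t_{k-1}-t_k)=0\quad\text{for every block }S\in\pi.$$ It has dimension $n-|\pi|+1$. There is a subset $J\subseteq\{1,\ldots,n-1\}$ with $|J|=n-|\pi|$ such that $(t_0,(t_j)_{j\in J})$ are linear coordinates on $V_\pi$ (they determine the remaining $t_k$, which are integer linear combinations of them). For $g_1,\ldots,g_{n-1}\in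 C[0,1]$ and $x\in[0,1]$, set $$\Lambda_\pi(g_1,\ldots,g_{n-1})(x)=\int\prod_{k=1}^{n-1}g_k(t_k)\prod_{j\in J}dt_j,$$ where $t_0=x$, each $t_k$ with $k\notin J\cup\{0\}$ is expressed in terms of $x$ and $(t_j)_{j\in J}$, and the integral is with respect to Lebesgue measure over those $(t_j)_{j\in J}\in[0,1]^J$ for which all $t_k\in[0,1]$, $1\le k\le n-1$ (if $J=\emptyset$ there is no integration). This does not depend on the choice of $J$. For $n=1$, $\Lambda_{\{\{1\}\}}()=1$. Formal power series. A formal power series in $g$ is a formal sum $\sum_{n\ge0}f_n(g)$, where $f_n(g)=\varphi_n(g,\ldots,g)$ for an $n$-fold $\mathbb{C}$-multilinear map $\varphi_n:C[0,1]^n\to C[0,1]$ (for $n=0$, a constant element of $C[0,1]$); equality means equality of the homogeneous terms $f_n(g)$ in each degree $n$. Products are formed pointwise in $C[0,1]$ (and $\tau$ of a series termwise) and collected by degree, and inverses $(1-\tau(g))^{-1}$, $(1+C(h))^{-1}$ are given by the geometric series. If $G(g)=\sum_{k\ge1}G_k(g)$ has zero constant term, the composition is $f(G(g))=f_0+\sum_{n\ge1}\sum_{k_1,\ldots,k_n\ge1}\varphi_n(G_{k_1}(g),\ldots,G_{k_n}(g))$, collected by degree. The series $F$ has zero constant term and degree-one term $g$, so it has an inverse with respect to composition. *)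

theory Defs
  imports "HOL-Analysis.Analysis" "HOL-Library.Disjoint_Sets"
begin

section \<open>Set partitions\<close>

definition partitions :: "nat \<Rightarrow> nat set set set" where
  "partitions n = {\<pi>. partition_on {1..n} \<pi>}"

definition same_block :: "nat set set \<Rightarrow> nat \<Rightarrow> nat \<Rightarrow> bool" where
  "same_block \<pi> i j \<longleftrightarrow> (\<exists>S\<in>\<pi>. i \<in> S \<and> j \<in> S)"

definition splits :: "nat set \<Rightarrow> nat set set \<Rightarrow> bool" where
  "splits S \<pi> \<longleftrightarrow> (\<exists>T\<subseteq>\<pi>. S = \<Union>T)"

definition CO :: "nat \<Rightarrow> nat set set set" where
  "CO n = {\<pi> \<in> partitions n.
     \<forall>p q. p < p + q \<and> p + q \<le> n \<and> q < n \<longrightarrow> \<not> splits {p + 1..p + q} \<pi>}"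

definition PC_plus :: "nat \<Rightarrow> nat set set set" where
  "PC_plus n = {\<pi> \<in> CO n. \<forall>k\<in>{1..<n}. \<not> same_block \<pi> k (k + 1)}"

definition PC :: "nat \<Rightarrow> nat set set set" where
  "PC n = {\<pi> \<in> PC_plus n. \<not> same_block \<pi> 1 n}"


section \<open>The algebra of continuous functions on the unit interval\<close>

text \<open>An element of $C[0,1]$ is represented by its extension by zero to the real line, so that
  equality in $C[0,1]$ is equality of functions.\<close>

definition C01 :: "(real \<Rightarrow> complex) set" where
  "C01 = {f. continuous_on {0..1} f \<and> (\<forall>x. x \<notin> {0..1} \<longrightarrow> f x = 0)}"

definition const01 :: "complex \<Rightarrow> real \<Rightarrow> complex" where
  "const01 c = (\<lambda>x. if x \<in> {0..1} then c else 0)"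

definition trace01 :: "(real \<Rightarrow> complex) \<Rightarrow> complex" where
  "trace01 f = (LINT t:{0..1}|lborel. f t)"


section \<open>The maps $\Lambda_\pi$\<close>

text \<open>Vectors $(t_0,\ldots,t_{n-1})$ are functions on the naturals that vanish from $n$ on; the
  convention $t_n = t_0$ is expressed by reducing the index modulo $n$.\<close>

definition V :: "nat \<Rightarrow> nat set set \<Rightarrow> (nat \<Rightarrow> real) set" where
  "V n \<pi> = {t. (\<forall>k\<ge>n. t k = 0) \<and> (\<forall>S\<in>\<pi>. (\<Sum>k\<in>S. t (k - 1) - t (k mod n)) = 0)}"

definition coordinates :: "nat \<Rightarrow> nat set set \<Rightarrow> nat set \<Rightarrow> bool" where
  "coordinates n \<pi> J \<longleftrightarrow>
     J \<subseteq> {1..<n} \<and> card J = n - card \<pi> \<and>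
     (\<forall>x s. \<exists>!t. t \<in> V n \<pi> \<and> t 0 = x \<and> (\<forall>j\<in>J. t j = s j))"

definition V_point :: "nat \<Rightarrow> nat set set \<Rightarrow> nat set \<Rightarrow> real \<Rightarrow> (nat \<Rightarrow> real) \<Rightarrow> nat \<Rightarrow> real" where
  "V_point n \<pi> J x s = (THE t. t \<in> V n \<pi> \<and> t 0 = x \<and> (\<forall>j\<in>J. t j = s j))"

text \<open>The arguments $g_1,\ldots,g_{n-1}$ form a list, hence the index shift. The value does not
  depend on the coordinates \<open>J\<close> that are chosen.\<close>

definition Lambda ::
  "nat \<Rightarrow> nat set set \<Rightarrow> (real \<Rightarrow> complex) list \<Rightarrow> real \<Rightarrow> complex" where
  "Lambda n \<pi> gs x =
     (if x \<in> {0..1} then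
        (let J = (SOME J. coordinates n \<pi> J) in
         LINT s:{s \<in> J \<rightarrow>\<^sub>E {0..1}. \<forall>k\<in>{1..<n}. V_point n \<pi> J x s k \<in> {0..1}}
             |(\<Pi>\<^sub>M j\<in>J. lborel).
           (\<Prod>k\<in>{1..<n}. (gs ! (k - 1)) (V_point n \<pi> J x s k)))
      else 0)"


section \<open>Formal power series\<close>

text \<open>A series is given by a family of representing maps $\varphi_n$, whose $n$ arguments are
  passed as a list of length $n$; its term of degree $n$ is $f_n(g) = \varphi_n(g,\ldots,g)$.
  Different families can represent the same series, so equality of series is \<open>series_eq\<close>.\<close>

type_synonym series = "nat \<Rightarrow> (real \<Rightarrow> complex) list \<Rightarrow> real \<Rightarrow> complex"

definition multilinear :: "nat \<Rightarrow> ((real \<Rightarrow> complex) list \<Rightarrow> real \<Rightarrow> complex) \<Rightarrow> bool" where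
  "multilinear n \<phi> \<longleftrightarrow>
     (\<forall>gs. length gs = n \<and> set gs \<subseteq> C01 \<longrightarrow>
        \<phi> gs \<in> C01 \<and>
        (\<forall>i<n. \<forall>u\<in>C01. \<forall>v\<in>C01. \<forall>a b.
           \<phi> (gs[i := (\<lambda>y. a * u y + b * v y)]) =
             (\<lambda>y. a * \<phi> (gs[i := u]) y + b * \<phi> (gs[i := v]) y)))"

definition formal_series :: "series \<Rightarrow> bool" where
  "formal_series f \<longleftrightarrow> (\<forall>n. multilinear n (f n))"

definition series_term :: "series \<Rightarrow> nat \<Rightarrow> (real \<Rightarrow> complex) \<Rightarrow> real \<Rightarrow> complex" where
  "series_term f n g = f n (replicate n g)"

definition series_eq :: "series \<Rightarrow> series \<Rightarrow> bool" (infix "\<doteq>" 50) where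
  "f \<doteq> f' \<longleftrightarrow> (\<forall>n. \<forall>g\<in>C01. series_term f n g = series_term f' n g)"

definition s_one :: series where
  "s_one n gs = (if n = 0 then const01 1 else (\<lambda>x. 0))"

text \<open>The series $g$.\<close>

definition s_var :: series where
  "s_var n gs = (if n = 1 then hd gs else (\<lambda>x. 0))"

definition s_add :: "series \<Rightarrow> series \<Rightarrow> series" (infixl "\<oplus>" 65) where
  "(f \<oplus> f') n gs = (\<lambda>x. f n gs x + f' n gs x)"

definition s_uminus :: "series \<Rightarrow> series" where
  "s_uminus f n gs = (\<lambda>x. - f n gs x)"

definition s_mult :: "series \<Rightarrow> series \<Rightarrow> series" (infixl "\<otimes>" 70) where
  "(f \<otimes> f') n gs = (\<lambda>x. \<Sum>i\<le>n. f i (take i gs) x * f' (n - i) (drop i gs) x)"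

primrec s_power :: "series \<Rightarrow> nat \<Rightarrow> series" where
  "s_power f 0 = s_one"
| "s_power f (Suc k) = f \<otimes> s_power f k"

text \<open>The inverse $(1-f)^{-1} = \sum_{k\ge0} f^k$, for \<open>f\<close> with zero constant term. Powers with
  exponent \<open>k > n\<close> then have no term of degree \<open>n\<close>.\<close>

definition s_geometric :: "series \<Rightarrow> series" where
  "s_geometric f n gs = (\<lambda>x. \<Sum>k\<le>n. s_power f k n gs x)"

definition s_trace :: "series \<Rightarrow> series" where
  "s_trace f n gs = const01 (trace01 (f n gs))"

fun split_list_at :: "nat list \<Rightarrow> 'a list \<Rightarrow> 'a list list" where
  "split_list_at [] gs = []"
| "split_list_at (k # ks) gs = take k gs # split_list_at ks (drop k gs)"

text \<open>Composition $f(G(g))$, for \<open>G\<close> with zero constant term. The sum runs over all lists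
  $(k_1,\ldots,k_r)$ of positive numbers with sum $n$; the $i$-th argument of the map of degree
  $r$ is $G_{k_i}$ applied to the $i$-th of the consecutive segments of \<open>gs\<close> of lengths
  $k_1,\ldots,k_r$.\<close>

definition s_comp :: "series \<Rightarrow> series \<Rightarrow> series" (infixl "\<odot>" 75) where
  "(f \<odot> G) n gs =
     (\<lambda>x. \<Sum>ks\<in>{ks. sum_list ks = n \<and> 0 \<notin> set ks}.
        f (length ks) (map2 G ks (split_list_at ks gs)) x)"

lemma series_term_s_mult:
  "series_term (f \<otimes> f') n g x = (\<Sum>i\<le>n. series_term f i g x * series_term f' (n - i) g x)"
  unfolding series_term_def s_mult_def by (intro sum.cong) (auto simp: min_absorb1)

lemma series_term_s_comp:
  "series_term (f \<odot> G) n g x =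
     (\<Sum>ks\<in>{ks. sum_list ks = n \<and> 0 \<notin> set ks}. f (length ks) (map (\<lambda>k. series_term G k g) ks) x)"
proof -
  have "map2 G ks (split_list_at ks (replicate (sum_list ks) g)) =
      map (\<lambda>k. series_term G k g) ks" for ks
    by (induction ks) (simp_all add: series_term_def)
  then show ?thesis
    unfolding series_term_def[of "f \<odot> G"] s_comp_def by (intro sum.cong) auto
qed

definition zero_constant_term :: "series \<Rightarrow> bool" where
  "zero_constant_term f \<longleftrightarrow> f 0 [] = (\<lambda>x. 0)"

definition comp_inverse :: "series \<Rightarrow> series \<Rightarrow> bool" where
  "comp_inverse F G \<longleftrightarrow>
     formal_series G \<and> zero_constant_term G \<and> F \<odot> G \<doteq> s_var \<and> G \<odot> F \<doteq> s_var"


section \<open>The series of the theorem\<close>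

text \<open>The series $\sum_{n\ge1}\sum_{\pi\in P(n)}\Lambda_\pi(g,\ldots,g)g$.\<close>

definition partition_series :: "(nat \<Rightarrow> nat set set set) \<Rightarrow> series" where
  "partition_series P n gs =
     (\<lambda>x. if n = 0 then 0 else \<Sum>\<pi>\<in>P n. Lambda n \<pi> (butlast gs) x * last gs x)"

definition A_series :: series where
  "A_series = partition_series PC"

definition B_series :: series where
  "B_series = partition_series PC_plus"

definition C_series :: series where
  "C_series = partition_series CO"

definition D_series :: series where
  "D_series = s_one \<oplus> partition_series partitions"

definition F_series :: series where
  "F_series = s_var \<otimes> D_series"

end

theory Submission
  imports Defs "HOL-Computational_Algebra.Formal_Power_Series"
begin

text \<open>The value of \<open>\<Lambda>\<^sub>\<pi>\<close> is the integral over \<open>{t \<in> V\<^sub>\<pi>. t 0 = x}\<close> with respect to a measure that does not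
  depend on the coordinates: any two systems of coordinates are joined by exchanging one coordinate
  at a time, and each exchange is an affine substitution in one variable with slope \<open>1\<close> or \<open>-1\<close>.

  The three equations come from three reductions of a partition. A pair \<open>k \<sim> k + 1\<close> makes \<open>t k\<close> free and
  splits off a factor \<open>\<tau>(g)\<close>; a pair \<open>1 \<sim> n\<close> makes the integral independent of \<open>t 0\<close> and turns it into a
  trace; an interval \<open>{a + 1..a + i}\<close> that splits the partition contributes a value of \<open>D\<close>, multiplied to
  the argument in position \<open>a\<close>. Each reduction is applied from left to right, one position at a time,
  so that the composition sums unfold one summand at a time.

  Finally \<open>F = g D\<close> satisfies \<open>F = g (1 + C(F))\<close>. Composing with a right inverse \<open>G\<close> gives
  \<open>h = G(h) (1 + C(h))\<close>, which determines \<open>G\<close>.\<close>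

section \<open>Coordinates on the space of a partition\<close>

text \<open>\<open>Lambda\<close> integrates in coordinates picked by \<open>SOME\<close>, about
  which nothing is known beyond the defining property, so independence of the choice comes before
  any computation. The explicit choice \<open>std_coords\<close> is made with the reductions in
  mind: merging and closing add one index to the renumbered coordinates of the smaller partition,
  and insertion takes the union of two renumbered sets, so Fubini's theorem applies without a change
  of variables. Elements of \<open>C01\<close> vanish off the unit interval, hence the constraints
  on the t k are carried by the integrand and the integral runs over a full product of lines; the
  price is a jump at 0 and 1, which makes continuity in x an almost-everywhere argument. The factor
  g(x) counts as an n-th factor at t n = t 0, which puts all n positions on the same footing. Since
  \<open>\<doteq>\<close> compares diagonals only, while a composition evaluates its left series at
  lists of different terms, identities that are later composed with another series are proved for
  arbitrary argument lists.\<close>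

lemma V_sum:
  assumes "finite J" "\<And>j. j \<in> J \<Longrightarrow> f j \<in> V n \<pi>"
  shows "(\<lambda>k. \<Sum>j\<in>J. a j * f j k) \<in> V n \<pi>"
proof -
  have "(\<Sum>k\<in>S. (\<Sum>j\<in>J. a j * f j (k - 1)) - (\<Sum>j\<in>J. a j * f j (k mod n))) = 0" if "S \<in> \<pi>" for S
  proof -
    have "(\<Sum>k\<in>S. (\<Sum>j\<in>J. a j * f j (k - 1)) - (\<Sum>j\<in>J. a j * f j (k mod n)))
        = (\<Sum>k\<in>S. \<Sum>j\<in>J. a j * (f j (k - 1) - f j (k mod n)))"
      by (simp add: sum_subtractf right_diff_distrib)
    also have "\<dots> = (\<Sum>j\<in>J. a j * (\<Sum>k\<in>S. f j (k - 1) - f j (k mod n)))"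
      by (subst sum.swap) (simp add: sum_distrib_left)
    also have "\<dots> = 0"
      using assms(2) that by (intro sum.neutral) (auto simp: V_def)
    finally show ?thesis .
  qed
  then show ?thesis
    using assms(2) by (auto simp: V_def intro!: sum.neutral)
qed

lemma V_lin_comb:
  assumes "u \<in> V n \<pi>" "v \<in> V n \<pi>"
  shows "(\<lambda>k. a * u k + b * v k) \<in> V n \<pi>"
  using V_sum[of UNIV "\<lambda>j. if j then u else v" n \<pi> "\<lambda>j. if j then a else b"] assms
  by (simp add: UNIV_bool add.commute)

lemma partition_block_subset: "\<pi> \<in> partitions n \<Longrightarrow> S \<in> \<pi> \<Longrightarrow> S \<subseteq> {1..n}"
  by (auto simp: partitions_def partition_on_def)

text \<open>Subtracting a constant vector reduces an arbitrary base value t 0 = x to t 0 =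
  0.\<close>

lemma V_const:
  assumes "\<pi> \<in> partitions n"
  shows "(\<lambda>k. if k < n then c else 0) \<in> V n \<pi>"
proof -
  have "(\<Sum>k\<in>S. (if k - 1 < n then c else 0) - (if k mod n < n then c else 0)) = 0" if "S \<in> \<pi>" for S
  proof (rule sum.neutral, rule ballI)
    fix k assume "k \<in> S"
    then have "k \<in> {1..n}"
      using partition_block_subset[OF assms that] by blast
    then show "(if k - 1 < n then c else 0) - (if k mod n < n then c else 0) = 0"
      by auto
  qed
  then show ?thesis
    by (simp add: V_def)
qed

text \<open>The cardinality condition of \<open>coordinates\<close> is split off: expansion in a
  basis and exchange of indices rest on unique solvability alone.\<close>

definition free_coords :: "nat \<Rightarrow> nat set set \<Rightarrow> nat set \<Rightarrow> bool" where
  "free_coords n \<pi> J \<longleftrightarrow> J \<subseteq> {1..<n} \<and>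
     (\<forall>x s. \<exists>!t. t \<in> V n \<pi> \<and> t 0 = x \<and> (\<forall>j\<in>J. t j = s j))"

lemma coordinates_iff: "coordinates n \<pi> J \<longleftrightarrow> free_coords n \<pi> J \<and> card J = n - card \<pi>"
  by (auto simp: coordinates_def free_coords_def)

abbreviation unit_fun :: "nat \<Rightarrow> nat \<Rightarrow> real" where
  "unit_fun j \<equiv> (\<lambda>i. if i = j then 1 else 0)"

lemma free_coords_finite: "free_coords n \<pi> J \<Longrightarrow> finite J"
  by (auto simp: free_coords_def intro: finite_subset)

lemma V_point_spec:
  assumes "free_coords n \<pi> J"
  shows "V_point n \<pi> J x s \<in> V n \<pi>" "V_point n \<pi> J x s 0 = x"
    "\<And>j. j \<in> J \<Longrightarrow> V_point n \<pi> J x s j = s j"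
proof -
  have "\<exists>!t. t \<in> V n \<pi> \<and> t 0 = x \<and> (\<forall>j\<in>J. t j = s j)"
    using assms by (auto simp: free_coords_def)
  from theI'[OF this] show "V_point n \<pi> J x s \<in> V n \<pi>" "V_point n \<pi> J x s 0 = x"
    "\<And>j. j \<in> J \<Longrightarrow> V_point n \<pi> J x s j = s j"
    by (auto simp: V_point_def)
qed

lemma V_point_eqI:
  assumes "free_coords n \<pi> J" "t \<in> V n \<pi>" "t 0 = x" "\<And>j. j \<in> J \<Longrightarrow> t j = s j"
  shows "V_point n \<pi> J x s = t"
proof -
  have "\<exists>!t. t \<in> V n \<pi> \<and> t 0 = x \<and> (\<forall>j\<in>J. t j = s j)"
    using assms(1) by (auto simp: free_coords_def)
  then show ?thesis
    using assms(2-4) V_point_spec[OF assms(1)] by (metis (no_types, lifting))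
qed

lemma V_point_cong:
  assumes "\<And>j. j \<in> J \<Longrightarrow> s j = s' j"
  shows "V_point n \<pi> J x s = V_point n \<pi> J x s'"
  unfolding V_point_def using assms by (metis (no_types, lifting))

text \<open>The vectors \<open>V_point n \<pi> J 0 (unit_fun j)\<close> are the basis of the
  subspace t 0 = 0 that is dual to the coordinates J. Both sides have the same coordinates, so
  uniqueness identifies them.\<close>

lemma V_expand0:
  assumes J: "free_coords n \<pi> J" and t: "t \<in> V n \<pi>" "t 0 = 0"
  shows "t k = (\<Sum>j\<in>J. t j * V_point n \<pi> J 0 (unit_fun j) k)"
proof -
  note sp = V_point_spec[OF J]
  have fin: "finite J" using J by (rule free_coords_finite)
  let ?u = "\<lambda>k. \<Sum>j\<in>J. t j * V_point n \<pi> J 0 (unit_fun j) k"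
  have "V_point n \<pi> J 0 t = ?u"
  proof (rule V_point_eqI[OF J])
    show "?u \<in> V n \<pi>" by (rule V_sum[OF fin]) (simp add: sp)
    show "?u i = t i" if "i \<in> J" for i
    proof -
      have "?u i = (\<Sum>j\<in>J. t j * (if i = j then 1 else 0))"
        using that by (intro sum.cong) (simp_all add: sp)
      also have "\<dots> = t i"
        using fin that by (simp add: if_distrib cong: if_cong)
      finally show ?thesis .
    qed
  qed (simp add: sp)
  moreover have "V_point n \<pi> J 0 t = t"
    by (rule V_point_eqI[OF J]) (use t in auto)
  ultimately have "t = ?u" by simp
  then show ?thesis by (rule fun_cong)
qed

text \<open>The constant vector x is subtracted and the difference expanded in the dual basis. The
  formula yields measurability in s as well as the slope in each single coordinate.\<close>

lemma V_point_affine: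
  assumes \<pi>: "\<pi> \<in> partitions n" and J: "free_coords n \<pi> J" and k: "k < n"
  shows "V_point n \<pi> J x s k = x + (\<Sum>j\<in>J. (s j - x) * V_point n \<pi> J 0 (unit_fun j) k)"
proof -
  note sp = V_point_spec[OF J]
  define t where "t = V_point n \<pi> J x s"
  define w where "w = (\<lambda>k. 1 * t k + (-1) * (if k < n then x else 0))"
  have "w \<in> V n \<pi>"
    unfolding w_def t_def by (rule V_lin_comb) (simp_all add: sp V_const[OF \<pi>])
  moreover have "w 0 = 0"
    using k by (simp add: w_def t_def sp)
  ultimately have "w k = (\<Sum>j\<in>J. w j * V_point n \<pi> J 0 (unit_fun j) k)"
    by (rule V_expand0[OF J])
  also have "\<dots> = (\<Sum>j\<in>J. (s j - x) * V_point n \<pi> J 0 (unit_fun j) k)"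
    using J by (intro sum.cong) (auto simp: w_def t_def sp free_coords_def)
  finally show ?thesis
    using k by (simp add: w_def t_def)
qed

section \<open>Linear algebra of the block equations: integrality and exchange\<close>

text \<open>Gaussian elimination: each step uses up one equation and at most one unknown.\<close>

lemma homogeneous_system_nontrivial:
  fixes a :: "'b \<Rightarrow> 'c \<Rightarrow> real"
  assumes "finite B" "finite N" "card B < card N"
  shows "\<exists>w. (\<exists>i\<in>N. w i \<noteq> 0) \<and> (\<forall>i. i \<notin> N \<longrightarrow> w i = 0) \<and> (\<forall>b\<in>B. (\<Sum>i\<in>N. a b i * w i) = 0)"
  using assms
proof (induction B arbitrary: N a rule: finite_induct)
  case empty
  then obtain i where "i \<in> N" by (metis card_gt_0_iff card.empty ex_in_conv)
  then show ?case by (intro exI[of _ "\<lambda>j. if j = i then 1 else 0"]) auto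
next
  case (insert b B)
  show ?case
  proof (cases "\<forall>i\<in>N. a b i = 0")
    case True
    have "card B < card N"
      using insert.prems insert.hyps by simp
    from insert.IH[OF insert.prems(1) this, of a] obtain w where
      w: "\<exists>i\<in>N. w i \<noteq> 0" "\<forall>i. i \<notin> N \<longrightarrow> w i = 0" "\<forall>b\<in>B. (\<Sum>i\<in>N. a b i * w i) = 0"
      by blast
    moreover have "(\<Sum>i\<in>N. a b i * w i) = 0"
      using True by (intro sum.neutral) auto
    ultimately show ?thesis
      by (intro exI[of _ w]) simp
  next
    case False
    then obtain k where k: "k \<in> N" "a b k \<noteq> 0" by blast
    \<comment> \<open>Equation b eliminates the unknown k from the other equations.\<close>
    define c where "c = (\<lambda>b' i. a b' i - a b' k * a b i / a b k)"
    have "card B < card (N - {k})"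
      using insert k by simp
    with insert.prems have "finite (N - {k})" "card B < card (N - {k})"
      by simp_all
    from insert.IH[OF this, of c] obtain w where
      w: "\<exists>i\<in>N - {k}. w i \<noteq> 0" "\<And>i. i \<notin> N - {k} \<Longrightarrow> w i = 0"
         "\<And>b'. b' \<in> B \<Longrightarrow> (\<Sum>i\<in>N - {k}. c b' i * w i) = 0"
      by auto
    \<comment> \<open>The eliminated unknown receives the value that equation b forces.\<close>
    define w' where "w' = w(k := - (\<Sum>i\<in>N - {k}. a b i * w i) / a b k)"
    have split: "(\<Sum>i\<in>N. a b' i * w' i) = a b' k * w' k + (\<Sum>i\<in>N - {k}. a b' i * w i)" for b'
    proof -
      have "(\<Sum>i\<in>N - {k}. a b' i * w' i) = (\<Sum>i\<in>N - {k}. a b' i * w i)"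
        by (intro sum.cong) (auto simp: w'_def)
      then show ?thesis
        using sum.remove[OF insert.prems(1) k(1), of "\<lambda>i. a b' i * w' i"] by simp
    qed
    have "(\<Sum>i\<in>N. a b' i * w' i) = 0" if "b' \<in> B" for b'
    proof -
      have "0 = (\<Sum>i\<in>N - {k}. a b' i * w i - a b' k / a b k * (a b i * w i))"
        using w(3)[OF that] by (simp add: c_def algebra_simps)
      also have "\<dots> = (\<Sum>i\<in>N - {k}. a b' i * w i) - a b' k / a b k * (\<Sum>i\<in>N - {k}. a b i * w i)"
        by (simp add: sum_subtractf sum_distrib_left)
      finally show ?thesis
        unfolding split by (simp add: w'_def)
    qed
    moreover have "(\<Sum>i\<in>N. a b i * w' i) = 0"
      unfolding split using k by (simp add: w'_def)
    moreover have "\<exists>i\<in>N. w' i \<noteq> 0" "\<And>i. i \<notin> N \<Longrightarrow> w' i = 0"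
      using w(1,2) k by (auto simp: w'_def)
    ultimately show ?thesis by (intro exI[of _ w']) auto
  qed
qed

text \<open>Entry i is viewed as an edge from the block of i to the block of i + 1; the right side
  is the row of the signed incidence matrix at the vertex S. The assumption \<open>t 0 = 0\<close>
  disposes of the wrap-around at k = n.\<close>

lemma V_sum_eq:
  assumes "S \<subseteq> {1..n}" "\<And>k. n \<le> k \<Longrightarrow> t k = (0::real)" "t 0 = 0"
  shows "(\<Sum>k\<in>S. t (k - 1) - t (k mod n)) =
    (\<Sum>i<n. (of_bool (Suc i \<in> S) - of_bool (i \<in> S)) * t i)"
proof -
  have fin: "finite S" using assms(1) finite_subset by blast
  have "(\<Sum>k\<in>S. t (k - 1)) = (\<Sum>i<n. of_bool (Suc i \<in> S) * t i)"
  proof -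
    have "(\<Sum>k\<in>S. t (k - 1)) = (\<Sum>i\<in>{i\<in>{..<n}. Suc i \<in> S}. t i)"
      using assms(1) by (intro sum.reindex_bij_witness[of _ Suc "\<lambda>k. k - 1"]) (auto simp: subset_iff)
    also have "\<dots> = (\<Sum>i<n. if Suc i \<in> S then t i else 0)"
      by (rule sum.inter_filter) simp
    also have "\<dots> = (\<Sum>i<n. of_bool (Suc i \<in> S) * t i)"
      by (intro sum.cong) auto
    finally show ?thesis .
  qed
  moreover have "(\<Sum>k\<in>S. t (k mod n)) = (\<Sum>i<n. of_bool (i \<in> S) * t i)"
  proof -
    have "(\<Sum>k\<in>S. t (k mod n)) = (\<Sum>k\<in>S \<inter> {..<n}. t k)"
    proof (intro sum.mono_neutral_cong_right ballI)
      fix k assume "k \<in> S - S \<inter> {..<n}"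
      then have "k = n" using assms(1) by (auto simp: subset_iff)
      then show "t (k mod n) = 0" using assms(3) by simp
    qed (use fin in auto)
    also have "\<dots> = (\<Sum>i\<in>{i\<in>{..<n}. i \<in> S}. t i)"
      by (intro sum.cong) auto
    also have "\<dots> = (\<Sum>i<n. if i \<in> S then t i else 0)"
      by (rule sum.inter_filter) simp
    also have "\<dots> = (\<Sum>i<n. of_bool (i \<in> S) * t i)"
      by (intro sum.cong) auto
    finally show ?thesis .
  qed
  ultimately show ?thesis
    by (simp add: sum_subtractf left_diff_distrib)
qed

lemma partition_unique_block:
  assumes "\<pi> \<in> partitions n" "i \<in> {1..n}"
  shows "\<exists>!S. S \<in> \<pi> \<and> i \<in> S"
proof -
  from assms have "i \<in> \<Union>\<pi>"
    by (auto simp: partitions_def partition_on_def)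
  moreover have "S = S'" if "S \<in> \<pi>" "S' \<in> \<pi>" "i \<in> S" "i \<in> S'" for S S'
    using assms(1) that by (auto simp: partitions_def partition_on_def disjoint_def)
  ultimately show ?thesis by blast
qed

lemma finite_partition: "\<pi> \<in> partitions n \<Longrightarrow> finite \<pi>"
  using finite_elements[of "{1..n}" \<pi>] by (simp add: partitions_def)

lemma sum_partition_of_bool:
  assumes "\<pi> \<in> partitions n" "i \<in> {1..n}"
  shows "(\<Sum>S\<in>\<pi>. of_bool (i \<in> S) :: real) = 1"
proof -
  obtain S where S: "S \<in> \<pi>" "i \<in> S" "\<And>S'. S' \<in> \<pi> \<Longrightarrow> i \<in> S' \<Longrightarrow> S' = S"
    using partition_unique_block[OF assms] by blast
  have "(\<Sum>S'\<in>\<pi>. of_bool (i \<in> S') :: real) = (\<Sum>S'\<in>\<pi>. if S' = S then 1 else 0)"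
  proof (rule sum.cong[OF refl])
    fix S' assume "S' \<in> \<pi>"
    then have "i \<in> S' \<longleftrightarrow> S' = S" using S by blast
    then show "of_bool (i \<in> S') = (if S' = S then 1 else 0 :: real)" by simp
  qed
  then show ?thesis using S(1) finite_partition[OF assms(1)] by simp
qed

text \<open>If the indices \<open>N\<close> of the non-integral entries of \<open>t\<close> are edges of the graph whose vertices are the
  blocks, then no vertex has degree one in \<open>N\<close>, as its equation would make the entry integral. So \<open>N\<close>
  touches at most as many vertices as it has edges, and since the equations add up to zero there is a
  nonzero element of \<open>V\<close> supported on \<open>N\<close>. It vanishes on all coordinates: a contradiction.\<close>

lemma V_integral:
  assumes \<pi>: "\<pi> \<in> partitions n" and J: "free_coords n \<pi> J"
    and t: "t \<in> V n \<pi>" "t 0 = 0" "\<And>j. j \<in> J \<Longrightarrow> t j \<in> \<int>"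
  shows "t k \<in> \<int>"
proof (rule ccontr)
  assume "t k \<notin> \<int>"
  define N where "N = {i. t i \<notin> \<int>}"
  have t0: "t i = 0" if "n \<le> i" for i
    using t(1) that by (simp add: V_def)
  have N_sub: "N \<subseteq> {1..<n}"
  proof
    fix i assume "i \<in> N"
    then have "t i \<noteq> 0" by (auto simp: N_def)
    then have "i \<noteq> 0" "\<not> n \<le> i" using t(2) t0[of i] by (cases "i = 0"; force)+
    then show "i \<in> {1..<n}" unfolding atLeastLessThan_iff by linarith
  qed
  then have finN: "finite N" by (rule finite_subset) simp
  have "k \<in> N" using \<open>t k \<notin> \<int>\<close> by (simp add: N_def)
  note fin\<pi> = finite_partition[OF \<pi>]
  define a :: "nat set \<Rightarrow> nat \<Rightarrow> real" where "a = (\<lambda>S i. of_bool (Suc i \<in> S) - of_bool (i \<in> S))"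
  \<comment> \<open>The vertices touched by N. A loop, with i and i + 1 in one block, has
    coefficient 0 and touches none.\<close>
  define B where "B = {S \<in> \<pi>. \<exists>i\<in>N. a S i \<noteq> 0}"
  have finB: "finite B" using fin\<pi> by (simp add: B_def)
  have deg: "2 \<le> card {i \<in> N. a S i \<noteq> 0}" if S: "S \<in> B" for S
  proof (rule ccontr)
    assume "\<not> 2 \<le> card {i \<in> N. a S i \<noteq> 0}"
    obtain i where i: "i \<in> N" "a S i \<noteq> 0" using S by (auto simp: B_def)
    have "card {i \<in> N. a S i \<noteq> 0} \<le> Suc 0"
      using \<open>\<not> 2 \<le> _\<close> by simp
    then have un: "j = i" if "j \<in> N" "a S j \<noteq> 0" for j
      using i that finN by (auto simp: card_le_Suc0_iff_eq)
    have "(\<Sum>i<n. a S i * t i) = 0"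
      using V_sum_eq[OF partition_block_subset[OF \<pi>], of S t] S t t0 by (auto simp: B_def V_def a_def)
    moreover have "(\<Sum>i<n. a S i * t i) = (\<Sum>j\<in>N. a S j * t j) + (\<Sum>j\<in>{..<n} - N. a S j * t j)"
    proof -
      have "N \<subseteq> {..<n}" using N_sub by auto
      from sum.subset_diff[OF this, of "\<lambda>j. a S j * t j"] show ?thesis by (simp add: add.commute)
    qed
    moreover have "(\<Sum>j\<in>N. a S j * t j) = a S i * t i"
    proof -
      have "(\<Sum>j\<in>N - {i}. a S j * t j) = 0"
        using un by (intro sum.neutral ballI) (metis DiffD1 DiffD2 insertI1 mult_zero_left)
      then show ?thesis by (simp add: sum.remove[OF finN i(1)])
    qed
    moreover have "(\<Sum>j\<in>{..<n} - N. a S j * t j) \<in> \<int>"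
      by (intro Ints_sum Ints_mult) (auto simp: a_def N_def)
    ultimately have "a S i * t i \<in> \<int>"
      by (metis Ints_minus add_eq_0_iff2)
    moreover have "a S i = 1 \<or> a S i = -1"
      using i(2) by (auto simp: a_def)
    ultimately have "t i \<in> \<int>" by (auto simp: minus_in_Ints_iff)
    then show False using i(1) by (simp add: N_def)
  qed
  have ends: "card {S \<in> B. a S i \<noteq> 0} \<le> 2" if i: "i \<in> N" for i
  proof -
    have "i \<in> {1..n}" "Suc i \<in> {1..n}" using i N_sub by auto
    then obtain S1 S2 where "\<And>S. S \<in> \<pi> \<Longrightarrow> i \<in> S \<Longrightarrow> S = S1" "\<And>S. S \<in> \<pi> \<Longrightarrow> Suc i \<in> S \<Longrightarrow> S = S2"
      using partition_unique_block[OF \<pi>] by metis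
    then have "{S \<in> B. a S i \<noteq> 0} \<subseteq> {S1, S2}"
      by (auto simp: B_def a_def)
    from card_mono[OF _ this] show ?thesis
      by (simp add: card_insert_if split: if_splits)
  qed
  \<comment> \<open>Double counting of incidences: every vertex of B has at least two edges, every
    edge at most two ends.\<close>
  have "(\<Sum>S\<in>B. 2) \<le> (\<Sum>S\<in>B. card {i \<in> N. a S i \<noteq> 0})"
    using deg by (rule sum_mono)
  also have "\<dots> = (\<Sum>i\<in>N. card {S \<in> B. a S i \<noteq> 0})"
    using finB finN by (intro sum_multicount_gen) auto
  also have "\<dots> \<le> (\<Sum>i\<in>N. 2)"
    using ends by (rule sum_mono)
  finally have card_le: "card B \<le> card N" by simp
  \<comment> \<open>The coefficients of each entry add up to 0 over all blocks, so one equation may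
    be dropped, which leaves strictly fewer equations than unknowns. If B is empty,
    \<open>k \<in> N\<close> provides the strict inequality.\<close>
  obtain B' S0 where B': "B' \<subseteq> B" "card B' < card N" "B - B' \<subseteq> {S0}"
  proof (cases "B = {}")
    case True
    then show thesis using that[of "{}"] \<open>k \<in> N\<close> finN by (auto simp: card_gt_0_iff)
  next
    case False
    then obtain S where "S \<in> B" by blast
    then have "card (B - {S}) < card B" by (rule card_Diff1_less[OF finB])
    with card_le have "card (B - {S}) < card N" by simp
    then show thesis by (intro that[of "B - {S}" S]) auto
  qed
  have "finite B'" using B'(1) finB by (rule finite_subset)
  from homogeneous_system_nontrivial[OF this finN B'(2), of a]
  obtain w where w: "\<exists>i\<in>N. w i \<noteq> 0" "\<And>i. i \<notin> N \<Longrightarrow> w i = 0"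
    "\<And>S. S \<in> B' \<Longrightarrow> (\<Sum>i\<in>N. a S i * w i) = 0"
    by blast
  have zero_off: "(\<Sum>i\<in>N. a S i * w i) = 0" if "S \<in> \<pi>" "S \<noteq> S0" for S
  proof (cases "S \<in> B")
    case True
    then show ?thesis using w(3) B'(3) that by blast
  next
    case False
    then show ?thesis using that by (auto simp: B_def intro!: sum.neutral)
  qed
  have total: "(\<Sum>S\<in>\<pi>. \<Sum>i\<in>N. a S i * w i) = 0"
  proof (subst sum.swap, rule sum.neutral, rule ballI)
    fix i assume "i \<in> N"
    then have "i \<in> {1..n}" "Suc i \<in> {1..n}" using N_sub by auto
    then have "(\<Sum>S\<in>\<pi>. a S i) = 0"
      by (simp add: a_def sum_subtractf sum_partition_of_bool[OF \<pi>] del: sum_of_bool_eq)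
    then show "(\<Sum>S\<in>\<pi>. a S i * w i) = 0"
      by (simp flip: sum_distrib_right)
  qed
  have all0: "(\<Sum>i\<in>N. a S i * w i) = 0" if S: "S \<in> \<pi>" for S
  proof (cases "S = S0")
    case True
    have "(\<Sum>S\<in>\<pi>. \<Sum>i\<in>N. a S i * w i) = (\<Sum>i\<in>N. a S i * w i)"
      using True zero_off by (subst sum.remove[OF fin\<pi> S]) (auto intro!: sum.neutral)
    then show ?thesis using total by simp
  qed (use zero_off S in blast)
  have wV: "w \<in> V n \<pi>"
  proof -
    have w0: "w i = 0" if "n \<le> i" for i
      using w(2) N_sub that by (metis atLeastLessThan_iff leD subsetD)
    moreover have "w 0 = 0"
      using w(2) N_sub by (metis atLeastLessThan_iff not_one_le_zero subsetD)
    moreover have "(\<Sum>i<n. a S i * w i) = (\<Sum>i\<in>N. a S i * w i)" for S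
      using N_sub w(2) by (intro sum.mono_neutral_right) auto
    ultimately show ?thesis
      using V_sum_eq[OF partition_block_subset[OF \<pi>], of _ w] all0 by (auto simp: V_def a_def)
  qed
  have "w i = 0" for i
  proof -
    have "w 0 = 0"
      using w(2) N_sub by (metis atLeastLessThan_iff not_one_le_zero subsetD)
    moreover have "w j = 0" if "j \<in> J" for j
      using w(2) t(3)[OF that] by (simp add: N_def)
    ultimately show ?thesis
      using V_expand0[OF J wV, of i] by simp
  qed
  then show False using w(1) by simp
qed

text \<open>The coefficients of the change of coordinates and of its inverse are both integers.\<close>

lemma free_coords_swap_abs:
  assumes \<pi>: "\<pi> \<in> partitions n"
    and J: "free_coords n \<pi> (insert j L)" and K: "free_coords n \<pi> (insert k L)"
    and "j \<notin> L" "k \<notin> L"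
  shows "\<bar>V_point n \<pi> (insert j L) 0 (unit_fun j) k\<bar> = 1"
proof -
  define v where "v = V_point n \<pi> (insert j L) 0 (unit_fun j)"
  define w where "w = V_point n \<pi> (insert k L) 0 (unit_fun k)"
  note v = V_point_spec[OF J, where x = 0 and s = "unit_fun j", folded v_def]
  note w = V_point_spec[OF K, where x = 0 and s = "unit_fun k", folded w_def]
  have vi: "v i \<in> \<int>" for i
    by (rule V_integral[OF \<pi> J v(1,2)]) (use v in auto)
  have wi: "w i \<in> \<int>" for i
    by (rule V_integral[OF \<pi> K w(1,2)]) (use w in auto)
  \<comment> \<open>The vector v vanishes on L, so only the index k survives in the expansion. This
    gives \<open>v k * w j = 1\<close> with both factors integers.\<close>
  have "v j = (\<Sum>i\<in>insert k L. v i * V_point n \<pi> (insert k L) 0 (unit_fun i) j)"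
    by (rule V_expand0[OF K v(1,2)])
  also have "\<dots> = v k * w j"
    using assms(4,5) v(3) free_coords_finite[OF K]
    by (subst sum.insert) (auto simp: w_def intro!: sum.neutral)
  finally have "v k * w j = 1" using v(3)[of j] by simp
  moreover obtain p q where "v k = of_int p" "w j = of_int q"
    using vi wi by (metis Ints_cases)
  ultimately have "of_int (p * q) = (1::real)" by simp
  then have "p * q = 1" by linarith
  then have "\<bar>p\<bar> = 1" by (auto simp: zmult_eq_1_iff)
  then show ?thesis
    using \<open>v k = of_int p\<close> by (simp add: v_def flip: of_int_abs)
qed

text \<open>Steinitz exchange. The vector w dual to k in K has entry 1 at k, so in its expansion
  over J some index j has both \<open>w j\<close> and the k-th entry of its own dual vector nonzero.
  The former forces j out of K, since w vanishes on the rest of K; the latter allows k to replace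
  j.\<close>

lemma free_coords_exchange:
  assumes \<pi>: "\<pi> \<in> partitions n"
    and J: "free_coords n \<pi> J" and K: "free_coords n \<pi> K" and k: "k \<in> K - J"
  shows "\<exists>j\<in>J - K. free_coords n \<pi> (insert k (J - {j}))"
proof -
  note spJ = V_point_spec[OF J] and spK = V_point_spec[OF K]
  have finJ: "finite J" using J by (rule free_coords_finite)
  define w where "w = V_point n \<pi> K 0 (unit_fun k)"
  have "w k = (\<Sum>j\<in>J. w j * V_point n \<pi> J 0 (unit_fun j) k)"
    unfolding w_def by (rule V_expand0[OF J]) (simp_all add: spK)
  moreover have "w k = 1" using k by (simp add: w_def spK)
  ultimately obtain j where j: "j \<in> J" "w j \<noteq> 0" "V_point n \<pi> J 0 (unit_fun j) k \<noteq> 0"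
    by (metis (no_types, lifting) mult_eq_0_iff sum.neutral zero_neq_one)
  have "j \<notin> K"
  proof
    assume "j \<in> K"
    then have "w j = unit_fun k j" by (simp only: w_def spK)
    then show False using j(1,2) k by (auto split: if_splits)
  qed
  define v where "v = V_point n \<pi> J 0 (unit_fun j)"
  have v: "v \<in> V n \<pi>" "v 0 = 0" "v j = 1" "\<And>i. i \<in> J - {j} \<Longrightarrow> v i = 0" "v k \<noteq> 0"
    using j by (simp_all add: v_def spJ)
  have "free_coords n \<pi> (insert k (J - {j}))"
    unfolding free_coords_def
  proof (intro conjI allI)
    show "insert k (J - {j}) \<subseteq> {1..<n}"
      using J K k by (auto simp: free_coords_def)
    fix x and s :: "nat \<Rightarrow> real"
    define u where "u = V_point n \<pi> J x s"
    have u: "u \<in> V n \<pi>" "u 0 = x" "\<And>i. i \<in> J \<Longrightarrow> u i = s i"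
      by (simp_all add: u_def spJ)
    \<comment> \<open>As v vanishes on \<open>J - {j}\<close>, adding a multiple of it corrects the
      entry at k and leaves the other coordinates alone.\<close>
    define t where "t = (\<lambda>i. 1 * u i + ((s k - u k) / v k) * v i)"
    have "t \<in> V n \<pi>"
      unfolding t_def by (rule V_lin_comb) (fact u(1) v(1))+
    then have t: "t \<in> V n \<pi>" "t 0 = x" "\<And>i. i \<in> insert k (J - {j}) \<Longrightarrow> t i = s i"
      using u v by (auto simp: t_def)
    show "\<exists>!t. t \<in> V n \<pi> \<and> t 0 = x \<and> (\<forall>j\<in>insert k (J - {j}). t j = s j)"
    proof (rule ex1I[of _ t])
      show "t \<in> V n \<pi> \<and> t 0 = x \<and> (\<forall>j\<in>insert k (J - {j}). t j = s j)"
        using t by blast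
      fix t' assume t': "t' \<in> V n \<pi> \<and> t' 0 = x \<and> (\<forall>j\<in>insert k (J - {j}). t' j = s j)"
      define d where "d = (\<lambda>i. 1 * t' i + (-1) * t i)"
      have dV: "d \<in> V n \<pi>" unfolding d_def by (rule V_lin_comb) (use t t' in auto)
      have d0: "d 0 = 0" "\<And>i. i \<in> insert k (J - {j}) \<Longrightarrow> d i = 0"
        unfolding d_def using t(2,3) t' by (simp, metis add.right_inverse mult_1 mult_minus1)
      \<comment> \<open>The difference d vanishes on \<open>J - {j}\<close> and is thus a multiple
        of v; since \<open>d k = 0\<close> and \<open>v k \<noteq> 0\<close>, the multiple is
        zero.\<close>
      have d: "d i = d j * v i" for i
      proof -
        have "d i = (\<Sum>l\<in>J. d l * V_point n \<pi> J 0 (unit_fun l) i)"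
          by (rule V_expand0[OF J dV d0(1)])
        also have "\<dots> = d j * v i"
          using d0 by (subst sum.remove[OF finJ j(1)]) (auto simp: v_def intro!: sum.neutral)
        finally show ?thesis .
      qed
      from d[of k] d0(2)[of k] v(5) have "d j = 0" by simp
      then have "t' i = t i" for i using d[of i] by (simp add: d_def)
      then show "t' = t" by (rule ext)
    qed
  qed
  then show ?thesis using j(1) \<open>j \<notin> K\<close> by blast
qed

text \<open>The indices \<open>k\<close> for which \<open>k + 1\<close> is not the least element of its block. The equation of a block
  with least element \<open>k + 1 > 1\<close> then expresses \<open>t k\<close> by entries of higher index and \<open>t 0\<close>.\<close>

definition std_coords :: "nat \<Rightarrow> nat set set \<Rightarrow> nat set" where
  "std_coords n \<pi> = {k \<in> {1..<n}. \<exists>i\<in>{1..k}. same_block \<pi> i (k + 1)}"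

lemma partition_block_eq:
  assumes "\<pi> \<in> partitions n" "S \<in> \<pi>" "S' \<in> \<pi>" "i \<in> S" "i \<in> S'"
  shows "S = S'"
  using assms by (auto simp: partitions_def partition_on_def disjoint_def)

lemma same_block_iff:
  assumes "\<pi> \<in> partitions n" "S \<in> \<pi>" "i \<in> S"
  shows "same_block \<pi> i j \<longleftrightarrow> j \<in> S"
proof
  assume "same_block \<pi> i j"
  then obtain S' where "S' \<in> \<pi>" "i \<in> S'" "j \<in> S'" by (auto simp: same_block_def)
  moreover have "S = S'"
    by (rule partition_block_eq[OF assms(1,2) \<open>S' \<in> \<pi>\<close> assms(3) \<open>i \<in> S'\<close>])
  ultimately show "j \<in> S" by blast
qed (use assms in \<open>auto simp: same_block_def\<close>)

text \<open>The omitted indices correspond to the blocks that do not contain 1, through S \<mapsto>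
  \<open>Min S - 1\<close>.\<close>

lemma card_std_coords:
  assumes \<pi>: "\<pi> \<in> partitions n" and n: "0 < n"
  shows "card ({1..<n} - std_coords n \<pi>) = card \<pi> - 1"
proof -
  obtain S1 where S1: "S1 \<in> \<pi>" "1 \<in> S1"
    using partition_unique_block[OF \<pi>, of 1] n by auto
  have fin: "finite S" "S \<noteq> {}" if "S \<in> \<pi>" for S
    using \<pi> that partition_block_subset[OF \<pi> that] finite_subset
    by (auto simp: partitions_def partition_on_def)
  note eq = partition_block_eq[OF \<pi>]
  have "bij_betw (\<lambda>S. Min S - 1) (\<pi> - {S1}) ({1..<n} - std_coords n \<pi>)"
    unfolding bij_betw_def
  proof (rule conjI[OF inj_onI equalityI[OF subsetI subsetI]])
    fix S S' assume S: "S \<in> \<pi> - {S1}" "S' \<in> \<pi> - {S1}" "Min S - 1 = Min S' - 1"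
    have m: "Min S \<in> S" "Min S' \<in> S'" using fin S by auto
    then have "1 \<le> Min S" "1 \<le> Min S'"
      using partition_block_subset[OF \<pi>] S(1,2) by fastforce+
    with S(3) have "Min S = Min S'" by linarith
    with m S(1,2) show "S = S'" using eq[of S S' "Min S"] by auto
  next
    fix k assume "k \<in> (\<lambda>S. Min S - 1) ` (\<pi> - {S1})"
    then obtain S where S: "S \<in> \<pi>" "S \<noteq> S1" "k = Min S - 1" by blast
    have m: "Min S \<in> S" using fin S by auto
    have "1 \<notin> S" using eq[OF S(1) S1(1) _ S1(2)] S(2) by blast
    then have "Min S \<in> {2..n}"
      using m partition_block_subset[OF \<pi> S(1)] by (cases "Min S = 1") force+
    then have k: "k \<in> {1..<n}" "k + 1 = Min S" using S(3) by auto
    have "\<not> same_block \<pi> i (k + 1)" if "i \<in> {1..k}" for i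
    proof
      assume "same_block \<pi> i (k + 1)"
      then obtain S' where "S' \<in> \<pi>" "i \<in> S'" "k + 1 \<in> S'" by (auto simp: same_block_def)
      then have "i \<in> S" using eq[of S' S "k + 1"] m k S(1) by metis
      then have "Min S \<le> i" using fin[OF S(1)] by simp
      then show False using k that by simp
    qed
    then show "k \<in> {1..<n} - std_coords n \<pi>" using k(1) by (auto simp: std_coords_def)
  next
    fix k assume k: "k \<in> {1..<n} - std_coords n \<pi>"
    then obtain S where S: "S \<in> \<pi>" "k + 1 \<in> S"
      using partition_unique_block[OF \<pi>, of "k + 1"] by auto
    have ge: "k + 1 \<le> i" if "i \<in> S" for i
    proof (rule ccontr)
      assume "\<not> k + 1 \<le> i"
      moreover have "1 \<le> i" using partition_block_subset[OF \<pi> S(1)] that by auto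
      ultimately have "i \<in> {1..k}" by simp
      moreover have "same_block \<pi> i (k + 1)" using S that by (auto simp: same_block_def)
      ultimately show False using k by (auto simp: std_coords_def)
    qed
    then have "Min S = k + 1" using S fin[OF S(1)] by (intro Min_eqI) auto
    moreover have "S \<noteq> S1" using ge[of 1] k S1 by auto
    ultimately show "k \<in> (\<lambda>S. Min S - 1) ` (\<pi> - {S1})" using S(1) by force
  qed
  then have "card ({1..<n} - std_coords n \<pi>) = card (\<pi> - {S1})"
    by (simp add: bij_betw_same_card)
  also have "\<dots> = card \<pi> - 1"
    using S1 by (simp add: card_Diff_singleton)
  finally show ?thesis .
qed

text \<open>Consider the largest index k with a nonzero entry. It is not a coordinate, so k + 1
  begins its block, and the equation of this block contains t k as its only possibly nonzero
  term.\<close>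

lemma V_std_coords_zero:
  assumes \<pi>: "\<pi> \<in> partitions n" and t: "t \<in> V n \<pi>" "t 0 = 0" "\<And>j. j \<in> std_coords n \<pi> \<Longrightarrow> t j = 0"
  shows "t = (\<lambda>_. 0)"
proof (rule ccontr)
  assume "t \<noteq> (\<lambda>_. 0)"
  then obtain i where i: "t i \<noteq> 0" by auto
  define N where "N = {i. t i \<noteq> 0}"
  have t0: "t i = 0" if "n \<le> i" for i using t(1) that by (simp add: V_def)
  have N_sub: "N \<subseteq> {..<n}" using t0 by (auto simp: N_def intro: leI)
  then have fin: "finite N" by (rule finite_subset) simp
  define k where "k = Max N"
  have "k \<in> N" unfolding k_def using fin i by (intro Max_in) (auto simp: N_def)
  then have k: "t k \<noteq> 0" "k < n" using N_sub by (auto simp: N_def)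
  have above: "t j = 0" if "k < j" for j
    using Max_ge[OF fin, of j] that by (auto simp: N_def k_def)
  have "k \<noteq> 0" using k(1) t(2) by metis
  obtain S where S: "S \<in> \<pi>" "k + 1 \<in> S"
    using partition_unique_block[OF \<pi>, of "k + 1"] k by auto
  have "i \<notin> S" if "i \<le> k" for i
  proof
    assume "i \<in> S"
    then have "i \<in> {1..k}" using partition_block_subset[OF \<pi> S(1)] that by auto
    moreover have "same_block \<pi> i (k + 1)" using S \<open>i \<in> S\<close> by (auto simp: same_block_def)
    ultimately have "k \<in> std_coords n \<pi>" using k \<open>k \<noteq> 0\<close> by (auto simp: std_coords_def)
    then show False using t(3) k by simp
  qed
  note below = this
  have "0 = (\<Sum>i<n. (of_bool (Suc i \<in> S) - of_bool (i \<in> S)) * t i)"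
    using V_sum_eq[OF partition_block_subset[OF \<pi> S(1)], of t] t(1,2) S(1) t0 by (auto simp: V_def)
  also have "\<dots> = (\<Sum>i<n. if i = k then t i else 0)"
  proof (rule sum.cong[OF refl])
    fix i assume "i \<in> {..<n}"
    show "(of_bool (Suc i \<in> S) - of_bool (i \<in> S)) * t i = (if i = k then t i else 0)"
      using below[of i] below[of "Suc i"] above[of i] S(2) by (cases i k rule: linorder_cases) auto
  qed
  also have "\<dots> = t k" using k by simp
  finally show False using k by simp
qed

lemma sum_cyclic_shift:
  fixes t :: "nat \<Rightarrow> real"
  shows "(\<Sum>k\<in>{1..n}. t (k - 1) - t (k mod n)) = 0"
proof (cases n)
  case (Suc m)
  have "(\<Sum>k\<in>{1..n}. t (k - 1)) = (\<Sum>i<n. t i)"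
    by (rule sum.reindex_bij_witness[of _ Suc "\<lambda>k. k - 1"]) auto
  moreover have "(\<Sum>k\<in>{1..n}. t (k mod n)) = (\<Sum>i<n. t i)"
    by (rule sum.reindex_bij_witness[of _ "\<lambda>i. if i = 0 then n else i" "\<lambda>k. k mod n"])
       (auto simp: mod_if Suc split: if_splits)
  ultimately show ?thesis by (simp add: sum_subtractf)
qed simp

lemma sum_over_partition:
  assumes "\<pi> \<in> partitions n"
  shows "(\<Sum>S\<in>\<pi>. \<Sum>k\<in>S. f k) = (\<Sum>k\<in>{1..n}. f k :: real)"
proof -
  have "(\<Sum>k\<in>\<Union>\<pi>. f k) = (\<Sum>S\<in>\<pi>. \<Sum>k\<in>S. f k)"
    using assms by (subst sum.Union_disjoint)
      (auto simp: partitions_def partition_on_def disjoint_def intro: finite_subset[OF partition_block_subset[OF assms]])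
  then show ?thesis using assms by (simp add: partitions_def partition_on_def)
qed

text \<open>Existence is obtained by homogenizing: the vector of prescribed values gets a
  coefficient of its own, which yields one unknown more than there are independent equations.
  Uniqueness is \<open>V_std_coords_zero\<close> applied to a difference.\<close>

lemma free_coords_std:
  assumes \<pi>: "\<pi> \<in> partitions n" and n: "0 < n"
  shows "free_coords n \<pi> (std_coords n \<pi>)"
  unfolding free_coords_def
proof (intro conjI allI)
  show "std_coords n \<pi> \<subseteq> {1..<n}" by (auto simp: std_coords_def)
  fix x and s :: "nat \<Rightarrow> real"
  define J where "J = std_coords n \<pi>"
  define T where "T = {1..<n} - J"
  have J_sub: "J \<subseteq> {1..<n}" by (auto simp: J_def std_coords_def)
  obtain S1 where S1: "S1 \<in> \<pi>" "1 \<in> S1"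
    using partition_unique_block[OF \<pi>, of 1] n by auto
  define b where "b = (\<lambda>i. if i = 0 then x else if i \<in> J then s i else 0)"
  \<comment> \<open>Index 0 stands for the vector b of prescribed values, an index i in T for the
    unit vector at i. Hence \<open>w 0\<close> is the homogenizing coefficient.\<close>
  define f where "f = (\<lambda>i. if i = 0 then b else unit_fun i)"
  define E where "E = (\<lambda>t S. \<Sum>k\<in>S. t (k - 1) - t (k mod n) :: real)"
  have "card (\<pi> - {S1}) = card T"
    using card_std_coords[OF \<pi> n] S1 by (simp add: T_def J_def card_Diff_singleton)
  also have "\<dots> < card (insert 0 T)"
    by (simp add: T_def)
  finally have "card (\<pi> - {S1}) < card (insert 0 T)" .
  moreover have "finite (\<pi> - {S1})" "finite (insert 0 T)"
    using finite_partition[OF \<pi>] by (auto simp: T_def)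
  ultimately have "\<exists>w. (\<exists>i\<in>insert 0 T. w i \<noteq> 0) \<and> (\<forall>i. i \<notin> insert 0 T \<longrightarrow> w i = 0) \<and>
      (\<forall>S\<in>\<pi> - {S1}. (\<Sum>i\<in>insert 0 T. E (f i) S * w i) = 0)"
    by (intro homogeneous_system_nontrivial)
  then obtain w where ww: "(\<exists>i\<in>insert 0 T. w i \<noteq> 0) \<and> (\<forall>i. i \<notin> insert 0 T \<longrightarrow> w i = 0) \<and>
      (\<forall>S\<in>\<pi> - {S1}. (\<Sum>i\<in>insert 0 T. E (f i) S * w i) = 0)"
    by (rule exE)
  note w = ww[THEN conjunct1] ww[THEN conjunct2, THEN conjunct2, rule_format]
  define t where "t = (\<lambda>k. \<Sum>i\<in>insert 0 T. w i * f i k)"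
  have Et: "E t S = (\<Sum>i\<in>insert 0 T. E (f i) S * w i)" for S
  proof -
    have "E t S = (\<Sum>k\<in>S. \<Sum>i\<in>insert 0 T. w i * (f i (k - 1) - f i (k mod n)))"
      by (simp add: E_def t_def sum_subtractf right_diff_distrib del: sum.insert)
    also have "\<dots> = (\<Sum>i\<in>insert 0 T. w i * E (f i) S)"
      unfolding E_def sum_distrib_left by (rule sum.swap)
    also have "\<dots> = (\<Sum>i\<in>insert 0 T. E (f i) S * w i)"
      by (intro sum.cong mult.commute refl)
    finally show ?thesis .
  qed
  \<comment> \<open>The equations add up to zero around the cycle, so the one of S1, which was left
    out of the system, follows from the others.\<close>
  have "(\<Sum>S\<in>\<pi>. E t S) = 0"
    unfolding E_def sum_over_partition[OF \<pi>] by (rule sum_cyclic_shift)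
  then have "E t S1 + (\<Sum>S\<in>\<pi> - {S1}. E t S) = 0"
    using sum.remove[OF finite_partition[OF \<pi>] S1(1)] by metis
  moreover have "(\<Sum>S\<in>\<pi> - {S1}. E t S) = 0"
    using w(2) Et by (intro sum.neutral ballI) metis
  ultimately have "E t S1 = 0" by simp
  then have Et0: "E t S = 0" if "S \<in> \<pi>" for S
    using that w(2)[of S] Et[of S] by (cases "S = S1") (simp_all del: sum.insert)
  have finT: "finite T" "0 \<notin> T" by (auto simp: T_def)
  have tT: "t k = w k" if "k \<in> T" for k
  proof -
    have "t k = w 0 * b k + (\<Sum>i\<in>T. w i * f i k)"
      using finT by (simp add: t_def f_def)
    also have "(\<Sum>i\<in>T. w i * f i k) = (\<Sum>i\<in>T. if i = k then w i else 0)"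
      using finT(2) by (intro sum.cong refl) (auto simp: f_def)
    also have "\<dots> = w k" using that finT(1) by simp
    also have "b k = 0" using that by (auto simp: b_def T_def)
    finally show ?thesis by simp
  qed
  have tnT: "t k = w 0 * b k" if "k \<notin> T" for k
  proof -
    have "(\<Sum>i\<in>T. w i * f i k) = 0"
      using that finT(2) by (intro sum.neutral ballI) (auto simp: f_def)
    then show ?thesis using finT by (simp add: t_def f_def)
  qed
  have tV: "t \<in> V n \<pi>"
  proof -
    have "t k = 0" if "n \<le> k" for k
    proof -
      have "k \<notin> T" "b k = 0" using that J_sub n by (auto simp: T_def b_def)
      then show ?thesis by (simp add: tnT)
    qed
    then show ?thesis using Et0 by (auto simp: V_def E_def)
  qed
  \<comment> \<open>With \<open>w 0 = 0\<close> the vector t would vanish at 0 and on all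
    coordinates, hence everywhere, against the nontriviality of w.\<close>
  have "w 0 \<noteq> 0"
  proof
    assume "w 0 = 0"
    then have "t 0 = 0" "\<And>j. j \<in> J \<Longrightarrow> t j = 0"
      using tnT by (auto simp: T_def)
    then have "t = (\<lambda>_. 0)"
      using V_std_coords_zero[OF \<pi> tV] by (simp add: J_def)
    then have "\<forall>i\<in>T. w i = 0" using tT by simp
    then show False using w(1) \<open>w 0 = 0\<close> by simp
  qed
  define t' where "t' = (\<lambda>k. (1 / w 0) * t k + 0 * t k)"
  have "t' \<in> V n \<pi>"
    unfolding t'_def by (rule V_lin_comb[OF tV tV])
  moreover have "t' 0 = x" "\<forall>j\<in>J. t' j = s j"
    using \<open>w 0 \<noteq> 0\<close> J_sub by (auto simp: t'_def tnT T_def b_def)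
  moreover have "u = t'" if u: "u \<in> V n \<pi>" "u 0 = x" "\<forall>j\<in>J. u j = s j" for u
  proof -
    define d where "d = (\<lambda>k. 1 * u k + (-1) * t' k)"
    have "d \<in> V n \<pi>"
      unfolding d_def by (rule V_lin_comb) (fact u(1) \<open>t' \<in> V n \<pi>\<close>)+
    moreover have "d j = 0" if "j \<in> std_coords n \<pi>" for j
    proof -
      have "u j = s j" "t' j = s j"
        using u(3) \<open>\<forall>j\<in>J. t' j = s j\<close> that unfolding J_def by blast+
      then show ?thesis by (simp add: d_def)
    qed
    moreover have "d 0 = 0"
      by (simp add: d_def u(2) \<open>t' 0 = x\<close>)
    ultimately have "d = (\<lambda>_. 0)"
      by (intro V_std_coords_zero[OF \<pi>])
    then have "d k = 0" for k by simp
    then have "u k = t' k" for k unfolding d_def by (simp add: algebra_simps)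
    then show ?thesis by (rule ext)
  qed
  ultimately show "\<exists>!t. t \<in> V n \<pi> \<and> t 0 = x \<and> (\<forall>j\<in>std_coords n \<pi>. t j = s j)"
    unfolding J_def by (intro ex1I[of _ t']) (blast+)
qed

lemma coordinates_std:
  assumes "\<pi> \<in> partitions n" "0 < n"
  shows "coordinates n \<pi> (std_coords n \<pi>)"
proof -
  have sub: "std_coords n \<pi> \<subseteq> {1..<n}" by (auto simp: std_coords_def)
  then have "card ({1..<n} - std_coords n \<pi>) = n - 1 - card (std_coords n \<pi>)"
    by (subst card_Diff_subset) (auto intro: finite_subset)
  moreover have "card (std_coords n \<pi>) \<le> n - 1"
    using card_mono[OF _ sub] by simp
  moreover have "0 < card \<pi>"
    using partition_unique_block[OF assms(1), of 1] assms finite_partition[OF assms(1)]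
    by (auto simp: card_gt_0_iff)
  ultimately show ?thesis
    unfolding coordinates_iff using free_coords_std[OF assms] card_std_coords[OF assms] assms(2) by simp
qed

section \<open>Independence of the integral from the coordinates\<close>

lemma V_point_measurable:
  assumes \<pi>: "\<pi> \<in> partitions n" and J: "free_coords n \<pi> J"
  shows "V_point n \<pi> J x \<in> measurable (\<Pi>\<^sub>M j\<in>J. lborel) (\<Pi>\<^sub>M k\<in>UNIV. borel)"
proof -
  have "(\<lambda>s. V_point n \<pi> J x s k) \<in> measurable (\<Pi>\<^sub>M j\<in>J. lborel) borel" for k
  proof (cases "k < n")
    case True
    have "(\<lambda>s. s j) \<in> borel_measurable (\<Pi>\<^sub>M j\<in>J. lborel)" if "j \<in> J" for j :: nat
      using measurable_component_singleton[OF that, of "\<lambda>_. lborel"] by simp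
    moreover have "V_point n \<pi> J x s k = x + (\<Sum>j\<in>J. (s j - x) * V_point n \<pi> J 0 (unit_fun j) k)" for s
      by (rule V_point_affine[OF \<pi> J True])
    ultimately show ?thesis
      by (simp only:) (intro borel_measurable_add borel_measurable_sum borel_measurable_times
          borel_measurable_diff borel_measurable_const)
  next
    case False
    then have "V_point n \<pi> J x s k = 0" for s
      using V_point_spec(1)[OF J, where x = x and s = s] by (auto simp: V_def)
    then show ?thesis by simp
  qed
  then have "(\<lambda>s k. V_point n \<pi> J x s k) \<in> measurable (\<Pi>\<^sub>M j\<in>J. lborel) (\<Pi>\<^sub>M k\<in>UNIV. borel)"
    by (intro measurable_PiM_single') auto
  then show ?thesis by simp
qed

lemma emeasure_distr_nn_integral:
  assumes "f \<in> measurable M N" "A \<in> sets N"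
  shows "emeasure (distr M N f) A = (\<integral>\<^sup>+s. indicator A (f s) \<partial>M)"
  using nn_integral_distr[OF assms(1), of "indicator A"] assms(2) by simp

text \<open>The exchanged coordinate is integrated innermost. With the coordinates in L fixed, t k =
  c + a u where \<bar>a\<bar> = 1, and Lebesgue measure is invariant under this
  substitution.\<close>

lemma V_point_distr_swap:
  assumes \<pi>: "\<pi> \<in> partitions n"
    and J: "free_coords n \<pi> (insert j L)" and K: "free_coords n \<pi> (insert k L)"
    and jk: "j \<notin> L" "k \<notin> L"
  shows "distr (\<Pi>\<^sub>M i\<in>insert j L. lborel) (\<Pi>\<^sub>M i\<in>UNIV. borel) (V_point n \<pi> (insert j L) x) =
    distr (\<Pi>\<^sub>M i\<in>insert k L. lborel) (\<Pi>\<^sub>M i\<in>UNIV. borel) (V_point n \<pi> (insert k L) x)"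
    (is "distr ?M1 ?N ?v1 = distr ?M2 ?N ?v2")
proof (rule measure_eqI)
  interpret product_sigma_finite "\<lambda>_::nat. lborel :: real measure" ..
  fix A assume "A \<in> sets (distr ?M1 ?N ?v1)"
  then have A[measurable]: "A \<in> sets ?N" by simp
  note [measurable] = V_point_measurable[OF \<pi> J] V_point_measurable[OF \<pi> K]
  have fin: "finite L" using free_coords_finite[OF J] by simp
  have kn: "k < n" using K by (auto simp: free_coords_def)
  define a where "a = V_point n \<pi> (insert j L) 0 (unit_fun j) k"
  have a: "\<bar>a\<bar> = 1" unfolding a_def by (rule free_coords_swap_abs[OF \<pi> J K jk])
  have inner: "(\<integral>\<^sup>+u. indicator A (?v1 (s(j := u))) \<partial>lborel) = (\<integral>\<^sup>+u. indicator A (?v2 (s(k := u))) \<partial>lborel)"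
    if s: "s \<in> space (\<Pi>\<^sub>M i\<in>L. lborel)" for s
  proof -
    define c where "c = ?v1 (s(j := 0)) k"
    have vk: "?v1 (s(j := u)) k = c + a * u" for u
    proof -
      have "?v1 (s(j := u)) k = x + (u - x) * a +
          (\<Sum>i\<in>L. (s i - x) * V_point n \<pi> (insert j L) 0 (unit_fun i) k)" for u
        using jk fin by (subst V_point_affine[OF \<pi> J kn]) (auto simp: a_def intro!: sum.cong)
      from this[of u] this[of 0] show ?thesis by (simp add: c_def algebra_simps)
    qed
    \<comment> \<open>The same point of V, described by the other set of coordinates.\<close>
    have "?v1 (s(j := u)) = ?v2 (s(k := c + a * u))" for u
      by (rule V_point_eqI[OF K, symmetric])
         (use jk V_point_spec[OF J, where x = x and s = "s(j := u)"] vk in auto)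
    then have "(\<integral>\<^sup>+u. indicator A (?v1 (s(j := u))) \<partial>lborel)
        = (\<integral>\<^sup>+u. indicator A (?v2 (s(k := c + a * u))) \<partial>lborel)"
      by simp
    also have "\<dots> = \<bar>a\<bar> * (\<integral>\<^sup>+u. indicator A (?v2 (s(k := c + a * u))) \<partial>lborel)"
      using a by simp
    also have "\<dots> = (\<integral>\<^sup>+u. indicator A (?v2 (s(k := u))) \<partial>lborel)"
    proof (rule nn_integral_real_affine[symmetric])
      have [measurable]: "(\<lambda>u. s(k := u)) \<in> measurable borel ?M2"
        using measurable_component_update[OF s jk(2)] by simp
      show "(\<lambda>u. indicator A (?v2 (s(k := u))) :: ennreal) \<in> borel_measurable borel"
        by measurable
    qed (use a in auto)
    finally show ?thesis .
  qed
  have "emeasure (distr ?M1 ?N ?v1) A = (\<integral>\<^sup>+s. indicator A (?v1 s) \<partial>?M1)"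
    by (rule emeasure_distr_nn_integral) measurable
  also have "\<dots> = (\<integral>\<^sup>+s. (\<integral>\<^sup>+u. indicator A (?v1 (s(j := u))) \<partial>lborel) \<partial>(\<Pi>\<^sub>M i\<in>L. lborel))"
    by (rule product_nn_integral_insert[OF fin jk(1)]) measurable
  also have "\<dots> = (\<integral>\<^sup>+s. (\<integral>\<^sup>+u. indicator A (?v2 (s(k := u))) \<partial>lborel) \<partial>(\<Pi>\<^sub>M i\<in>L. lborel))"
    by (rule nn_integral_cong) (rule inner)
  also have "\<dots> = (\<integral>\<^sup>+s. indicator A (?v2 s) \<partial>?M2)"
    by (rule product_nn_integral_insert[OF fin jk(2), symmetric]) measurable
  also have "\<dots> = emeasure (distr ?M2 ?N ?v2) A"
    by (rule emeasure_distr_nn_integral[symmetric]) measurable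
  finally show "emeasure (distr ?M1 ?N ?v1) A = emeasure (distr ?M2 ?N ?v2) A" .
qed simp

text \<open>The claim is about image measures on the space of all sequences, so that every integrand
  in t can be transported at once. Each exchange brings J one index closer to K.\<close>

lemma V_point_distr:
  assumes \<pi>: "\<pi> \<in> partitions n" and K: "free_coords n \<pi> K"
    and J: "free_coords n \<pi> J" "card J = card K"
  shows "distr (\<Pi>\<^sub>M i\<in>J. lborel) (\<Pi>\<^sub>M i\<in>UNIV. borel) (V_point n \<pi> J x) =
    distr (\<Pi>\<^sub>M i\<in>K. lborel) (\<Pi>\<^sub>M i\<in>UNIV. borel) (V_point n \<pi> K x)"
  using J
proof (induction "card (K - J)" arbitrary: J)
  case 0
  then have "K \<subseteq> J" using free_coords_finite[OF K] by simp
  then have "J = K" using 0 free_coords_finite[OF 0(2)] by (metis card_subset_eq)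
  then show ?case by simp
next
  case (Suc m)
  then obtain k where k: "k \<in> K - J" by (metis card.empty ex_in_conv nat.distinct(1))
  then obtain j where j: "j \<in> J - K" "free_coords n \<pi> (insert k (J - {j}))"
    using free_coords_exchange[OF \<pi> Suc.prems(1) K k] by blast
  have fin: "finite J" by (rule free_coords_finite[OF Suc.prems(1)])
  have J: "J = insert j (J - {j})" using j by blast
  have "distr (\<Pi>\<^sub>M i\<in>J. lborel) (\<Pi>\<^sub>M i\<in>UNIV. borel) (V_point n \<pi> J x) =
    distr (\<Pi>\<^sub>M i\<in>insert k (J - {j}). lborel) (\<Pi>\<^sub>M i\<in>UNIV. borel) (V_point n \<pi> (insert k (J - {j})) x)"
    using V_point_distr_swap[OF \<pi> _ j(2), of j x] Suc.prems(1) J k by simp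
  also have "\<dots> = distr (\<Pi>\<^sub>M i\<in>K. lborel) (\<Pi>\<^sub>M i\<in>UNIV. borel) (V_point n \<pi> K x)"
  proof (rule Suc.hyps(1))
    have "K - insert k (J - {j}) = (K - J) - {k}" using j by auto
    then show "m = card (K - insert k (J - {j}))"
      using Suc.hyps(2) k free_coords_finite[OF K] by simp
    have "card (insert k (J - {j})) = Suc (card (J - {j}))"
      using fin k by simp
    also have "\<dots> = card J" using fin j by (intro card_Suc_Diff1) auto
    finally show "card (insert k (J - {j})) = card K" using Suc.prems(2) by simp
  qed (fact j(2))
  finally show ?case .
qed

section \<open>Integration over the space of a partition\<close>

lemma C01_measurable:
  assumes "f \<in> C01"
  shows "f \<in> borel_measurable borel"
proof -
  have "(\<lambda>x. if x \<in> {0..1} then f x else 0) \<in> borel_measurable borel"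
    by (rule borel_measurable_continuous_on_if) (use assms in \<open>auto simp: C01_def\<close>)
  moreover have "(\<lambda>x. if x \<in> {0..1} then f x else 0) = f"
    using assms by (auto simp: C01_def fun_eq_iff)
  ultimately show ?thesis by simp
qed

lemma C01_bounded:
  assumes "f \<in> C01"
  obtains B where "0 \<le> B" "\<And>x. norm (f x) \<le> B"
proof -
  have "compact (f ` {0..1})"
    using assms by (intro compact_continuous_image) (auto simp: C01_def)
  then have "bounded (f ` {0..1})" by (rule compact_imp_bounded)
  then obtain B where B: "\<And>x. x \<in> {0..1} \<Longrightarrow> norm (f x) \<le> B"
    unfolding bounded_iff by blast
  have "norm (f x) \<le> max B 0" for x
    using B[of x] assms by (cases "x \<in> {0..1}") (auto simp: C01_def)
  then show ?thesis using that[of "max B 0"] by simp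
qed

abbreviation std_point :: "nat \<Rightarrow> nat set set \<Rightarrow> real \<Rightarrow> (nat \<Rightarrow> real) \<Rightarrow> nat \<Rightarrow> real" where
  "std_point n \<pi> x s \<equiv> V_point n \<pi> (std_coords n \<pi>) x s"

text \<open>This is $\Lambda_\pi(H_1,\ldots,H_{n-1})\,H_n$, with $H_n$ written as a factor at $t_n = t_0 = x$.\<close>

definition Lambda_prod :: "nat \<Rightarrow> nat set set \<Rightarrow> (nat \<Rightarrow> real \<Rightarrow> complex) \<Rightarrow> real \<Rightarrow> complex" where
  "Lambda_prod n \<pi> H x = (LINT s|(\<Pi>\<^sub>M j\<in>std_coords n \<pi>. lborel).
     (\<Prod>k\<in>{1..n}. H k (std_point n \<pi> x s (k mod n))))"

lemma std_point_measurable: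
  assumes "\<pi> \<in> partitions n" "0 < n" "f \<in> borel_measurable borel"
  shows "(\<lambda>s. f (std_point n \<pi> x s k)) \<in> borel_measurable (\<Pi>\<^sub>M j\<in>std_coords n \<pi>. lborel)"
proof -
  have "std_point n \<pi> x \<in> measurable (\<Pi>\<^sub>M j\<in>std_coords n \<pi>. lborel) (\<Pi>\<^sub>M k\<in>UNIV. borel)"
    by (rule V_point_measurable[OF assms(1) free_coords_std[OF assms(1,2)]])
  from measurable_compose[OF this measurable_component_singleton[of k UNIV "\<lambda>_. borel"]]
  have "(\<lambda>s. std_point n \<pi> x s k) \<in> borel_measurable (\<Pi>\<^sub>M j\<in>std_coords n \<pi>. lborel)" by simp
  from measurable_compose[OF this assms(3)] show ?thesis .
qed

lemma std_coords_sub: "std_coords n \<pi> \<subseteq> {1..<n}" "finite (std_coords n \<pi>)"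
  by (auto simp: std_coords_def)

lemma Lambda_prod_integrand_measurable:
  assumes "\<pi> \<in> partitions n" "0 < n" "\<forall>k\<in>{1..n}. H k \<in> C01"
  shows "(\<lambda>s. \<Prod>k\<in>{1..n}. H k (std_point n \<pi> x s (k mod n)))
    \<in> borel_measurable (\<Pi>\<^sub>M j\<in>std_coords n \<pi>. lborel)"
  using assms(3) by (intro borel_measurable_prod std_point_measurable C01_measurable assms(1,2)) auto

lemma finite_measure_unit_cube:
  assumes "finite J"
  shows "emeasure (\<Pi>\<^sub>M j\<in>J. lborel) (J \<rightarrow>\<^sub>E {0..1::real}) = 1"
proof -
  interpret product_sigma_finite "\<lambda>_. lborel :: real measure" ..
  show ?thesis using assms by (subst emeasure_PiM) auto
qed

text \<open>A coordinate outside the unit interval annihilates the factor with its own index, so the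
  integrand lives on the unit cube whatever x is. Uniformity in x is what dominated convergence
  requires later.\<close>

lemma Lambda_prod_integrand_bound:
  assumes \<pi>: "\<pi> \<in> partitions n" "0 < n" and H: "\<forall>k\<in>{1..n}. H k \<in> C01"
  shows "\<exists>B. integrable (\<Pi>\<^sub>M j\<in>std_coords n \<pi>. lborel)
      (\<lambda>s. B * indicator (std_coords n \<pi> \<rightarrow>\<^sub>E {0..1::real}) s :: real) \<and>
    (\<forall>x. \<forall>s\<in>space (\<Pi>\<^sub>M j\<in>std_coords n \<pi>. lborel).
      norm (\<Prod>k\<in>{1..n}. H k (std_point n \<pi> x s (k mod n))) \<le> B * indicator (std_coords n \<pi> \<rightarrow>\<^sub>E {0..1::real}) s)"
proof -
  define J where "J = std_coords n \<pi>"
  have J: "J \<subseteq> {1..<n}" "finite J" using std_coords_sub by (auto simp: J_def)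
  note sp = V_point_spec[OF free_coords_std[OF \<pi>], folded J_def]
  have "\<exists>b. 0 \<le> b \<and> (\<forall>x. norm (H k x) \<le> b)" if "k \<in> {1..n}" for k
    using C01_bounded[OF H[rule_format, OF that]] by metis
  then obtain b where b: "\<And>k. k \<in> {1..n} \<Longrightarrow> 0 \<le> b k" "\<And>k x. k \<in> {1..n} \<Longrightarrow> norm (H k x) \<le> b k"
    by metis
  define B where "B = (\<Prod>k\<in>{1..n}. b k)"
  show ?thesis
  proof (intro exI[of _ B] conjI allI ballI)
    have "(J \<rightarrow>\<^sub>E {0..1::real}) \<in> sets (\<Pi>\<^sub>M j\<in>J. lborel)"
      by (intro sets_PiM_I_finite) (use J in auto)
    then have "integrable (\<Pi>\<^sub>M j\<in>J. lborel) (indicator (J \<rightarrow>\<^sub>E {0..1::real}) :: _ \<Rightarrow> real)"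
      using finite_measure_unit_cube[OF J(2)] by (intro integrable_real_indicator) auto
    then show "integrable (\<Pi>\<^sub>M j\<in>std_coords n \<pi>. lborel)
        (\<lambda>s. B * indicator (std_coords n \<pi> \<rightarrow>\<^sub>E {0..1::real}) s)"
      unfolding J_def by simp
  next
    fix x and s :: "nat \<Rightarrow> real" assume "s \<in> space (\<Pi>\<^sub>M j\<in>std_coords n \<pi>. lborel)"
    then have s: "s \<in> J \<rightarrow>\<^sub>E UNIV" by (simp add: space_PiM J_def)
    show "norm (\<Prod>k\<in>{1..n}. H k (std_point n \<pi> x s (k mod n))) \<le> B * indicator (std_coords n \<pi> \<rightarrow>\<^sub>E {0..1::real}) s"
    proof (cases "s \<in> J \<rightarrow>\<^sub>E {0..1}")
      case True
      have "norm (\<Prod>k\<in>{1..n}. H k (std_point n \<pi> x s (k mod n))) = (\<Prod>k\<in>{1..n}. norm (H k (std_point n \<pi> x s (k mod n))))"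
        by (rule prod_norm[symmetric])
      also have "\<dots> \<le> B"
        unfolding B_def by (intro prod_mono) (use b in auto)
      finally show ?thesis using True by (simp add: J_def)
    next
      case False
      then obtain j where j: "j \<in> J" "s j \<notin> {0..1}"
        using s by (auto simp: PiE_iff)
      then have "j \<in> {1..n}" "j mod n = j" using J(1) by auto
      moreover have "H j (std_point n \<pi> x s j) = 0"
        using H[rule_format, OF \<open>j \<in> {1..n}\<close>] j sp(3)[OF j(1)] by (auto simp: C01_def J_def)
      ultimately have "(\<Prod>k\<in>{1..n}. H k (std_point n \<pi> x s (k mod n))) = 0"
        by (intro prod_zero bexI[of _ j]) simp_all
      then show ?thesis using False by (simp add: J_def)
    qed
  qed
qed

lemma Lambda_prod_integrable:
  assumes "\<pi> \<in> partitions n" "0 < n" "\<forall>k\<in>{1..n}. H k \<in> C01"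
  shows "integrable (\<Pi>\<^sub>M j\<in>std_coords n \<pi>. lborel)
    (\<lambda>s. \<Prod>k\<in>{1..n}. H k (std_point n \<pi> x s (k mod n)))"
proof -
  obtain B where B: "integrable (\<Pi>\<^sub>M j\<in>std_coords n \<pi>. lborel)
      (\<lambda>s. B * indicator (std_coords n \<pi> \<rightarrow>\<^sub>E {0..1::real}) s :: real)"
    "\<forall>x. \<forall>s\<in>space (\<Pi>\<^sub>M j\<in>std_coords n \<pi>. lborel).
      norm (\<Prod>k\<in>{1..n}. H k (std_point n \<pi> x s (k mod n))) \<le> B * indicator (std_coords n \<pi> \<rightarrow>\<^sub>E {0..1::real}) s"
    using Lambda_prod_integrand_bound[OF assms] by (elim exE conjE) (rule that)
  show ?thesis
    by (rule Bochner_Integration.integrable_bound[OF B(1) Lambda_prod_integrand_measurable[OF assms]])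
       (use B(2) in \<open>auto intro!: AE_I2 intro: order.trans[OF _ abs_ge_self]\<close>)
qed

text \<open>The factor with index n is evaluated at t 0 = x.\<close>

lemma Lambda_prod_outside:
  assumes "\<pi> \<in> partitions n" "0 < n" "H n \<in> C01" "x \<notin> {0..1}"
  shows "Lambda_prod n \<pi> H x = 0"
proof -
  have "(\<Prod>k\<in>{1..n}. H k (std_point n \<pi> x s (k mod n))) = 0" for s
    using assms V_point_spec(2)[OF free_coords_std[OF assms(1,2)], of x s]
    by (intro prod_zero bexI[of _ n]) (auto simp: C01_def)
  then show ?thesis unfolding Lambda_prod_def by (simp only: integral_zero)
qed

text \<open>Off its domain of integration the integrand of \<open>Lambda\<close> is zero already.
  What remains is an integral against the image measure on sequences, where the coordinates chosen
  by \<open>SOME\<close> may be replaced by the standard ones.\<close>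

lemma Lambda_eq_prod:
  assumes \<pi>: "\<pi> \<in> partitions n" "0 < n" and H: "length hs = n" "set hs \<subseteq> C01"
  shows "Lambda n \<pi> (butlast hs) x * last hs x = Lambda_prod n \<pi> (\<lambda>k. hs ! (k - 1)) x"
proof (cases "x \<in> {0..1}")
  case False
  have "hs ! (n - 1) \<in> C01" using H \<pi> by (auto intro!: subsetD[OF H(2)] nth_mem)
  moreover have "last hs = hs ! (n - 1)" using H \<pi> by (subst last_conv_nth) auto
  ultimately show ?thesis
    using False Lambda_prod_outside[OF \<pi>, of "\<lambda>k. hs ! (k - 1)" x] by (simp add: C01_def)
next
  case True
  define J where "J = (SOME J. coordinates n \<pi> J)"
  have "coordinates n \<pi> J" unfolding J_def by (rule someI[of "coordinates n \<pi>"]) (rule coordinates_std[OF \<pi>])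
  then have J: "free_coords n \<pi> J" "card J = card (std_coords n \<pi>)"
    using coordinates_std[OF \<pi>] by (auto simp: coordinates_iff)
  let ?K = "std_coords n \<pi>"
  have K: "free_coords n \<pi> ?K" by (rule free_coords_std[OF \<pi>])
  define h where "h = (\<lambda>k. butlast hs ! (k - 1))"
  have hh: "h k = hs ! (k - 1)" if "k \<in> {1..<n}" for k
    using that H by (auto simp: h_def nth_butlast)
  have hC: "h k \<in> C01" if "k \<in> {1..<n}" for k
    using that H \<pi> hh[OF that] by (auto intro!: subsetD[OF H(2)] nth_mem)
  let ?f = "\<lambda>t. \<Prod>k\<in>{1..<n}. h k (t k)"
  have f: "?f \<in> borel_measurable (\<Pi>\<^sub>M k\<in>UNIV. borel)"
  proof (rule borel_measurable_prod)
    fix k assume "k \<in> {1..<n}"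
    then have "h k \<in> borel_measurable borel" using hC C01_measurable by blast
    from measurable_compose[OF measurable_component_singleton[of k UNIV "\<lambda>_. borel"] this]
    show "(\<lambda>t. h k (t k)) \<in> borel_measurable (\<Pi>\<^sub>M k\<in>UNIV. borel)" by simp
  qed
  let ?A = "{s \<in> J \<rightarrow>\<^sub>E {0..1}. \<forall>k\<in>{1..<n}. V_point n \<pi> J x s k \<in> {0..1}}"
  have "Lambda n \<pi> (butlast hs) x =
      (LINT s|(\<Pi>\<^sub>M j\<in>J. lborel). indicator ?A s *\<^sub>R ?f (V_point n \<pi> J x s))"
    unfolding Lambda_def Let_def set_lebesgue_integral_def J_def h_def using True by (simp only: if_True)
  also have "\<dots> = (LINT s|(\<Pi>\<^sub>M j\<in>J. lborel). ?f (V_point n \<pi> J x s))"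
  proof (rule Bochner_Integration.integral_cong[OF refl])
    fix s :: "nat \<Rightarrow> real" assume "s \<in> space (\<Pi>\<^sub>M j\<in>J. lborel)"
    then have s: "s \<in> J \<rightarrow>\<^sub>E UNIV" by (simp add: space_PiM)
    have "?f (V_point n \<pi> J x s) = 0" if "s \<notin> ?A"
    proof -
      have "\<exists>k\<in>{1..<n}. V_point n \<pi> J x s k \<notin> {0..1}"
      proof (cases "s \<in> J \<rightarrow>\<^sub>E {0..1}")
        case False
        then obtain j where "j \<in> J" "s j \<notin> {0..1}" using s by (auto simp: PiE_iff)
        then show ?thesis using J(1) V_point_spec(3)[OF J(1)]
          by (intro bexI[of _ j]) (auto simp: free_coords_def)
      qed (use that in auto)
      then obtain k where k: "k \<in> {1..<n}" "V_point n \<pi> J x s k \<notin> {0..1}" by blast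
      then have "h k (V_point n \<pi> J x s k) = 0" using hC[OF k(1)] unfolding C01_def by blast
      then show ?thesis using k(1) by (intro prod_zero) auto
    qed
    then show "indicator ?A s *\<^sub>R ?f (V_point n \<pi> J x s) = ?f (V_point n \<pi> J x s)"
      by (auto simp: indicator_def simp del: atLeastAtMost_iff)
  qed
  also have "\<dots> = (LINT t|distr (\<Pi>\<^sub>M j\<in>J. lborel) (\<Pi>\<^sub>M i\<in>UNIV. borel) (V_point n \<pi> J x). ?f t)"
    by (rule integral_distr[OF V_point_measurable[OF \<pi>(1) J(1)] f, symmetric])
  also have "\<dots> = (LINT t|distr (\<Pi>\<^sub>M j\<in>?K. lborel) (\<Pi>\<^sub>M i\<in>UNIV. borel) (V_point n \<pi> ?K x). ?f t)"
    by (simp add: V_point_distr[OF \<pi>(1) K J])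
  also have "\<dots> = (LINT s|(\<Pi>\<^sub>M j\<in>?K. lborel). ?f (std_point n \<pi> x s))"
    by (rule integral_distr[OF V_point_measurable[OF \<pi>(1) K] f])
  finally have L: "Lambda n \<pi> (butlast hs) x = (LINT s|(\<Pi>\<^sub>M j\<in>?K. lborel). ?f (std_point n \<pi> x s))" .
  have "(\<Prod>k\<in>{1..n}. (hs ! (k - 1)) (std_point n \<pi> x s (k mod n))) = ?f (std_point n \<pi> x s) * last hs x" for s
  proof -
    have "{1..n} = insert n {1..<n}" using \<pi>(2) by auto
    then have "(\<Prod>k\<in>{1..n}. (hs ! (k - 1)) (std_point n \<pi> x s (k mod n)))
        = (hs ! (n - 1)) (std_point n \<pi> x s 0) * (\<Prod>k\<in>{1..<n}. (hs ! (k - 1)) (std_point n \<pi> x s (k mod n)))"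
      by simp
    also have "hs ! (n - 1) = last hs" using H \<pi> by (subst last_conv_nth) auto
    also have "std_point n \<pi> x s 0 = x" by (rule V_point_spec(2)[OF K])
    also have "(\<Prod>k\<in>{1..<n}. (hs ! (k - 1)) (std_point n \<pi> x s (k mod n))) = ?f (std_point n \<pi> x s)"
      by (rule prod.cong) (auto simp: hh)
    finally show ?thesis by (simp add: mult.commute)
  qed
  then show ?thesis by (simp add: Lambda_prod_def L)
qed

lemma Lambda_prod_comb:
  assumes \<pi>: "\<pi> \<in> partitions n" "0 < n" and H: "\<forall>k\<in>{1..n}. H k \<in> C01"
    and i: "i \<in> {1..n}" and u: "u \<in> C01" and v: "v \<in> C01"
  shows "Lambda_prod n \<pi> (H(i := (\<lambda>y. a * u y + b * v y))) x =
    a * Lambda_prod n \<pi> (H(i := u)) x + b * Lambda_prod n \<pi> (H(i := v)) x"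
proof -
  let ?M = "\<Pi>\<^sub>M j\<in>std_coords n \<pi>. (lborel :: real measure)"
  let ?p = "\<lambda>w s. \<Prod>k\<in>{1..n}. (H(i := w)) k (std_point n \<pi> x s (k mod n))"
  have int: "integrable ?M (?p w)" if "w \<in> C01" for w
    by (rule Lambda_prod_integrable[OF \<pi>]) (use H that in auto)
  have "?p w s = w (std_point n \<pi> x s (i mod n)) * (\<Prod>k\<in>{1..n} - {i}. H k (std_point n \<pi> x s (k mod n)))" for w s
    by (subst prod.remove[OF _ i]) (auto intro!: prod.cong)
  then have "?p (\<lambda>y. a * u y + b * v y) s = a * ?p u s + b * ?p v s" for s
    by (simp only:) (simp add: algebra_simps)
  then show ?thesis
    unfolding Lambda_prod_def using int[OF u] int[OF v] by simp
qed

section \<open>Continuity in the base point\<close>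

text \<open>By Fubini's theorem: every fibre of the hyperplane in the direction of j is a single
  point.\<close>

lemma AE_affine_neq:
  assumes fin: "finite J" and j: "j \<in> J" "c j \<noteq> 0"
  shows "AE s in (\<Pi>\<^sub>M j\<in>J. lborel). (\<Sum>j\<in>J. s j * c j) \<noteq> (a::real)"
proof -
  interpret product_sigma_finite "\<lambda>_::'a. lborel :: real measure" ..
  let ?M = "\<Pi>\<^sub>M j\<in>J. (lborel :: real measure)"
  let ?f = "\<lambda>s. \<Sum>j\<in>J. s j * c j"
  define L where "L = J - {j}"
  have L: "J = insert j L" "j \<notin> L" "finite L" using fin j by (auto simp: L_def)
  have comp: "(\<lambda>s. s i) \<in> borel_measurable ?M" if "i \<in> J" for i
    using measurable_component_singleton[OF that, of "\<lambda>_. lborel :: real measure"] by simp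
  have fm[measurable]: "?f \<in> borel_measurable ?M"
    by (intro borel_measurable_sum borel_measurable_times borel_measurable_const comp)
  let ?N = "{s \<in> space ?M. ?f s = a}"
  have N: "?N \<in> sets ?M" by measurable
  have "emeasure ?M ?N = (\<integral>\<^sup>+s. indicator ?N s \<partial>?M)" using N by simp
  also have "\<dots> = (\<integral>\<^sup>+s. indicator {a} (?f s) \<partial>?M)"
    by (rule nn_integral_cong) (auto simp: indicator_def)
  also have "\<dots> = (\<integral>\<^sup>+s. (\<integral>\<^sup>+u. indicator {a} (?f (s(j := u))) \<partial>lborel) \<partial>(\<Pi>\<^sub>M i\<in>L. lborel))"
  proof -
    have "(\<lambda>s. indicator {a} (?f s) :: ennreal) \<in> borel_measurable ?M" by measurable
    then show ?thesis
      unfolding L(1) by (rule product_nn_integral_insert[OF L(3,2)])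
  qed
  also have "\<dots> = (\<integral>\<^sup>+s. 0 \<partial>(\<Pi>\<^sub>M i\<in>L. (lborel :: real measure)))"
  proof (rule nn_integral_cong)
    fix s :: "'a \<Rightarrow> real"
    define d where "d = (\<Sum>i\<in>L. s i * c i)"
    have "?f (s(j := u)) = u * c j + d" for u
    proof -
      have "(\<Sum>i\<in>L. (s(j := u)) i * c i) = d"
        unfolding d_def by (rule sum.cong) (use L in auto)
      then show ?thesis using L by simp
    qed
    moreover have "u * c j + d = a \<longleftrightarrow> u = (a - d) / c j" for u
      using j by (auto simp: field_simps)
    ultimately have "(\<integral>\<^sup>+u. indicator {a} (?f (s(j := u))) \<partial>lborel)
        = (\<integral>\<^sup>+u. indicator {(a - d) / c j} u \<partial>lborel)"
      by (intro nn_integral_cong) (simp add: indicator_def)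
    then show "(\<integral>\<^sup>+u. indicator {a} (?f (s(j := u))) \<partial>lborel) = 0" by simp
  qed
  finally have "emeasure ?M ?N = 0" by simp
  then show ?thesis
    using N by (intro AE_I[of _ _ ?N]) auto
qed

text \<open>The zero extension of h can jump only at 0 and 1. If t m depends on some coordinate, it
  takes these values on a null set of s only; otherwise t m is the base point itself, and continuity
  of h on the closed interval suffices because the sequence u stays inside it.\<close>

lemma std_point_AE_tendsto:
  assumes \<pi>: "\<pi> \<in> partitions n" and h: "h \<in> C01" and m: "m < n"
    and x: "x \<in> {0..1}" and u: "\<And>i. u i \<in> {0..1}" "u \<longlonglongrightarrow> x"
  shows "AE s in (\<Pi>\<^sub>M j\<in>std_coords n \<pi>. lborel).
    (\<lambda>i. h (std_point n \<pi> (u i) s m)) \<longlonglongrightarrow> h (std_point n \<pi> x s m)"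
proof -
  have n: "0 < n" using m by simp
  let ?J = "std_coords n \<pi>"
  note J = free_coords_std[OF \<pi> n]
  define c where "c = (\<lambda>j. V_point n \<pi> ?J 0 (unit_fun j) m)"
  have aff: "std_point n \<pi> y s m = y + (\<Sum>j\<in>?J. (s j - y) * c j)" for y s
    unfolding c_def by (rule V_point_affine[OF \<pi> J m])
  show ?thesis
  proof (cases "\<forall>j\<in>?J. c j = 0")
    case True
    then have "std_point n \<pi> y s m = y" for y s unfolding aff by simp
    moreover have "(\<lambda>i. h (u i)) \<longlonglongrightarrow> h x"
      using h u x by (auto simp: C01_def continuous_on_sequentially comp_def)
    ultimately show ?thesis by simp
  next
    case False
    then obtain j where j: "j \<in> ?J" "c j \<noteq> 0" by blast
    define d where "d = x - (\<Sum>j\<in>?J. x * c j)"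
    have "AE s in (\<Pi>\<^sub>M j\<in>?J. lborel). (\<Sum>j\<in>?J. s j * c j) \<noteq> 0 - d"
      "AE s in (\<Pi>\<^sub>M j\<in>?J. lborel). (\<Sum>j\<in>?J. s j * c j) \<noteq> 1 - d"
      by (rule AE_affine_neq[where c = c, OF std_coords_sub(2) j])+
    then show ?thesis
    proof eventually_elim
      fix s :: "nat \<Rightarrow> real"
      assume s: "(\<Sum>j\<in>?J. s j * c j) \<noteq> 0 - d" "(\<Sum>j\<in>?J. s j * c j) \<noteq> 1 - d"
      define z where "z = std_point n \<pi> x s m"
      have "z = d + (\<Sum>j\<in>?J. s j * c j)"
        unfolding z_def aff d_def by (simp add: left_diff_distrib sum_subtractf)
      with s have z: "z \<noteq> 0" "z \<noteq> 1" by auto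
      have "isCont h z"
      proof (cases "z \<in> {0..1}")
        case True
        then have "z \<in> interior {0..1}" using z by auto
        then show ?thesis using h continuous_on_interior[of "{0..1}" h z] by (auto simp: C01_def)
      next
        case False
        have "continuous_on (- {0..1}) h"
          using h by (intro continuous_on_cong[THEN iffD2, OF refl _ continuous_on_const[of _ 0]]) (auto simp: C01_def)
        then show ?thesis using False
          by (subst (asm) continuous_on_eq_continuous_at) (auto simp: open_Compl)
      qed
      moreover have "(\<lambda>i. std_point n \<pi> (u i) s m) \<longlonglongrightarrow> z"
        unfolding z_def aff by (intro tendsto_intros u(2))
      ultimately show "(\<lambda>i. h (std_point n \<pi> (u i) s m)) \<longlonglongrightarrow> h (std_point n \<pi> x s m)"
        unfolding z_def by (rule isCont_tendsto_compose)
    qed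
  qed
qed

text \<open>Sequential continuity by dominated convergence, with a majorant that does not involve
  x.\<close>

lemma Lambda_prod_C01:
  assumes \<pi>: "\<pi> \<in> partitions n" "0 < n" and H: "\<forall>k\<in>{1..n}. H k \<in> C01"
  shows "Lambda_prod n \<pi> H \<in> C01"
proof -
  obtain B where B: "integrable (\<Pi>\<^sub>M j\<in>std_coords n \<pi>. lborel)
      (\<lambda>s. B * indicator (std_coords n \<pi> \<rightarrow>\<^sub>E {0..1::real}) s :: real)"
    "\<forall>x. \<forall>s\<in>space (\<Pi>\<^sub>M j\<in>std_coords n \<pi>. lborel).
      norm (\<Prod>k\<in>{1..n}. H k (std_point n \<pi> x s (k mod n))) \<le> B * indicator (std_coords n \<pi> \<rightarrow>\<^sub>E {0..1::real}) s"
    using Lambda_prod_integrand_bound[OF assms] by (elim exE conjE) (rule that)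
  have "(\<lambda>i. Lambda_prod n \<pi> H (u i)) \<longlonglongrightarrow> Lambda_prod n \<pi> H x"
    if x: "x \<in> {0..1}" and u: "\<And>i. u i \<in> {0..1}" "u \<longlonglongrightarrow> x" for x u
    unfolding Lambda_prod_def
  proof (rule integral_dominated_convergence[OF _ _ B(1)])
    have "AE s in (\<Pi>\<^sub>M j\<in>std_coords n \<pi>. lborel). \<forall>k\<in>{1..n}.
        (\<lambda>i. H k (std_point n \<pi> (u i) s (k mod n))) \<longlonglongrightarrow> H k (std_point n \<pi> x s (k mod n))"
      using \<pi> H x u by (intro AE_finite_allI std_point_AE_tendsto) auto
    then show "AE s in (\<Pi>\<^sub>M j\<in>std_coords n \<pi>. lborel).
        (\<lambda>i. \<Prod>k\<in>{1..n}. H k (std_point n \<pi> (u i) s (k mod n))) \<longlonglongrightarrow> (\<Prod>k\<in>{1..n}. H k (std_point n \<pi> x s (k mod n)))"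
      by eventually_elim (intro tendsto_prod, blast)
  qed (use Lambda_prod_integrand_measurable[OF assms] B(2) in \<open>auto intro!: AE_I2\<close>)
  then have "continuous_on {0..1} (Lambda_prod n \<pi> H)"
    by (auto simp: continuous_on_sequentially comp_def)
  then show ?thesis
    using Lambda_prod_outside[OF \<pi>, of H] H[rule_format, of n] \<pi>(2) by (auto simp: C01_def)
qed

section \<open>Reductions of a partition\<close>

lemma lborel_PiM_reindex:
  fixes h :: "'a \<Rightarrow> 'b"
  assumes fin: "finite J" and inj: "inj_on h J"
  shows "distr (\<Pi>\<^sub>M i\<in>h ` J. lborel) (\<Pi>\<^sub>M j\<in>J. lborel) (\<lambda>s. restrict (s \<circ> h) J) =
    (\<Pi>\<^sub>M j\<in>J. (lborel :: real measure))"
proof -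
  interpret A: product_sigma_finite "\<lambda>_::'a. lborel :: real measure" ..
  interpret B: product_sigma_finite "\<lambda>_::'b. lborel :: real measure" ..
  let ?M = "\<Pi>\<^sub>M i\<in>h ` J. (lborel :: real measure)" and ?N = "\<Pi>\<^sub>M j\<in>J. (lborel :: real measure)"
  let ?r = "\<lambda>s. restrict (s \<circ> h) J"
  have meas: "?r \<in> measurable ?M ?N"
    by (rule measurable_restrict) (auto intro!: measurable_component_singleton)
  show ?thesis
  proof (rule A.PiM_eqI[OF fin])
    fix A :: "'a \<Rightarrow> real set" assume A: "\<And>i. i \<in> J \<Longrightarrow> A i \<in> sets lborel"
    have "?r -` Pi\<^sub>E J A \<inter> space ?M = (\<Pi>\<^sub>E i\<in>h ` J. A (inv_into J h i))"
      using inj by (auto simp: space_PiM PiE_iff)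
    then have "emeasure (distr ?M ?N ?r) (Pi\<^sub>E J A) = emeasure ?M (\<Pi>\<^sub>E i\<in>h ` J. A (inv_into J h i))"
      using A fin meas by (subst emeasure_distr) (auto intro!: sets_PiM_I_finite)
    also have "\<dots> = (\<Prod>i\<in>h ` J. emeasure lborel (A (inv_into J h i)))"
      using A fin inj by (subst B.emeasure_PiM) auto
    also have "\<dots> = (\<Prod>i\<in>J. emeasure lborel (A i))"
      using inj by (simp add: prod.reindex)
    finally show "emeasure (distr ?M ?N ?r) (Pi\<^sub>E J A) = (\<Prod>i\<in>J. emeasure lborel (A i))" .
  qed simp
qed

text \<open>The function \<open>s \<circ> h\<close> is not restricted to J, whence the assumption
  that f sees its argument on J alone.\<close>

lemma integral_PiM_reindex:
  fixes h :: "'a \<Rightarrow> 'b" and f :: "('a \<Rightarrow> real) \<Rightarrow> complex"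
  assumes fin: "finite J" and inj: "inj_on h J"
    and f: "f \<in> borel_measurable (\<Pi>\<^sub>M j\<in>J. lborel)"
    and cong: "\<And>s. f (restrict s J) = f s"
  shows "(LINT s|(\<Pi>\<^sub>M i\<in>h ` J. lborel). f (s \<circ> h)) = (LINT s|(\<Pi>\<^sub>M j\<in>J. lborel). f s)"
proof -
  have meas: "(\<lambda>s. restrict (s \<circ> h) J) \<in> measurable (\<Pi>\<^sub>M i\<in>h ` J. lborel) (\<Pi>\<^sub>M j\<in>J. (lborel :: real measure))"
    by (rule measurable_restrict) (auto intro!: measurable_component_singleton)
  show ?thesis
    by (subst lborel_PiM_reindex[OF fin inj, symmetric], subst integral_distr[OF meas f])
       (simp only: cong)
qed

lemma std_point_restrict: "std_point n \<pi> x (restrict s (std_coords n \<pi>)) = std_point n \<pi> x s"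
  by (rule V_point_cong) simp

lemma Lambda_prod_reindex:
  assumes \<pi>: "\<pi> \<in> partitions n" "0 < n" and H: "\<forall>k\<in>{1..n}. H k \<in> C01"
    and inj: "inj_on h (std_coords n \<pi>)"
  shows "(LINT s|(\<Pi>\<^sub>M i\<in>h ` std_coords n \<pi>. lborel). (\<Prod>k\<in>{1..n}. H k (std_point n \<pi> x (s \<circ> h) (k mod n))))
    = Lambda_prod n \<pi> H x"
  unfolding Lambda_prod_def
  by (rule integral_PiM_reindex[OF std_coords_sub(2) inj Lambda_prod_integrand_measurable[OF \<pi> H]])
     (simp only: std_point_restrict)

lemma trace01_C01: "f \<in> C01 \<Longrightarrow> trace01 f = (LINT t|lborel. f t)"
  unfolding trace01_def set_lebesgue_integral_def
  by (rule Bochner_Integration.integral_cong) (auto simp: C01_def indicator_def)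

lemma C01_mult: "f \<in> C01 \<Longrightarrow> g \<in> C01 \<Longrightarrow> (\<lambda>x. f x * g x) \<in> C01"
  by (auto simp: C01_def intro!: continuous_intros)

text \<open>Along a surjection d, the pullbacks are exactly the partitions that put points with
  equal d-value into one block. Merging two neighbours and closing the cycle are both of this
  kind.\<close>

definition pullback :: "nat \<Rightarrow> (nat \<Rightarrow> nat) \<Rightarrow> nat set set \<Rightarrow> nat set set" where
  "pullback n d \<pi> = (\<lambda>S. d -` S \<inter> {1..n}) ` \<pi>"

lemma partitionsI:
  assumes "\<And>S. S \<in> \<pi> \<Longrightarrow> S \<noteq> {} \<and> S \<subseteq> {1..n}" "\<And>i. i \<in> {1..n} \<Longrightarrow> \<exists>S\<in>\<pi>. i \<in> S"
    "\<And>S S' i. S \<in> \<pi> \<Longrightarrow> S' \<in> \<pi> \<Longrightarrow> i \<in> S \<Longrightarrow> i \<in> S' \<Longrightarrow> S = S'"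
  shows "\<pi> \<in> partitions n"
  unfolding partitions_def partition_on_def disjoint_def
proof (intro CollectI conjI ballI impI)
  show "\<Union>\<pi> = {1..n}" using assms(1,2) by blast
  show "{} \<notin> \<pi>" using assms(1) by blast
  show "S \<inter> S' = {}" if "S \<in> \<pi>" "S' \<in> \<pi>" "S \<noteq> S'" for S S' using assms(3) that by blast
qed

lemma partitions_nonempty: "\<pi> \<in> partitions n \<Longrightarrow> S \<in> \<pi> \<Longrightarrow> S \<noteq> {}"
  by (auto simp: partitions_def partition_on_def)

lemma pullback_partition:
  assumes \<pi>: "\<pi> \<in> partitions m" and d: "d ` {1..n} = {1..m}"
  shows "pullback n d \<pi> \<in> partitions n"
proof (rule partitionsI)
  fix S assume "S \<in> pullback n d \<pi>"
  then obtain T where T: "T \<in> \<pi>" "S = d -` T \<inter> {1..n}" by (auto simp: pullback_def)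
  then obtain i where "i \<in> T" using partitions_nonempty[OF \<pi>] by blast
  then have "i \<in> d ` {1..n}" using partition_block_subset[OF \<pi> T(1)] d by auto
  then show "S \<noteq> {} \<and> S \<subseteq> {1..n}" using T(2) \<open>i \<in> T\<close> by auto
next
  fix i assume i: "i \<in> {1..n}"
  then have "d i \<in> {1..m}" using d by blast
  then obtain T where "T \<in> \<pi>" "d i \<in> T" using partition_unique_block[OF \<pi>] by blast
  then show "\<exists>S\<in>pullback n d \<pi>. i \<in> S" using i by (auto simp: pullback_def)
next
  fix S S' i assume "S \<in> pullback n d \<pi>" "S' \<in> pullback n d \<pi>" "i \<in> S" "i \<in> S'"
  then obtain T T' where "T \<in> \<pi>" "S = d -` T \<inter> {1..n}" "T' \<in> \<pi>" "S' = d -` T' \<inter> {1..n}" "d i \<in> T" "d i \<in> T'"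
    by (auto simp: pullback_def)
  then show "S = S'" using partition_block_eq[OF \<pi>, of T T' "d i"] by simp
qed

lemma same_block_pullback:
  "same_block (pullback n d \<pi>) i j \<longleftrightarrow> i \<in> {1..n} \<and> j \<in> {1..n} \<and> same_block \<pi> (d i) (d j)"
  by (auto simp: same_block_def pullback_def)

lemma same_block_bounds:
  assumes "\<pi> \<in> partitions n" "same_block \<pi> i j"
  shows "i \<in> {1..n}" "j \<in> {1..n}"
  using assms(2) partition_block_subset[OF assms(1)] unfolding same_block_def by blast+

lemma same_block_refl: "\<pi> \<in> partitions n \<Longrightarrow> i \<in> {1..n} \<Longrightarrow> same_block \<pi> i i"
  using partition_unique_block[of \<pi> n i] by (auto simp: same_block_def)

lemma same_block_sym: "same_block \<pi> i j \<longleftrightarrow> same_block \<pi> j i"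
  by (auto simp: same_block_def)

lemma partition_eqI:
  assumes \<pi>: "\<pi> \<in> partitions n" and \<pi>': "\<pi>' \<in> partitions n"
    and eq: "\<And>i j. i \<in> {1..n} \<Longrightarrow> j \<in> {1..n} \<Longrightarrow> same_block \<pi> i j \<longleftrightarrow> same_block \<pi>' i j"
  shows "\<pi> = \<pi>'"
proof -
  have *: "S \<in> \<rho>'" if \<rho>: "\<rho> \<in> partitions n" and \<rho>': "\<rho>' \<in> partitions n"
    and e: "\<And>i j. i \<in> {1..n} \<Longrightarrow> j \<in> {1..n} \<Longrightarrow> same_block \<rho> i j \<longleftrightarrow> same_block \<rho>' i j"
    and S: "S \<in> \<rho>" for \<rho> \<rho>' S
  proof -
    obtain i where i: "i \<in> S" using partitions_nonempty[OF \<rho> S] by blast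
    then have i': "i \<in> {1..n}" using partition_block_subset[OF \<rho> S] by blast
    obtain T where T: "T \<in> \<rho>'" "i \<in> T" using partition_unique_block[OF \<rho>' i'] by blast
    have "j \<in> S \<longleftrightarrow> j \<in> T" for j
    proof (cases "j \<in> {1..n}")
      case True
      then show ?thesis
        using e[OF i' True] same_block_iff[OF \<rho> S i] same_block_iff[OF \<rho>' T] by simp
    next
      case False
      then show ?thesis using partition_block_subset[OF \<rho> S] partition_block_subset[OF \<rho>' T(1)] by blast
    qed
    then have "S = T" by blast
    then show ?thesis using T by simp
  qed
  show ?thesis
    using *[OF \<pi> \<pi>'] *[OF \<pi>' \<pi>] eq by blast
qed

text \<open>The equation of a preimage block decomposes over the fibres of d, so it is enough that
  the differences of t over each fibre add up to the corresponding difference of u.\<close>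

lemma V_pullback:
  assumes \<pi>: "\<pi> \<in> partitions m" and d: "d ` {1..n} = {1..m}"
    and u: "u \<in> V m \<pi>" and t: "\<And>k. n \<le> k \<Longrightarrow> t k = 0"
    and eq: "\<And>i. i \<in> {1..m} \<Longrightarrow>
      (\<Sum>k\<in>{k\<in>{1..n}. d k = i}. t (k - 1) - t (k mod n)) = u (i - 1) - u (i mod m)"
  shows "t \<in> V n (pullback n d \<pi>)"
proof -
  have "(\<Sum>k\<in>d -` S \<inter> {1..n}. t (k - 1) - t (k mod n)) = 0" if S: "S \<in> \<pi>" for S
  proof -
    have sub: "S \<subseteq> {1..m}" by (rule partition_block_subset[OF \<pi> S])
    then have fin: "finite S" by (rule finite_subset) simp
    have "(\<Sum>k\<in>d -` S \<inter> {1..n}. t (k - 1) - t (k mod n))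
        = (\<Sum>i\<in>S. \<Sum>k\<in>{k\<in>d -` S \<inter> {1..n}. d k = i}. t (k - 1) - t (k mod n))"
      by (rule sum.group[symmetric]) (use fin in auto)
    also have "\<dots> = (\<Sum>i\<in>S. \<Sum>k\<in>{k\<in>{1..n}. d k = i}. t (k - 1) - t (k mod n))"
      by (intro sum.cong) auto
    also have "\<dots> = (\<Sum>i\<in>S. u (i - 1) - u (i mod m))"
      using eq sub by (intro sum.cong) auto
    also have "\<dots> = 0" using u S by (simp add: V_def)
    finally show ?thesis .
  qed
  then show ?thesis using t by (auto simp: V_def pullback_def)
qed

text \<open>If \<open>k\<close> and \<open>k + 1\<close> lie in the same block, then \<open>t k\<close> cancels from the equations; identifying the two
  points removes this free variable.\<close>

definition merge_succ :: "nat \<Rightarrow> nat \<Rightarrow> nat" where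
  "merge_succ k i = (if i \<le> k then i else i - 1)"

text \<open>Variables are renumbered in the direction opposite to points: those from k on move up
  and leave a gap for the freed variable k.\<close>

definition skip :: "nat \<Rightarrow> nat \<Rightarrow> nat" where
  "skip k i = (if i < k then i else i + 1)"

lemma merge_succ_image:
  assumes "k \<in> {1..<n}"
  shows "merge_succ k ` {1..n} = {1..n - 1}"
proof (intro equalityI subsetI)
  fix i assume i: "i \<in> {1..n - 1}"
  show "i \<in> merge_succ k ` {1..n}"
    by (rule image_eqI[of _ _ "if i \<le> k then i else i + 1"]) (use i assms in \<open>auto simp: merge_succ_def\<close>)
qed (use assms in \<open>auto simp: merge_succ_def\<close>)

text \<open>The point k + 1 has k before it in its block, so k is a coordinate. Any other point
  begins its block exactly when its image does.\<close>

lemma std_coords_merge: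
  assumes k: "k \<in> {1..<n}" and \<pi>: "\<pi> \<in> partitions (n - 1)"
  shows "std_coords n (pullback n (merge_succ k) \<pi>) = insert k (skip k ` std_coords (n - 1) \<pi>)"
proof (intro set_eqI)
  fix j
  let ?P = "pullback n (merge_succ k) \<pi>"
  consider "j < k" | "j = k" | "k < j" by linarith
  then show "j \<in> std_coords n ?P \<longleftrightarrow> j \<in> insert k (skip k ` std_coords (n - 1) \<pi>)"
  proof cases
    case 1
    then have "j \<in> insert k (skip k ` std_coords (n - 1) \<pi>) \<longleftrightarrow> j \<in> std_coords (n - 1) \<pi>"
      by (auto simp: skip_def image_iff)
    also have "\<dots> \<longleftrightarrow> j \<in> std_coords n ?P"
      using 1 k by (auto simp: std_coords_def same_block_pullback merge_succ_def)
    finally show ?thesis ..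
  next
    case 2
    have "same_block ?P k (k + 1)"
      using k same_block_refl[OF \<pi>, of k] by (auto simp: same_block_pullback merge_succ_def)
    then show ?thesis using 2 k by (auto simp: std_coords_def)
  next
    case 3
    then have "j \<in> insert k (skip k ` std_coords (n - 1) \<pi>) \<longleftrightarrow> j - 1 \<in> std_coords (n - 1) \<pi>"
      by (auto simp: skip_def image_iff intro!: bexI[of _ "j - 1"])
    also have "\<dots> \<longleftrightarrow> j \<in> std_coords n ?P"
    proof
      assume "j - 1 \<in> std_coords (n - 1) \<pi>"
      then obtain i where i: "j - 1 < n - 1" "1 \<le> i" "i \<le> j - 1" "same_block \<pi> i (j - 1 + 1)"
        by (auto simp: std_coords_def)
      \<comment> \<open>A preimage of i; even if it moves up by one it is at most j, because
        \<open>i \<le> j - 1\<close>.\<close>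
      define l where "l = (if i \<le> k then i else i + 1)"
      have "same_block ?P l (j + 1)" "l \<in> {1..j}"
        using i 3 k by (auto simp: l_def same_block_pullback merge_succ_def)
      then show "j \<in> std_coords n ?P" using i by (auto simp: std_coords_def)
    next
      assume "j \<in> std_coords n ?P"
      then obtain i where i: "j < n" "1 \<le> i" "i \<le> j" "same_block \<pi> (merge_succ k i) j"
        using 3 by (auto simp: std_coords_def same_block_pullback merge_succ_def)
      have "merge_succ k i \<in> {1..j - 1}" using i 3 k by (auto simp: merge_succ_def)
      then show "j - 1 \<in> std_coords (n - 1) \<pi>" using i 3 k by (auto simp: std_coords_def)
    qed
    finally show ?thesis ..
  qed
qed

lemma std_point_merge:
  assumes k: "k \<in> {1..<n}" and \<pi>: "\<pi> \<in> partitions (n - 1)"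
  shows "std_point n (pullback n (merge_succ k) \<pi>) x s =
    (\<lambda>i. if i < k then std_point (n - 1) \<pi> x (s \<circ> skip k) i else if i = k then s k
      else std_point (n - 1) \<pi> x (s \<circ> skip k) (i - 1))"
    (is "std_point n ?P x s = ?t")
proof -
  define u where "u = std_point (n - 1) \<pi> x (s \<circ> skip k)"
  have n: "0 < n - 1" "0 < n" using k by auto
  have P: "?P \<in> partitions n" by (rule pullback_partition[OF \<pi> merge_succ_image[OF k]])
  note u = V_point_spec[OF free_coords_std[OF \<pi> n(1)], where x = x and s = "s \<circ> skip k", folded u_def]
  define t where "t = (\<lambda>i. if i < k then u i else if i = k then s k else u (i - 1))"
  have u0: "u i = 0" if "n - 1 \<le> i" for i using u(1) that by (simp add: V_def)
  have tV: "t \<in> V n ?P"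
  proof (rule V_pullback[OF \<pi> merge_succ_image[OF k] u(1)])
    show "t i = 0" if "n \<le> i" for i using that u0 k by (auto simp: t_def)
    fix i assume i: "i \<in> {1..n - 1}"
    consider "i < k" | "i = k" | "k < i" by linarith
    then show "(\<Sum>l\<in>{l\<in>{1..n}. merge_succ k l = i}. t (l - 1) - t (l mod n)) = u (i - 1) - u (i mod (n - 1))"
    proof cases
      case 1
      then have "{l\<in>{1..n}. merge_succ k l = i} = {i}" using i by (auto simp: merge_succ_def split: if_splits)
      then show ?thesis using 1 i k by (auto simp: t_def)
    next
      case 2
      \<comment> \<open>On the only fibre with two points the differences telescope over t k. For k
        + 1 = n the right end is t 0.\<close>
      then have "{l\<in>{1..n}. merge_succ k l = i} = {k, k + 1}"
        using i k by (auto simp: merge_succ_def split: if_splits)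
      moreover have "t ((k + 1) mod n) = u (k mod (n - 1))"
      proof (cases "k + 1 = n")
        case True
        then have "n - 1 = k" by simp
        then show ?thesis using True k by (simp add: t_def)
      next
        case False
        then show ?thesis using k by (auto simp: t_def)
      qed
      ultimately show ?thesis using 2 k by (auto simp: t_def)
    next
      case 3
      then have "{l\<in>{1..n}. merge_succ k l = i} = {i + 1}"
        using i k by (auto simp: merge_succ_def split: if_splits)
      moreover have "t ((i + 1) mod n) = u (i mod (n - 1))"
      proof (cases "i + 1 = n")
        case True
        then have "n - 1 = i" by simp
        then show ?thesis using True k by (simp add: t_def)
      next
        case False
        then show ?thesis using k i 3 by (auto simp: t_def)
      qed
      ultimately show ?thesis using 3 k by (auto simp: t_def)
    qed
  qed
  have "std_point n ?P x s = t"
  proof (rule V_point_eqI[OF free_coords_std[OF P n(2)] tV])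
    show "t 0 = x" using u(2) k by (simp add: t_def)
    fix j assume "j \<in> std_coords n ?P"
    then consider "j = k" | i where "i \<in> std_coords (n - 1) \<pi>" "j = skip k i"
      unfolding std_coords_merge[OF k \<pi>] by blast
    then show "t j = s j"
    proof cases
      case 2
      then show ?thesis using u(3)[OF 2(1)] by (auto simp: t_def skip_def)
    qed (simp add: t_def)
  qed
  then show ?thesis unfolding t_def u_def .
qed

text \<open>The added coordinate occurs in the factor \<open>H k\<close> and nowhere else, so
  Fubini's theorem separates its integral, the trace.\<close>

lemma Lambda_prod_merge:
  assumes k: "k \<in> {1..<n}" and \<pi>: "\<pi> \<in> partitions (n - 1)" and H: "\<forall>i\<in>{1..n}. H i \<in> C01"
  shows "Lambda_prod n (pullback n (merge_succ k) \<pi>) H x = trace01 (H k) * Lambda_prod (n - 1) \<pi> (H \<circ> skip k) x"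
proof -
  interpret product_sigma_finite "\<lambda>_::nat. lborel :: real measure" ..
  let ?P = "pullback n (merge_succ k) \<pi>" and ?J = "std_coords (n - 1) \<pi>"
  have n: "0 < n - 1" "0 < n" using k by auto
  have P: "?P \<in> partitions n" by (rule pullback_partition[OF \<pi> merge_succ_image[OF k]])
  let ?L = "skip k ` ?J"
  have L: "finite ?L" "k \<notin> ?L" using std_coords_sub by (auto simp: skip_def)
  have inj: "inj (skip k)" by (auto simp: inj_def skip_def split: if_splits)
  let ?g = "\<lambda>s. \<Prod>i\<in>{1..n - 1}. (H \<circ> skip k) i (std_point (n - 1) \<pi> x (s \<circ> skip k) (i mod (n - 1)))"
  have eq: "(\<Prod>i\<in>{1..n}. H i (std_point n ?P x s (i mod n))) = H k (s k) * ?g s" for s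
  proof -
    have set: "{1..n} = insert k (skip k ` {1..n - 1})"
    proof (intro equalityI subsetI)
      fix i assume i: "i \<in> {1..n}"
      show "i \<in> insert k (skip k ` {1..n - 1})"
      proof (cases "i = k")
        case False
        then have "i = skip k (if i < k then i else i - 1)" "(if i < k then i else i - 1) \<in> {1..n - 1}"
          using i k by (auto simp: skip_def)
        then show ?thesis by blast
      qed simp
    qed (use k in \<open>auto simp: skip_def\<close>)
    have "(\<Prod>i\<in>{1..n}. H i (std_point n ?P x s (i mod n))) =
        H k (std_point n ?P x s (k mod n)) * (\<Prod>i\<in>skip k ` {1..n - 1}. H i (std_point n ?P x s (i mod n)))"
      unfolding set by (rule prod.insert) (auto simp: skip_def)
    also have "(\<Prod>i\<in>skip k ` {1..n - 1}. H i (std_point n ?P x s (i mod n))) =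
        (\<Prod>i\<in>{1..n - 1}. H (skip k i) (std_point n ?P x s (skip k i mod n)))"
      using inj by (subst prod.reindex) (auto intro: inj_on_subset)
    also have "\<dots> = ?g s"
    proof (rule prod.cong[OF refl])
      fix i assume i: "i \<in> {1..n - 1}"
      have "std_point n ?P x s (skip k i mod n) = std_point (n - 1) \<pi> x (s \<circ> skip k) (i mod (n - 1))"
      proof (cases "i = n - 1")
        case True
        then have "skip k i mod n = 0" using k by (auto simp: skip_def)
        then show ?thesis using True k by (simp add: std_point_merge[OF k \<pi>])
      next
        case False
        then have "skip k i mod n = skip k i" "i mod (n - 1) = i" using i by (auto simp: skip_def)
        then show ?thesis by (auto simp: std_point_merge[OF k \<pi>] skip_def)
      qed
      then show "H (skip k i) (std_point n ?P x s (skip k i mod n)) =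
          (H \<circ> skip k) i (std_point (n - 1) \<pi> x (s \<circ> skip k) (i mod (n - 1)))" by simp
    qed
    also have "std_point n ?P x s (k mod n) = s k" using k by (simp add: std_point_merge[OF k \<pi>])
    finally show ?thesis .
  qed
  have "integrable (\<Pi>\<^sub>M j\<in>std_coords n ?P. lborel) (\<lambda>s. H k (s k) * ?g s)"
    using Lambda_prod_integrable[OF P n(2) H, of x] by (simp only: eq)
  then have "integrable (\<Pi>\<^sub>M j\<in>insert k ?L. lborel) (\<lambda>s. H k (s k) * ?g s)"
    unfolding std_coords_merge[OF k \<pi>] .
  from product_integral_insert[OF L this]
  have "Lambda_prod n ?P H x = (LINT s|(\<Pi>\<^sub>M j\<in>?L. lborel). (LINT y|lborel. H k y * ?g (s(k := y))))"
    unfolding Lambda_prod_def eq by (simp add: std_coords_merge[OF k \<pi>])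
  also have "\<dots> = (LINT s|(\<Pi>\<^sub>M j\<in>?L. lborel). trace01 (H k) * ?g s)"
  proof (rule Bochner_Integration.integral_cong[OF refl])
    fix s :: "nat \<Rightarrow> real"
    have "s(k := y) \<circ> skip k = s \<circ> skip k" for y by (auto simp: skip_def)
    moreover have "H k \<in> C01" using H k by auto
    ultimately show "(LINT y|lborel. H k y * ?g (s(k := y))) = trace01 (H k) * ?g s"
      by (simp add: trace01_C01)
  qed
  also have "\<dots> = trace01 (H k) * (LINT s|(\<Pi>\<^sub>M j\<in>?L. lborel). ?g s)" by simp
  also have "(LINT s|(\<Pi>\<^sub>M j\<in>?L. lborel). ?g s) = Lambda_prod (n - 1) \<pi> (H \<circ> skip k) x"
  proof (rule Lambda_prod_reindex[OF \<pi> n(1)])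
    show "\<forall>i\<in>{1..n - 1}. (H \<circ> skip k) i \<in> C01" using H k by (auto simp: skip_def)
    show "inj_on (skip k) ?J" using inj by (rule inj_on_subset) simp
  qed
  finally show ?thesis .
qed

text \<open>If \<open>1\<close> and \<open>n\<close> lie in the same block, then \<open>t 0\<close> cancels from the equations, and \<open>t (n - 1)\<close> takes over
  its role in the partition obtained by identifying \<open>n\<close> with \<open>1\<close>.\<close>

definition close_end :: "nat \<Rightarrow> nat \<Rightarrow> nat" where
  "close_end n i = (if i = n then 1 else i)"

lemma close_end_image: "2 \<le> n \<Longrightarrow> close_end n ` {1..n} = {1..n - 1}"
proof (intro equalityI subsetI)
  fix i assume "2 \<le> n" "i \<in> {1..n - 1}"
  then show "i \<in> close_end n ` {1..n}"
    by (intro image_eqI[of _ _ i]) (auto simp: close_end_def)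
qed (auto simp: close_end_def split: if_splits)

lemma std_coords_close:
  assumes n: "2 \<le> n" and \<pi>: "\<pi> \<in> partitions (n - 1)"
  shows "std_coords n (pullback n (close_end n) \<pi>) = insert (n - 1) (std_coords (n - 1) \<pi>)"
proof (intro set_eqI)
  fix j
  let ?P = "pullback n (close_end n) \<pi>"
  consider "j < n - 1" | "j = n - 1" | "n \<le> j" by linarith
  then show "j \<in> std_coords n ?P \<longleftrightarrow> j \<in> insert (n - 1) (std_coords (n - 1) \<pi>)"
  proof cases
    case 1
    then have "same_block ?P l (j + 1) \<longleftrightarrow> same_block \<pi> l (j + 1)" if "l \<in> {1..j}" for l
      using that by (auto simp: same_block_pullback close_end_def)
    then show ?thesis using 1 by (auto simp: std_coords_def)
  next
    case 2
    have "same_block ?P 1 (n - 1 + 1)"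
      using n same_block_refl[OF \<pi>, of 1] by (auto simp: same_block_pullback close_end_def)
    then show ?thesis using 2 n by (auto simp: std_coords_def)
  qed (use n in \<open>auto simp: std_coords_def\<close>)
qed

lemma std_point_close:
  assumes n: "2 \<le> n" and \<pi>: "\<pi> \<in> partitions (n - 1)"
  shows "std_point n (pullback n (close_end n) \<pi>) x s =
    (\<lambda>i. if i = 0 then x else if i = n - 1 then s (n - 1) else std_point (n - 1) \<pi> (s (n - 1)) s i)"
proof -
  let ?P = "pullback n (close_end n) \<pi>"
  define u where "u = std_point (n - 1) \<pi> (s (n - 1)) s"
  have n': "0 < n - 1" "0 < n" using n by auto
  have P: "?P \<in> partitions n" by (rule pullback_partition[OF \<pi> close_end_image[OF n]])
  note u = V_point_spec[OF free_coords_std[OF \<pi> n'(1)], where x = "s (n - 1)" and s = s, folded u_def]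
  define t where "t = (\<lambda>i. if i = 0 then x else if i = n - 1 then s (n - 1) else u i)"
  have u0: "u i = 0" if "n - 1 \<le> i" for i using u(1) that by (simp add: V_def)
  have tV: "t \<in> V n ?P"
  proof (rule V_pullback[OF \<pi> close_end_image[OF n] u(1)])
    show "t i = 0" if "n \<le> i" for i using that u0 n by (auto simp: t_def)
    fix i assume i: "i \<in> {1..n - 1}"
    have tu: "t i = u (i mod (n - 1))"
      using i u(2) by (cases "i = n - 1") (auto simp: t_def)
    have "i mod n = i" using i by auto
    show "(\<Sum>l\<in>{l\<in>{1..n}. close_end n l = i}. t (l - 1) - t (l mod n)) = u (i - 1) - u (i mod (n - 1))"
    proof (cases "i = 1")
      case True
      \<comment> \<open>The differences at 1 and at n contain t 0 with opposite signs and leave t (n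
        - 1) - t 1.\<close>
      then have "{l\<in>{1..n}. close_end n l = i} = {1, n}"
        using n by (auto simp: close_end_def split: if_splits)
      then have "(\<Sum>l\<in>{l\<in>{1..n}. close_end n l = i}. t (l - 1) - t (l mod n))
          = (t 0 - t 1) + (t (n - 1) - t 0)"
        using n by simp
      then show ?thesis using True tu u(2) n by (simp add: t_def)
    next
      case False
      then have "{l\<in>{1..n}. close_end n l = i} = {i}"
        using i by (auto simp: close_end_def split: if_splits)
      moreover have "t (i - 1) = u (i - 1)" using False i by (auto simp: t_def)
      ultimately show ?thesis by (simp add: tu \<open>i mod n = i\<close>)
    qed
  qed
  have "std_point n ?P x s = t"
  proof (rule V_point_eqI[OF free_coords_std[OF P n'(2)] tV])
    show "t 0 = x" by (simp add: t_def)
    fix j assume "j \<in> std_coords n ?P"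
    then have "j = n - 1 \<or> j \<in> std_coords (n - 1) \<pi>"
      unfolding std_coords_close[OF n \<pi>] by blast
    then show "t j = s j"
      using u(3)[of j] n' std_coords_sub(1)[of "n - 1" \<pi>] by (auto simp: t_def)
  qed
  then show ?thesis unfolding t_def u_def .
qed

text \<open>Only the factor with index n still sees x. The others form
  \<open>Lambda_prod (n - 1) \<pi> H\<close> with base value t (n - 1), and integrating over this
  value gives a trace.\<close>

lemma Lambda_prod_close:
  assumes n: "2 \<le> n" and \<pi>: "\<pi> \<in> partitions (n - 1)" and H: "\<forall>i\<in>{1..n}. H i \<in> C01"
  shows "Lambda_prod n (pullback n (close_end n) \<pi>) H x = H n x * trace01 (Lambda_prod (n - 1) \<pi> H)"
proof -
  interpret product_sigma_finite "\<lambda>_::nat. lborel :: real measure" ..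
  let ?P = "pullback n (close_end n) \<pi>" and ?J = "std_coords (n - 1) \<pi>"
  have n': "0 < n - 1" "0 < n" using n by auto
  have P: "?P \<in> partitions n" by (rule pullback_partition[OF \<pi> close_end_image[OF n]])
  have J: "finite ?J" "n - 1 \<notin> ?J"
    using std_coords_sub[of "n - 1" \<pi>] by auto
  have H': "\<forall>i\<in>{1..n - 1}. H i \<in> C01" using H by auto
  let ?g = "\<lambda>s. \<Prod>i\<in>{1..n - 1}. H i (std_point (n - 1) \<pi> (s (n - 1)) s (i mod (n - 1)))"
  have eq: "(\<Prod>i\<in>{1..n}. H i (std_point n ?P x s (i mod n))) = H n x * ?g s" for s
  proof -
    have "{1..n} = insert n {1..n - 1}" using n by auto
    then have "(\<Prod>i\<in>{1..n}. H i (std_point n ?P x s (i mod n))) =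
        H n (std_point n ?P x s (n mod n)) * (\<Prod>i\<in>{1..n - 1}. H i (std_point n ?P x s (i mod n)))"
      using n by simp
    also have "(\<Prod>i\<in>{1..n - 1}. H i (std_point n ?P x s (i mod n))) = ?g s"
    proof (rule prod.cong[OF refl])
      fix i assume i: "i \<in> {1..n - 1}"
      then have "i mod n = i" by auto
      then have "std_point n ?P x s (i mod n) = std_point (n - 1) \<pi> (s (n - 1)) s (i mod (n - 1))"
        using i V_point_spec(2)[OF free_coords_std[OF \<pi> n'(1)], where x = "s (n - 1)" and s = s]
        by (cases "i = n - 1") (auto simp: std_point_close[OF n \<pi>])
      then show "H i (std_point n ?P x s (i mod n)) = H i (std_point (n - 1) \<pi> (s (n - 1)) s (i mod (n - 1)))" by simp
    qed
    also have "std_point n ?P x s (n mod n) = x" using n by (simp add: std_point_close[OF n \<pi>])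
    finally show ?thesis .
  qed
  have "integrable (\<Pi>\<^sub>M j\<in>std_coords n ?P. lborel) (\<lambda>s. H n x * ?g s)"
    using Lambda_prod_integrable[OF P n'(2) H, of x] by (simp only: eq)
  then have "integrable (\<Pi>\<^sub>M j\<in>{n - 1} \<union> ?J. lborel) (\<lambda>s. H n x * ?g s)"
    by (simp add: std_coords_close[OF n \<pi>])
  \<comment> \<open>The coordinate n - 1 becomes the outer variable, because it is the base value of
    the inner integral.\<close>
  from product_integral_fold[OF _ _ J(1) this]
  have "Lambda_prod n ?P H x = (LINT a|(\<Pi>\<^sub>M j\<in>{n - 1}. lborel). (LINT b|(\<Pi>\<^sub>M j\<in>?J. lborel).
      H n x * ?g (merge {n - 1} ?J (a, b))))"
    unfolding Lambda_prod_def eq using J(2) by (simp add: std_coords_close[OF n \<pi>])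
  also have "\<dots> = (LINT a|(\<Pi>\<^sub>M j\<in>{n - 1}. lborel). H n x * Lambda_prod (n - 1) \<pi> H (a (n - 1)))"
  proof (rule Bochner_Integration.integral_cong[OF refl])
    fix a :: "nat \<Rightarrow> real"
    have "std_point (n - 1) \<pi> y (merge {n - 1} ?J (a, b)) = std_point (n - 1) \<pi> y b" for y b
      by (rule V_point_cong) (use J(2) in \<open>auto simp: merge_def\<close>)
    then have "?g (merge {n - 1} ?J (a, b)) = (\<Prod>i\<in>{1..n - 1}. H i (std_point (n - 1) \<pi> (a (n - 1)) b (i mod (n - 1))))" for b
      by (simp add: merge_def)
    then show "(LINT b|(\<Pi>\<^sub>M j\<in>?J. lborel). H n x * ?g (merge {n - 1} ?J (a, b))) = H n x * Lambda_prod (n - 1) \<pi> H (a (n - 1))"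
      unfolding Lambda_prod_def by simp
  qed
  also have "\<dots> = (LINT y|lborel. H n x * Lambda_prod (n - 1) \<pi> H y)"
    by (rule product_integral_singleton) (use C01_measurable[OF Lambda_prod_C01[OF \<pi> n'(1) H']] in simp)
  also have "\<dots> = H n x * trace01 (Lambda_prod (n - 1) \<pi> H)"
    unfolding trace01_C01[OF Lambda_prod_C01[OF \<pi> n'(1) H']] by (rule integral_mult_right_zero)
  finally show ?thesis .
qed

text \<open>Inserting a partition \<open>\<rho>\<close> of \<open>i\<close> points after the point \<open>a\<close> of \<open>\<sigma>\<close>. The equations of \<open>\<rho>\<close> add up to
  \<open>t a = t (a + i)\<close>, so the variables of \<open>\<rho>\<close> form a copy of \<open>V i \<rho>\<close> based at this common value. Points are
  renumbered by \<open>insert_pos\<close>, variables by \<open>insert_edge\<close>: the variable \<open>a\<close> of \<open>\<sigma>\<close> becomes \<open>a + i\<close>.\<close>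

definition insert_pos :: "nat \<Rightarrow> nat \<Rightarrow> nat \<Rightarrow> nat" where
  "insert_pos a i k = (if k \<le> a then k else k + i)"

definition insert_edge :: "nat \<Rightarrow> nat \<Rightarrow> nat \<Rightarrow> nat" where
  "insert_edge a i k = (if k < a then k else k + i)"

definition insert_at :: "nat \<Rightarrow> nat \<Rightarrow> nat set set \<Rightarrow> nat set set \<Rightarrow> nat set set" where
  "insert_at a i \<rho> \<sigma> = (\<lambda>S. (\<lambda>k. k + a) ` S) ` \<rho> \<union> (\<lambda>S. insert_pos a i ` S) ` \<sigma>"

lemma insert_pos_inj: "inj (insert_pos a i)"
  by (auto simp: inj_def insert_pos_def split: if_splits)

lemma insert_pos_disjoint: "l \<in> {1..i} \<Longrightarrow> insert_pos a i k \<noteq> l + a"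
  by (auto simp: insert_pos_def)

lemma insert_pos_cases:
  assumes "a \<le> m" "k \<in> {1..m + i}"
  obtains l where "l \<in> {1..i}" "k = l + a" | l where "l \<in> {1..m}" "k = insert_pos a i l"
proof -
  consider "k \<le> a" | "a < k" "k \<le> a + i" | "a + i < k" by linarith
  then show thesis
  proof cases
    case 1
    then show ?thesis using assms by (intro that(2)[of k]) (auto simp: insert_pos_def)
  next
    case 2
    then show ?thesis by (intro that(1)[of "k - a"]) auto
  next
    case 3
    then show ?thesis using assms by (intro that(2)[of "k - i"]) (auto simp: insert_pos_def)
  qed
qed

lemma same_block_insert_at:
  assumes \<rho>: "\<rho> \<in> partitions i" and \<sigma>: "\<sigma> \<in> partitions m"
  shows "l \<in> {1..i} \<Longrightarrow> l' \<in> {1..i} \<Longrightarrow>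
      same_block (insert_at a i \<rho> \<sigma>) (l + a) (l' + a) \<longleftrightarrow> same_block \<rho> l l'"
    "same_block (insert_at a i \<rho> \<sigma>) (insert_pos a i k) (insert_pos a i k') \<longleftrightarrow> same_block \<sigma> k k'"
    "l \<in> {1..i} \<Longrightarrow> \<not> same_block (insert_at a i \<rho> \<sigma>) (l + a) (insert_pos a i k)"
    "l \<in> {1..i} \<Longrightarrow> \<not> same_block (insert_at a i \<rho> \<sigma>) (insert_pos a i k) (l + a)"
proof -
  have r: "\<not> insert_pos a i k \<in> (\<lambda>k. k + a) ` S" if "S \<in> \<rho>" for S k
    using partition_block_subset[OF \<rho> that] insert_pos_disjoint[of _ i a k] by fastforce
  have s: "\<not> l + a \<in> insert_pos a i ` S" if "l \<in> {1..i}" for S l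
    using that insert_pos_disjoint[of l i a] by fastforce
  have t: "insert_pos a i k \<in> insert_pos a i ` S \<longleftrightarrow> k \<in> S" for k S
    using insert_pos_inj by (rule inj_image_mem_iff)
  have q: "l + a \<in> (\<lambda>k. k + a) ` S \<longleftrightarrow> l \<in> S" for l S by auto
  have ex: "same_block (insert_at a i \<rho> \<sigma>) p q \<longleftrightarrow>
      (\<exists>S\<in>\<rho>. p \<in> (\<lambda>k. k + a) ` S \<and> q \<in> (\<lambda>k. k + a) ` S) \<or>
      (\<exists>S\<in>\<sigma>. p \<in> insert_pos a i ` S \<and> q \<in> insert_pos a i ` S)" for p q
    unfolding same_block_def insert_at_def by (simp only: bex_Un bex_simps)
  show "same_block (insert_at a i \<rho> \<sigma>) (l + a) (l' + a) \<longleftrightarrow> same_block \<rho> l l'"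
    if "l \<in> {1..i}" "l' \<in> {1..i}"
    unfolding ex q using s[OF that(1)] by (simp add: same_block_def)
  show "same_block (insert_at a i \<rho> \<sigma>) (insert_pos a i k) (insert_pos a i k') \<longleftrightarrow> same_block \<sigma> k k'"
    unfolding ex t using r by (simp add: same_block_def)
  show "\<not> same_block (insert_at a i \<rho> \<sigma>) (l + a) (insert_pos a i k)" if "l \<in> {1..i}"
    unfolding ex using s[OF that] r by simp
  then show "l \<in> {1..i} \<Longrightarrow> \<not> same_block (insert_at a i \<rho> \<sigma>) (insert_pos a i k) (l + a)"
    by (simp add: same_block_sym)
qed

lemma insert_at_partition:
  assumes \<rho>: "\<rho> \<in> partitions i" and \<sigma>: "\<sigma> \<in> partitions m" and a: "a \<le> m"
  shows "insert_at a i \<rho> \<sigma> \<in> partitions (m + i)"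
proof (rule partitionsI)
  fix S assume "S \<in> insert_at a i \<rho> \<sigma>"
  then consider T where "T \<in> \<rho>" "S = (\<lambda>k. k + a) ` T" | T where "T \<in> \<sigma>" "S = insert_pos a i ` T"
    by (auto simp: insert_at_def)
  then show "S \<noteq> {} \<and> S \<subseteq> {1..m + i}"
  proof cases
    case 1
    then show ?thesis using partition_block_subset[OF \<rho> 1(1)] partitions_nonempty[OF \<rho> 1(1)] a by fastforce
  next
    case 2
    have "insert_pos a i k \<in> {1..m + i}" if "k \<in> {1..m}" for k
      using that by (auto simp: insert_pos_def)
    then show ?thesis using partition_block_subset[OF \<sigma> 2(1)] partitions_nonempty[OF \<sigma> 2(1)] 2(2) by blast
  qed
next
  fix k assume "k \<in> {1..m + i}"
  from a this show "\<exists>S\<in>insert_at a i \<rho> \<sigma>. k \<in> S"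
  proof (cases rule: insert_pos_cases)
    case (1 l)
    then obtain T where "T \<in> \<rho>" "l \<in> T" using partition_unique_block[OF \<rho>] by blast
    then show ?thesis using 1 unfolding insert_at_def by blast
  next
    case (2 l)
    then obtain T where "T \<in> \<sigma>" "l \<in> T" using partition_unique_block[OF \<sigma>] by blast
    then show ?thesis using 2 unfolding insert_at_def by blast
  qed
next
  fix S S' k assume S: "S \<in> insert_at a i \<rho> \<sigma>" "S' \<in> insert_at a i \<rho> \<sigma>" "k \<in> S" "k \<in> S'"
  have sub: "T \<subseteq> {1..i}" if "T \<in> \<rho>" for T by (rule partition_block_subset[OF \<rho> that])
  from S(1,2) consider
      T T' where "T \<in> \<rho>" "S = (\<lambda>k. k + a) ` T" "T' \<in> \<rho>" "S' = (\<lambda>k. k + a) ` T'"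
    | T T' where "T \<in> \<rho>" "S = (\<lambda>k. k + a) ` T" "T' \<in> \<sigma>" "S' = insert_pos a i ` T'"
    | T T' where "T \<in> \<sigma>" "S = insert_pos a i ` T" "T' \<in> \<rho>" "S' = (\<lambda>k. k + a) ` T'"
    | T T' where "T \<in> \<sigma>" "S = insert_pos a i ` T" "T' \<in> \<sigma>" "S' = insert_pos a i ` T'"
    unfolding insert_at_def by blast
  then show "S = S'"
  proof cases
    case (1 T T')
    then obtain l where "l \<in> T" "l \<in> T'" using S(3,4) by auto
    then have "T = T'" by (rule partition_block_eq[OF \<rho> 1(1,3)])
    then show ?thesis using 1 by simp
  next
    case (2 T T')
    then obtain l p where "l \<in> T" "k = l + a" "k = insert_pos a i p" using S(3,4) by blast
    then show ?thesis using insert_pos_disjoint[of l i a p] sub[OF 2(1)] by auto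
  next
    case (3 T T')
    then obtain l p where "l \<in> T'" "k = l + a" "k = insert_pos a i p" using S(3,4) by blast
    then show ?thesis using insert_pos_disjoint[of l i a p] sub[OF 3(3)] by auto
  next
    case (4 T T')
    then obtain l where "l \<in> T" "l \<in> T'" using S(3,4) insert_pos_inj[of a i] by (auto dest: injD)
    then have "T = T'" by (rule partition_block_eq[OF \<sigma> 4(1,3)])
    then show ?thesis using 4 by simp
  qed
qed

text \<open>Both renumberings of points are increasing and so preserve the least element of each
  block. Variables follow because
  \<open>insert_pos a i (k + 1) = insert_edge a i k + 1\<close>.\<close>

lemma std_coords_insert_at:
  assumes \<rho>: "\<rho> \<in> partitions i" and \<sigma>: "\<sigma> \<in> partitions m" and a: "1 \<le> a" "a \<le> m"
  shows "std_coords (m + i) (insert_at a i \<rho> \<sigma>) =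
    insert_edge a i ` std_coords m \<sigma> \<union> (\<lambda>k. k + a) ` std_coords i \<rho>" (is "_ = ?R")
proof (intro set_eqI)
  fix j
  let ?P = "insert_at a i \<rho> \<sigma>"
  have sb: "p \<in> {1..i} \<Longrightarrow> p' \<in> {1..i} \<Longrightarrow> same_block ?P (p + a) (p' + a) \<longleftrightarrow> same_block \<rho> p p'"
    "same_block ?P (insert_pos a i q) (insert_pos a i q') \<longleftrightarrow> same_block \<sigma> q q'"
    "p \<in> {1..i} \<Longrightarrow> \<not> same_block ?P (p + a) (insert_pos a i q)"
    "p \<in> {1..i} \<Longrightarrow> \<not> same_block ?P (insert_pos a i q) (p + a)" for p p' q q'
    by (rule same_block_insert_at[OF \<rho> \<sigma>]; assumption)+
  consider "j < a" | "j = a" | "a < j" "j < a + i" | "a + i \<le> j" "a < j" by linarith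
  then show "j \<in> std_coords (m + i) ?P \<longleftrightarrow> j \<in> ?R"
  proof cases
    case 1
    then have "j \<in> ?R \<longleftrightarrow> j \<in> std_coords m \<sigma>"
      by (auto simp: insert_edge_def image_iff)
    also have "\<dots> \<longleftrightarrow> j \<in> std_coords (m + i) ?P"
    proof -
      have "same_block ?P l (j + 1) \<longleftrightarrow> same_block \<sigma> l (j + 1)" if "l \<in> {1..j}" for l
        using sb(2)[where q = l and q' = "j + 1"] that 1 by (simp add: insert_pos_def)
      then show ?thesis using 1 a by (auto simp: std_coords_def)
    qed
    finally show ?thesis ..
  next
    \<comment> \<open>If i > 0, the point a + 1 is the first inserted one and begins its block, so a
      is no coordinate; nor does the right side contain a.\<close>
    case 2
    have "j \<notin> std_coords (m + i) ?P" if i: "0 < i"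
    proof -
      have "\<not> same_block ?P l (j + 1)" if "l \<in> {1..j}" for l
        using sb(4)[where p = 1 and q = l] that 2 i by (simp add: insert_pos_def add.commute)
      then show ?thesis by (auto simp: std_coords_def)
    qed
    moreover have "j \<in> std_coords m ?P \<longleftrightarrow> j \<in> ?R" if "i = 0"
    proof -
      have "same_block ?P l (j + 1) \<longleftrightarrow> same_block \<sigma> l (j + 1)" for l
      proof -
        have "insert_pos a i k = k" for k using that by (simp add: insert_pos_def)
        then show ?thesis using sb(2)[where q = l and q' = "j + 1"] by simp
      qed
      moreover have "std_coords i \<rho> = {}" using that by (auto simp: std_coords_def)
      ultimately show ?thesis using that 2 by (auto simp: std_coords_def insert_edge_def)
    qed
    moreover have "j \<notin> ?R" if "0 < i"
      using that 2 by (auto simp: insert_edge_def std_coords_def)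
    ultimately show ?thesis by (cases "i = 0") auto
  next
    case 3
    then have "j \<in> ?R \<longleftrightarrow> j - a \<in> std_coords i \<rho>"
      by (auto simp: insert_edge_def image_iff intro!: bexI[of _ "j - a"] split: if_splits)
    also have "\<dots> \<longleftrightarrow> j \<in> std_coords (m + i) ?P"
    proof
      assume "j - a \<in> std_coords i \<rho>"
      then obtain l where l: "l \<in> {1..j - a}" "same_block \<rho> l (j - a + 1)"
        by (auto simp: std_coords_def)
      then have "same_block ?P (l + a) (j + 1)"
        using sb(1)[where p = l and p' = "j - a + 1"] 3 by auto
      moreover have "l + a \<in> {1..j}" using l by auto
      ultimately show "j \<in> std_coords (m + i) ?P" using 3 a by (auto simp: std_coords_def)
    next
      assume "j \<in> std_coords (m + i) ?P"
      then obtain l where l: "l \<in> {1..j}" "same_block ?P l (j + 1)"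
        by (auto simp: std_coords_def)
      have j1: "j + 1 = (j - a + 1) + a" "j - a + 1 \<in> {1..i}" using 3 by auto
      have "a < l"
      proof (rule ccontr)
        assume "\<not> a < l"
        then have "insert_pos a i l = l" by (simp add: insert_pos_def)
        then show False using sb(4)[OF j1(2), where q = l] l(2) j1(1) by simp
      qed
      then have l1: "l = (l - a) + a" "l - a \<in> {1..i}" using l(1) 3 by auto
      then have "same_block \<rho> (l - a) (j - a + 1)"
        using sb(1)[OF l1(2) j1(2)] l(2) j1(1) by simp
      moreover have "l - a \<in> {1..j - a}" using l(1) \<open>a < l\<close> by auto
      ultimately show "j - a \<in> std_coords i \<rho>" using 3 by (auto simp: std_coords_def)
    qed
    finally show ?thesis ..
  next
    case 4
    then have "j = insert_edge a i (j - i)" by (auto simp: insert_edge_def)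
    then have "j \<in> insert_edge a i ` std_coords m \<sigma>" if "j - i \<in> std_coords m \<sigma>"
      using that by (rule image_eqI)
    moreover have "k = j - i" if "j = insert_edge a i k" for k
      using that 4 by (auto simp: insert_edge_def split: if_splits)
    then have "j - i \<in> std_coords m \<sigma>" if "j \<in> insert_edge a i ` std_coords m \<sigma>"
      using that by auto
    moreover have "j \<notin> (\<lambda>k. k + a) ` std_coords i \<rho>"
      using 4 std_coords_sub(1)[of i \<rho>] by auto
    ultimately have "j \<in> ?R \<longleftrightarrow> j - i \<in> std_coords m \<sigma>" by blast
    also have "\<dots> \<longleftrightarrow> j \<in> std_coords (m + i) ?P"
    proof
      assume "j - i \<in> std_coords m \<sigma>"
      then obtain l where l: "l \<in> {1..j - i}" "same_block \<sigma> l (j - i + 1)" "j - i < m"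
        by (auto simp: std_coords_def)
      moreover have "j + 1 = insert_pos a i (j - i + 1)" using 4 by (auto simp: insert_pos_def)
      ultimately have "same_block ?P (insert_pos a i l) (j + 1)"
        by (simp only: sb(2))
      moreover have "insert_pos a i l \<in> {1..j}" using l 4 by (auto simp: insert_pos_def)
      ultimately show "j \<in> std_coords (m + i) ?P" using 4 a l by (auto simp: std_coords_def)
    next
      assume "j \<in> std_coords (m + i) ?P"
      then obtain l where l: "l \<in> {1..j}" "same_block ?P l (j + 1)" "j < m + i"
        by (auto simp: std_coords_def)
      have j1: "j + 1 = insert_pos a i (j - i + 1)" using 4 by (auto simp: insert_pos_def)
      have "l \<in> {1..m + i}" using l by auto
      from a(2) this show "j - i \<in> std_coords m \<sigma>"
      proof (cases rule: insert_pos_cases)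
        case (1 p)
        then show ?thesis using sb(3)[OF 1(1)] l(2) j1 by metis
      next
        case (2 p)
        then have "same_block \<sigma> p (j - i + 1)" using sb(2) l(2) j1 by metis
        moreover have "p \<in> {1..j - i}" using 2 l(1) 4 by (auto simp: insert_pos_def split: if_splits)
        ultimately show ?thesis using 4 l(3) a by (auto simp: std_coords_def)
      qed
    qed
    finally show ?thesis ..
  qed
qed

text \<open>The copy of \<rho> occupies the variables from a to a + i - 1. The index
  \<open>a mod m\<close> of its base value covers a = m, where the copy is based at t 0.\<close>

lemma std_point_insert_at:
  assumes \<rho>: "\<rho> \<in> partitions i" and \<sigma>: "\<sigma> \<in> partitions m" and a: "1 \<le> a" "a \<le> m" and i: "0 < i"
  defines "u \<equiv> \<lambda>x s. std_point m \<sigma> x (s \<circ> insert_edge a i)"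
  shows "std_point (m + i) (insert_at a i \<rho> \<sigma>) x s =
    (\<lambda>k. if k < a then u x s k
      else if k < a + i then std_point i \<rho> (u x s (a mod m)) (s \<circ> (\<lambda>k. k + a)) (k - a)
      else u x s (k - i))"
proof -
  let ?P = "insert_at a i \<rho> \<sigma>"
  define v where "v = u x s"
  define w where "w = std_point i \<rho> (v (a mod m)) (s \<circ> (\<lambda>k. k + a))"
  have m: "0 < m" "0 < m + i" using a by auto
  have P: "?P \<in> partitions (m + i)" by (rule insert_at_partition[OF \<rho> \<sigma> a(2)])
  note v = V_point_spec[OF free_coords_std[OF \<sigma> m(1)], where x = x and s = "s \<circ> insert_edge a i",
      folded v_def[unfolded u_def]]
  note w = V_point_spec[OF free_coords_std[OF \<rho> i], where x = "v (a mod m)" and s = "s \<circ> (\<lambda>k. k + a)",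
      folded w_def]
  define t where "t = (\<lambda>k. if k < a then v k else if k < a + i then w (k - a) else v (k - i))"
  have v0: "v k = 0" if "m \<le> k" for k using v(1) that by (simp add: V_def)
  have t_in: "t (l + a - 1) - t ((l + a) mod (m + i)) = w (l - 1) - w (l mod i)" if l: "l \<in> {1..i}" for l
  proof (cases "l = i")
    case True
    have "t ((i + a) mod (m + i)) = v (a mod m)"
    proof (cases "a = m")
      case True
      then show ?thesis using a by (simp add: t_def add.commute)
    next
      case False
      then show ?thesis using a by (simp add: t_def)
    qed
    then show ?thesis using True w(2) i by (auto simp: t_def)
  next
    case False
    then have "(l + a) mod (m + i) = l + a" using l a by auto
    then show ?thesis using False l by (auto simp: t_def)
  qed
  have t_out: "t (insert_pos a i l - 1) - t (insert_pos a i l mod (m + i)) = v (l - 1) - v (l mod m)"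
    if l: "l \<in> {1..m}" for l
  proof -
    \<comment> \<open>Two places need care: at l = a the right entry t a is \<open>w 0\<close>, the
      base value v (a mod m); at l = a + 1 the left entry is t (a + i) = v a.\<close>
    consider "l < a" | "l = a" | "a < l" "l < m" | "a < l" "l = m" using l by fastforce
    then show ?thesis
    proof cases
      case 1
      then show ?thesis using l a by (auto simp: insert_pos_def t_def)
    next
      case 2
      then have "a mod (m + i) = a" using a i by auto
      then show ?thesis using 2 l a i w(2) by (auto simp: insert_pos_def t_def)
    next
      case 3
      then show ?thesis using l a by (auto simp: insert_pos_def t_def)
    next
      case 4
      then show ?thesis using l a by (auto simp: insert_pos_def t_def)
    qed
  qed
  have tV: "t \<in> V (m + i) ?P"
    unfolding V_def
  proof (intro CollectI conjI allI impI ballI)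
    show "t k = 0" if "m + i \<le> k" for k using that v0 a by (auto simp: t_def)
    fix S assume "S \<in> ?P"
    then consider T where "T \<in> \<rho>" "S = (\<lambda>k. k + a) ` T" | T where "T \<in> \<sigma>" "S = insert_pos a i ` T"
      by (auto simp: insert_at_def)
    then show "(\<Sum>k\<in>S. t (k - 1) - t (k mod (m + i))) = 0"
    proof cases
      case 1
      have "(\<Sum>k\<in>S. t (k - 1) - t (k mod (m + i))) = (\<Sum>l\<in>T. w (l - 1) - w (l mod i))"
        unfolding 1(2) using partition_block_subset[OF \<rho> 1(1)]
        by (subst sum.reindex) (auto simp del: One_nat_def intro!: sum.cong t_in)
      then show ?thesis using w(1) 1 by (simp add: V_def)
    next
      case 2
      have "(\<Sum>k\<in>S. t (k - 1) - t (k mod (m + i))) = (\<Sum>l\<in>T. v (l - 1) - v (l mod m))"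
        unfolding 2(2) using partition_block_subset[OF \<sigma> 2(1)] inj_on_subset[OF insert_pos_inj]
        by (subst sum.reindex) (auto simp del: One_nat_def intro!: sum.cong t_out)
      then show ?thesis using v(1) 2 by (simp add: V_def)
    qed
  qed
  have "std_point (m + i) ?P x s = t"
  proof (rule V_point_eqI[OF free_coords_std[OF P m(2)] tV])
    show "t 0 = x" using v(2) a by (simp add: t_def)
    fix j assume "j \<in> std_coords (m + i) ?P"
    then consider l where "l \<in> std_coords m \<sigma>" "j = insert_edge a i l" | l where "l \<in> std_coords i \<rho>" "j = l + a"
      unfolding std_coords_insert_at[OF \<rho> \<sigma> a] by blast
    then show "t j = s j"
    proof cases
      case 1
      then show ?thesis using v(3)[OF 1(1)] by (auto simp: t_def insert_edge_def)
    next
      case 2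
      then show ?thesis using w(3)[OF 2(1)] std_coords_sub(1)[of i \<rho>] by (auto simp: t_def)
    qed
  qed
  then show ?thesis unfolding t_def w_def v_def .
qed

text \<open>The arguments that \<sigma> receives once the variables of \<rho> have been integrated
  out.\<close>

definition insert_fun ::
  "nat \<Rightarrow> nat \<Rightarrow> nat set set \<Rightarrow> (nat \<Rightarrow> real \<Rightarrow> complex) \<Rightarrow> nat \<Rightarrow> real \<Rightarrow> complex" where
  "insert_fun a i \<rho> H = (H \<circ> insert_pos a i)(a := (\<lambda>y. H a y * Lambda_prod i \<rho> (\<lambda>l. H (l + a)) y))"

lemma insert_fun_C01:
  assumes "\<rho> \<in> partitions i" "1 \<le> a" "a \<le> m" "0 < i" "\<forall>k\<in>{1..m + i}. H k \<in> C01"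
  shows "\<forall>k\<in>{1..m}. insert_fun a i \<rho> H k \<in> C01"
  unfolding insert_fun_def using assms
  by (auto simp: insert_pos_def intro!: C01_mult Lambda_prod_C01)

text \<open>With the coordinates of \<sigma> fixed, the inserted factors depend on them only through
  the common base value. The inner integral is therefore a value of
  \<open>Lambda_prod i \<rho>\<close> at the variable that also belongs to the factor in position
  a.\<close>

lemma Lambda_prod_insert_at:
  assumes \<rho>: "\<rho> \<in> partitions i" and \<sigma>: "\<sigma> \<in> partitions m" and a: "1 \<le> a" "a \<le> m" and i: "0 < i"
    and H: "\<forall>k\<in>{1..m + i}. H k \<in> C01"
  shows "Lambda_prod (m + i) (insert_at a i \<rho> \<sigma>) H x = Lambda_prod m \<sigma> (insert_fun a i \<rho> H) x"
proof -
  interpret product_sigma_finite "\<lambda>_::nat. lborel :: real measure" ..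
  let ?P = "insert_at a i \<rho> \<sigma>" and ?h = "insert_edge a i"
  have m: "0 < m" "0 < m + i" using a by auto
  have P: "?P \<in> partitions (m + i)" by (rule insert_at_partition[OF \<rho> \<sigma> a(2)])
  let ?I = "?h ` std_coords m \<sigma>" and ?K = "(\<lambda>k. k + a) ` std_coords i \<rho>"
  have disj: "?I \<inter> ?K = {}"
    using std_coords_sub(1)[of i \<rho>] by (auto simp: insert_edge_def)
  have fin: "finite ?I" "finite ?K" using std_coords_sub by auto
  have injh: "inj ?h" by (auto simp: inj_def insert_edge_def split: if_splits)
  let ?u = "\<lambda>s. std_point m \<sigma> x (s \<circ> ?h)"
  let ?c = "\<lambda>s. \<Prod>k\<in>{1..m} - {a}. H (insert_pos a i k) (?u s (k mod m))"
  let ?e = "\<lambda>y s. \<Prod>l\<in>{1..i}. H (l + a) (std_point i \<rho> y (s \<circ> (\<lambda>k. k + a)) (l mod i))"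
  have eq: "(\<Prod>k\<in>{1..m + i}. H k (std_point (m + i) ?P x s (k mod (m + i)))) =
      ?c s * H a (?u s (a mod m)) * ?e (?u s (a mod m)) s" for s
  proof -
    let ?t = "std_point (m + i) ?P x s"
    note t = std_point_insert_at[OF \<rho> \<sigma> a i, of x s]
    have set: "{1..m + i} = insert_pos a i ` {1..m} \<union> (\<lambda>l. l + a) ` {1..i}"
    proof (intro equalityI subsetI)
      fix k assume "k \<in> {1..m + i}"
      from a(2) this show "k \<in> insert_pos a i ` {1..m} \<union> (\<lambda>l. l + a) ` {1..i}"
        by (cases rule: insert_pos_cases) blast+
    qed (use a in \<open>auto simp: insert_pos_def\<close>)
    have "(\<Prod>k\<in>{1..m + i}. H k (?t (k mod (m + i)))) =
        (\<Prod>k\<in>insert_pos a i ` {1..m}. H k (?t (k mod (m + i)))) *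
        (\<Prod>k\<in>(\<lambda>l. l + a) ` {1..i}. H k (?t (k mod (m + i))))"
      unfolding set using insert_pos_disjoint by (intro prod.union_disjoint) fastforce+
    also have "(\<Prod>k\<in>(\<lambda>l. l + a) ` {1..i}. H k (?t (k mod (m + i)))) = ?e (?u s (a mod m)) s"
    proof (subst prod.reindex)
      show "inj_on (\<lambda>l. l + a) {1..i}" by simp
      show "prod ((\<lambda>k. H k (?t (k mod (m + i)))) \<circ> (\<lambda>l. l + a)) {1..i} = ?e (?u s (a mod m)) s"
      proof (rule prod.cong[OF refl])
        fix l assume l: "l \<in> {1..i}"
        have "?t ((l + a) mod (m + i)) = std_point i \<rho> (?u s (a mod m)) (s \<circ> (\<lambda>k. k + a)) (l mod i)"
        proof (cases "l = i")
          case True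
          have "?t ((i + a) mod (m + i)) = ?u s (a mod m)"
          proof (cases "a = m")
            case True
            then have "?t ((i + a) mod (m + i)) = ?t 0" by (simp add: add.commute)
            also have "\<dots> = ?u s 0" using a by (simp add: t)
            also have "\<dots> = ?u s (a mod m)" using True by simp
            finally show ?thesis .
          next
            case False
            then show ?thesis using a by (simp add: t)
          qed
          then show ?thesis
            using True V_point_spec(2)[OF free_coords_std[OF \<rho> i], where x = "?u s (a mod m)" and s = "s \<circ> (\<lambda>k. k + a)"]
            by simp
        next
          case False
          then have "(l + a) mod (m + i) = l + a" using l a by auto
          then show ?thesis using False l by (auto simp: t)
        qed
        then show "((\<lambda>k. H k (?t (k mod (m + i)))) \<circ> (\<lambda>l. l + a)) l =
            H (l + a) (std_point i \<rho> (?u s (a mod m)) (s \<circ> (\<lambda>k. k + a)) (l mod i))"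
          by (simp only: comp_apply)
      qed
    qed
    also have "(\<Prod>k\<in>insert_pos a i ` {1..m}. H k (?t (k mod (m + i)))) =
        (\<Prod>k\<in>{1..m}. H (insert_pos a i k) (?u s (k mod m)))"
    proof (subst prod.reindex)
      show "inj_on (insert_pos a i) {1..m}" using insert_pos_inj by (rule inj_on_subset) simp
      show "prod ((\<lambda>k. H k (?t (k mod (m + i)))) \<circ> insert_pos a i) {1..m} =
        (\<Prod>k\<in>{1..m}. H (insert_pos a i k) (?u s (k mod m)))"
      proof (rule prod.cong[OF refl])
        fix l assume l: "l \<in> {1..m}"
        consider "l < a" | "l = a" | "a < l" "l < m" | "a < l" "l = m" using l by fastforce
        then have "?t (insert_pos a i l mod (m + i)) = ?u s (l mod m)"
        proof cases
          \<comment> \<open>Position a now reads the variable a, which is entry 0 of the copy of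
            \<rho> and hence its base value; i > 0 keeps a below m + i.\<close>
          case 2
          then have "a mod (m + i) = a" using a i by auto
          then show ?thesis
            using 2 i V_point_spec(2)[OF free_coords_std[OF \<rho> i], where x = "?u s (a mod m)" and s = "s \<circ> (\<lambda>k. k + a)"]
            by (simp add: t insert_pos_def)
        qed (use a in \<open>auto simp: t insert_pos_def\<close>)
        then show "((\<lambda>k. H k (?t (k mod (m + i)))) \<circ> insert_pos a i) l = H (insert_pos a i l) (?u s (l mod m))"
          by simp
      qed
    qed
    also have "\<dots> = H a (?u s (a mod m)) * ?c s"
      using a by (subst prod.remove[of _ a]) (auto simp: insert_pos_def)
    finally show ?thesis by (simp only: mult_ac)
  qed
  have "integrable (\<Pi>\<^sub>M j\<in>std_coords (m + i) ?P. lborel)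
      (\<lambda>s. ?c s * H a (?u s (a mod m)) * ?e (?u s (a mod m)) s)"
    using Lambda_prod_integrable[OF P m(2) H, of x] by (simp only: eq)
  then have "integrable (\<Pi>\<^sub>M j\<in>?I \<union> ?K. lborel)
      (\<lambda>s. ?c s * H a (?u s (a mod m)) * ?e (?u s (a mod m)) s)"
    unfolding std_coords_insert_at[OF \<rho> \<sigma> a] .
  from product_integral_fold[OF disj fin this]
  have "Lambda_prod (m + i) ?P H x = (LINT s|(\<Pi>\<^sub>M j\<in>?I. lborel). (LINT r|(\<Pi>\<^sub>M j\<in>?K. lborel).
      (\<lambda>s. ?c s * H a (?u s (a mod m)) * ?e (?u s (a mod m)) s) (merge ?I ?K (s, r))))"
    unfolding Lambda_prod_def eq by (simp add: std_coords_insert_at[OF \<rho> \<sigma> a])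
  also have "\<dots> = (LINT s|(\<Pi>\<^sub>M j\<in>?I. lborel).
      (\<Prod>k\<in>{1..m}. insert_fun a i \<rho> H k (std_point m \<sigma> x (s \<circ> ?h) (k mod m))))"
  proof (rule Bochner_Integration.integral_cong[OF refl])
    fix s :: "nat \<Rightarrow> real"
    have u: "?u (merge ?I ?K (s, r)) = ?u s" for r
      by (rule V_point_cong) (simp add: merge_def)
    have w: "std_point i \<rho> y (merge ?I ?K (s, r) \<circ> (\<lambda>k. k + a)) = std_point i \<rho> y (r \<circ> (\<lambda>k. k + a))" for y r
    proof (rule V_point_cong)
      fix j assume "j \<in> std_coords i \<rho>"
      then have "j + a \<in> ?K" by blast
      moreover from this have "j + a \<notin> ?I" using disj by blast
      ultimately show "(merge ?I ?K (s, r) \<circ> (\<lambda>k. k + a)) j = (r \<circ> (\<lambda>k. k + a)) j"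
        by (simp add: merge_def)
    qed
    have "(LINT r|(\<Pi>\<^sub>M j\<in>?K. lborel).
        (\<lambda>s. ?c s * H a (?u s (a mod m)) * ?e (?u s (a mod m)) s) (merge ?I ?K (s, r)))
      = ?c s * H a (?u s (a mod m)) * (LINT r|(\<Pi>\<^sub>M j\<in>?K. lborel). ?e (?u s (a mod m)) r)"
      by (simp only: u w integral_mult_right_zero)
    also have "(LINT r|(\<Pi>\<^sub>M j\<in>?K. lborel). ?e (?u s (a mod m)) r) = Lambda_prod i \<rho> (\<lambda>l. H (l + a)) (?u s (a mod m))"
      by (rule Lambda_prod_reindex[OF \<rho> i]) (use H a in auto)
    also have "?c s * H a (?u s (a mod m)) * \<dots> =
        (\<Prod>k\<in>{1..m}. insert_fun a i \<rho> H k (?u s (k mod m)))"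
      using a by (subst (2) prod.remove[of _ a]) (auto simp: insert_fun_def mult_ac intro!: prod.cong)
    finally show "(LINT r|(\<Pi>\<^sub>M j\<in>?K. lborel).
        (\<lambda>s. ?c s * H a (?u s (a mod m)) * ?e (?u s (a mod m)) s) (merge ?I ?K (s, r)))
      = (\<Prod>k\<in>{1..m}. insert_fun a i \<rho> H k (?u s (k mod m)))" .
  qed
  also have "\<dots> = Lambda_prod m \<sigma> (insert_fun a i \<rho> H) x"
    by (rule Lambda_prod_reindex[OF \<sigma> m(1) insert_fun_C01[OF \<rho> a i H]]) (use injh in \<open>auto intro: inj_on_subset\<close>)
  finally show ?thesis .
qed

section \<open>Block-closed intervals\<close>

text \<open>On subsets of [n] this amounts to splitting. The pointwise form passes through
  renumberings without any unions of blocks being named.\<close>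

definition block_closed :: "nat set set \<Rightarrow> nat set \<Rightarrow> bool" where
  "block_closed \<pi> X \<longleftrightarrow> (\<forall>i j. same_block \<pi> i j \<longrightarrow> i \<in> X \<longrightarrow> j \<in> X)"

lemma splits_iff:
  assumes \<pi>: "\<pi> \<in> partitions n" and X: "X \<subseteq> {1..n}"
  shows "splits X \<pi> \<longleftrightarrow> block_closed \<pi> X"
proof
  assume "splits X \<pi>"
  then obtain T where T: "T \<subseteq> \<pi>" "X = \<Union>T" by (auto simp: splits_def)
  show "block_closed \<pi> X"
    unfolding block_closed_def
  proof (intro allI impI)
    fix i j assume ij: "same_block \<pi> i j" "i \<in> X"
    then obtain S where S: "S \<in> T" "i \<in> S" using T by blast
    then have "j \<in> S" using same_block_iff[OF \<pi>, of S i j] ij T by blast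
    then show "j \<in> X" using S T by blast
  qed
next
  assume closed: "block_closed \<pi> X"
  have "X = \<Union>{S \<in> \<pi>. S \<subseteq> X}"
  proof (intro equalityI subsetI)
    fix i assume i: "i \<in> X"
    then obtain S where S: "S \<in> \<pi>" "i \<in> S" using partition_unique_block[OF \<pi>] X by blast
    then have "S \<subseteq> X" using closed i same_block_iff[OF \<pi> S] by (auto simp: block_closed_def)
    then show "i \<in> \<Union>{S \<in> \<pi>. S \<subseteq> X}" using S by blast
  qed blast
  then show "splits X \<pi>" unfolding splits_def by (intro exI[of _ "{S \<in> \<pi>. S \<subseteq> X}"]) blast
qed

text \<open>Intervals are given by their ends l = p + 1 and r = p + q; the bound q < n excludes the
  full interval.\<close>

lemma CO_iff:
  "\<pi> \<in> CO n \<longleftrightarrow> \<pi> \<in> partitions n \<and>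
    (\<forall>l r. 1 \<le> l \<longrightarrow> l \<le> r \<longrightarrow> r \<le> n \<longrightarrow> block_closed \<pi> {l..r} \<longrightarrow> l = 1 \<and> r = n)"
proof (cases "\<pi> \<in> partitions n")
  case \<pi>: True
  have "(\<forall>p q. p < p + q \<and> p + q \<le> n \<and> q < n \<longrightarrow> \<not> splits {p + 1..p + q} \<pi>) \<longleftrightarrow>
    (\<forall>l r. 1 \<le> l \<longrightarrow> l \<le> r \<longrightarrow> r \<le> n \<longrightarrow> block_closed \<pi> {l..r} \<longrightarrow> l = 1 \<and> r = n)"
  proof safe
    fix l r assume *: "\<forall>p q. p < p + q \<and> p + q \<le> n \<and> q < n \<longrightarrow> \<not> splits {p + 1..p + q} \<pi>"
      and lr: "1 \<le> l" "l \<le> r" "r \<le> n" "block_closed \<pi> {l..r}"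
    have "splits {l..r} \<pi>" using splits_iff[OF \<pi>, of "{l..r}"] lr by auto
    moreover have "{l - 1 + 1..l - 1 + (r - l + 1)} = {l..r}" using lr by auto
    moreover have "l - 1 < l - 1 + (r - l + 1)" "l - 1 + (r - l + 1) \<le> n" using lr by auto
    ultimately have "\<not> (r - l + 1 < n)"
      using *[rule_format, of "l - 1" "r - l + 1"] by metis
    then show "l = 1" "r = n" using lr by auto
  next
    fix p q assume *: "\<forall>l r. 1 \<le> l \<longrightarrow> l \<le> r \<longrightarrow> r \<le> n \<longrightarrow> block_closed \<pi> {l..r} \<longrightarrow> l = 1 \<and> r = n"
      and pq: "p < p + q" "p + q \<le> n" "q < n" "splits {p + 1..p + q} \<pi>"
    have "block_closed \<pi> {p + 1..p + q}" using splits_iff[OF \<pi>, of "{p + 1..p + q}"] pq by auto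
    then have "p + 1 = 1 \<and> p + q = n" using *[rule_format, of "p + 1" "p + q"] pq by auto
    then show False using pq by auto
  qed
  then show ?thesis using \<pi> by (simp add: CO_def)
qed (simp add: CO_def)

lemma CO_D:
  assumes "\<pi> \<in> CO n" "1 \<le> l" "l \<le> r" "r \<le> n" "block_closed \<pi> {l..r}"
  shows "l = 1" "r = n"
  using assms unfolding CO_iff by blast+

lemma CO_partitions: "\<pi> \<in> CO n \<Longrightarrow> \<pi> \<in> partitions n"
  by (simp add: CO_def)

lemma finite_partitions: "finite (partitions n)"
proof (rule finite_subset)
  show "partitions n \<subseteq> Pow (Pow {1..n})" using partition_block_subset by auto
qed simp

lemma block_closed_compl:
  assumes "\<pi> \<in> partitions n" "block_closed \<pi> X"
  shows "block_closed \<pi> ({1..n} - X)"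
  using assms same_block_bounds[OF assms(1)] same_block_sym[of \<pi>] unfolding block_closed_def by blast

lemma block_closed_pullback:
  assumes \<pi>: "\<pi> \<in> partitions m" and d: "d ` {1..n} = {1..m}"
    and XY: "\<And>i. i \<in> {1..n} \<Longrightarrow> i \<in> X \<longleftrightarrow> d i \<in> Y"
  shows "block_closed (pullback n d \<pi>) X \<longleftrightarrow> block_closed \<pi> Y"
proof
  assume *: "block_closed (pullback n d \<pi>) X"
  show "block_closed \<pi> Y"
    unfolding block_closed_def
  proof (intro allI impI)
    fix i j assume ij: "same_block \<pi> i j" "i \<in> Y"
    have "i \<in> d ` {1..n}" "j \<in> d ` {1..n}"
      unfolding d using same_block_bounds[OF \<pi> ij(1)] by auto
    then obtain i' j' where "i' \<in> {1..n}" "i = d i'" "j' \<in> {1..n}" "j = d j'" by blast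
    then show "j \<in> Y" using * ij XY by (auto simp: block_closed_def same_block_pullback)
  qed
next
  assume "block_closed \<pi> Y"
  then show "block_closed (pullback n d \<pi>) X"
    using XY unfolding block_closed_def same_block_pullback by blast
qed

lemma pullback_inj:
  assumes d: "d ` {1..n} = {1..m}"
  shows "inj_on (pullback n d) (partitions m)"
proof (rule inj_onI)
  fix \<pi> \<pi>' assume \<pi>: "\<pi> \<in> partitions m" "\<pi>' \<in> partitions m" "pullback n d \<pi> = pullback n d \<pi>'"
  show "\<pi> = \<pi>'"
  proof (rule partition_eqI[OF \<pi>(1,2)])
    fix i j assume "i \<in> {1..m}" "j \<in> {1..m}"
    then obtain i' j' where "i' \<in> {1..n}" "i = d i'" "j' \<in> {1..n}" "j = d j'"
      unfolding d[symmetric] by blast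
    then show "same_block \<pi> i j \<longleftrightarrow> same_block \<pi>' i j"
      using \<pi>(3) same_block_pullback[of n d] by metis
  qed
qed

text \<open>Every block is saturated for d, so the images of blocks are disjoint and the preimages
  of these images give the blocks back.\<close>

lemma pullback_surj:
  assumes \<pi>: "\<pi> \<in> partitions n" and d: "d ` {1..n} = {1..m}"
    and eq: "\<forall>i\<in>{1..n}. \<forall>j\<in>{1..n}. d i = d j \<longrightarrow> same_block \<pi> i j"
  obtains \<pi>' where "\<pi>' \<in> partitions m" "\<pi> = pullback n d \<pi>'"
proof -
  define \<pi>' where "\<pi>' = (\<lambda>S. d ` S) ` \<pi>"
  have mem: "i \<in> S" if "S \<in> \<pi>" "i \<in> {1..n}" "d i \<in> d ` S" for S i
  proof -
    from that(3) obtain j where j: "j \<in> S" "d i = d j" by (rule imageE)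
    then have "j \<in> {1..n}" using partition_block_subset[OF \<pi> that(1)] by blast
    then have "same_block \<pi> j i" using eq j that by simp
    then show ?thesis using same_block_iff[OF \<pi> that(1) j(1)] by simp
  qed
  have "\<pi>' \<in> partitions m"
  proof (rule partitionsI)
    fix S assume "S \<in> \<pi>'"
    then obtain T where T: "T \<in> \<pi>" "S = d ` T" by (auto simp: \<pi>'_def)
    then show "S \<noteq> {} \<and> S \<subseteq> {1..m}"
      using partitions_nonempty[OF \<pi>] partition_block_subset[OF \<pi> T(1)] d by auto
  next
    fix i assume "i \<in> {1..m}"
    then obtain j where "j \<in> {1..n}" "i = d j" unfolding d[symmetric] by blast
    then show "\<exists>S\<in>\<pi>'. i \<in> S" using partition_unique_block[OF \<pi>, of j] unfolding \<pi>'_def by blast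
  next
    fix S S' i assume "S \<in> \<pi>'" "S' \<in> \<pi>'" "i \<in> S" "i \<in> S'"
    then obtain T T' j where T: "T \<in> \<pi>" "S = d ` T" "T' \<in> \<pi>" "S' = d ` T'" "j \<in> T" "i = d j" "d j \<in> d ` T'"
      by (auto simp: \<pi>'_def)
    then have "j \<in> T'" using mem[OF T(3)] partition_block_subset[OF \<pi> T(1)] by blast
    then have "T = T'" using partition_block_eq[OF \<pi> T(1,3,5)] by simp
    then show "S = S'" using T by simp
  qed
  moreover have "\<pi> = pullback n d \<pi>'"
  proof -
    have "d -` (d ` S) \<inter> {1..n} = S" if "S \<in> \<pi>" for S
      using mem[OF that] partition_block_subset[OF \<pi> that] by blast
    then have "pullback n d \<pi>' = (\<lambda>S. S) ` \<pi>"
      unfolding pullback_def \<pi>'_def image_image by (intro image_cong) auto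
    then show ?thesis by simp
  qed
  ultimately show thesis by (rule that)
qed

section \<open>Decomposition of the classes of partitions\<close>

text \<open>The exact class on n - 1 points is \<open>PC\<close>, since the condition that n - 1 and
  n be separated turns into separation of n - 1 and 1, which is condition (c) for the smaller
  partition.\<close>

lemma PC_plus_closed_eq:
  assumes n: "2 \<le> n"
  shows "{\<pi> \<in> PC_plus n. same_block \<pi> 1 n} = pullback n (close_end n) ` PC (n - 1)"
proof -
  note d = close_end_image[OF n]
  have key: "pullback n (close_end n) \<pi> \<in> PC_plus n \<longleftrightarrow> \<pi> \<in> PC (n - 1)" if \<pi>: "\<pi> \<in> partitions (n - 1)" for \<pi>
  proof -
    let ?P = "pullback n (close_end n) \<pi>"
    have P: "?P \<in> partitions n" by (rule pullback_partition[OF \<pi> d])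
    have ends: "same_block ?P 1 n"
      using n same_block_refl[OF \<pi>, of 1] by (auto simp: same_block_pullback close_end_def)
    have "?P \<in> CO n \<longleftrightarrow> \<pi> \<in> CO (n - 1)"
    proof
      assume CO: "?P \<in> CO n"
      show "\<pi> \<in> CO (n - 1)"
        unfolding CO_iff
      proof (intro conjI allI impI \<pi>)
        fix l r assume lr: "1 \<le> l" "l \<le> r" "r \<le> n - 1" "block_closed \<pi> {l..r}"
        have "l = 1 \<and> r = n - 1"
        proof (cases "l = 1")
          case True
          show ?thesis
          proof (rule ccontr)
            assume "\<not> (l = 1 \<and> r = n - 1)"
            then have r: "r < n - 1" using True lr by auto
            \<comment> \<open>An interval that contains 1 pulls back to a set containing n as well,
              which need not be an interval. Its complement pulls back to one.\<close>
            have "block_closed \<pi> ({1..n - 1} - {l..r})"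
              by (rule block_closed_compl[OF \<pi> lr(4)])
            also have "{1..n - 1} - {l..r} = {r + 1..n - 1}" using True by auto
            finally have "block_closed ?P {r + 1..n - 1}"
              by (subst block_closed_pullback[OF \<pi> d]) (use lr in \<open>auto simp: close_end_def\<close>)
            from CO_D[OF CO _ _ _ this] r lr show False by auto
          qed
        next
          case False
          then have "block_closed ?P {l..r}"
            using lr by (subst block_closed_pullback[OF \<pi> d, of _ "{l..r}"]) (auto simp: close_end_def)
          moreover have "r \<le> n" using lr by simp
          ultimately show ?thesis using CO_D(1)[OF CO lr(1,2)] False by blast
        qed
        then show "l = 1" "r = n - 1" by auto
      qed
    next
      assume CO: "\<pi> \<in> CO (n - 1)"
      show "?P \<in> CO n"
        unfolding CO_iff
      proof (intro conjI allI impI P)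
        fix l r assume lr: "1 \<le> l" "l \<le> r" "r \<le> n" "block_closed ?P {l..r}"
        \<comment> \<open>A closed interval contains both ends or neither. In the first case it is
          everything; in the second it is a proper closed interval of \<pi>.\<close>
        have iff: "1 \<in> {l..r} \<longleftrightarrow> n \<in> {l..r}"
          using lr(4) ends same_block_sym unfolding block_closed_def by blast
        show "l = 1" "r = n"
        proof -
          have "1 \<in> {l..r}"
          proof (rule ccontr)
            assume *: "1 \<notin> {l..r}"
            with iff have "n \<notin> {l..r}" by simp
            with * have lr': "1 < l" "r < n" using lr by auto
            from lr(4) have "block_closed \<pi> {l..r}"
              by (subst (asm) block_closed_pullback[OF \<pi> d, of _ "{l..r}"]) (use lr lr' in \<open>auto simp: close_end_def\<close>)
            moreover have "r \<le> n - 1" using lr' by simp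
            ultimately show False using CO_D(1)[OF CO lr(1,2)] lr' by simp
          qed
          with iff have "1 \<in> {l..r}" "n \<in> {l..r}" by auto
          then show "l = 1" "r = n" using lr by auto
        qed
      qed
    qed
    moreover have "(\<forall>k\<in>{1..<n}. \<not> same_block ?P k (k + 1)) \<longleftrightarrow>
        (\<forall>k\<in>{1..<n - 1}. \<not> same_block \<pi> k (k + 1)) \<and> \<not> same_block \<pi> 1 (n - 1)"
    proof -
      have "{1..<n} = insert (n - 1) {1..<n - 1}" using n by auto
      moreover have "same_block ?P (n - 1) (n - 1 + 1) \<longleftrightarrow> same_block \<pi> 1 (n - 1)"
        using n same_block_sym[of \<pi>] by (auto simp: same_block_pullback close_end_def)
      moreover have "same_block ?P k (k + 1) \<longleftrightarrow> same_block \<pi> k (k + 1)" if "k \<in> {1..<n - 1}" for k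
        using that by (auto simp: same_block_pullback close_end_def)
      ultimately show ?thesis by auto
    qed
    ultimately show ?thesis by (simp add: PC_plus_def PC_def)
  qed
  show ?thesis
  proof (intro equalityI subsetI)
    fix \<pi> assume \<pi>: "\<pi> \<in> {\<pi> \<in> PC_plus n. same_block \<pi> 1 n}"
    then have P: "\<pi> \<in> partitions n" by (simp add: PC_plus_def CO_def)
    have sb: "same_block \<pi> i j" if "i \<in> {1..n}" "j \<in> {1..n}" "close_end n i = close_end n j" for i j
    proof -
      have "i = j \<or> (i = 1 \<and> j = n) \<or> (i = n \<and> j = 1)"
        using that(3) unfolding close_end_def by metis
      moreover have "same_block \<pi> 1 n" "same_block \<pi> n 1"
        using \<pi> same_block_sym[of \<pi> 1 n] by blast+
      ultimately show ?thesis using same_block_refl[OF P that(1)] by blast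
    qed
    obtain \<pi>' where \<pi>': "\<pi>' \<in> partitions (n - 1)" "\<pi> = pullback n (close_end n) \<pi>'"
    proof (rule pullback_surj[OF P d])
      show "\<forall>i\<in>{1..n}. \<forall>j\<in>{1..n}. close_end n i = close_end n j \<longrightarrow> same_block \<pi> i j"
        using sb by blast
    qed (rule that)
    then show "\<pi> \<in> pullback n (close_end n) ` PC (n - 1)"
      using key[OF \<pi>'(1)] \<pi> by blast
  next
    fix \<pi> assume "\<pi> \<in> pullback n (close_end n) ` PC (n - 1)"
    then obtain \<pi>' where \<pi>': "\<pi>' \<in> PC (n - 1)" "\<pi> = pullback n (close_end n) \<pi>'" by blast
    then have P: "\<pi>' \<in> partitions (n - 1)" by (simp add: PC_def PC_plus_def CO_def)
    have "same_block \<pi> 1 n"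
      using n same_block_refl[OF P, of 1] \<pi>'(2) by (auto simp: same_block_pullback close_end_def)
    then show "\<pi> \<in> {\<pi> \<in> PC_plus n. same_block \<pi> 1 n}" using key[OF P] \<pi>' by simp
  qed
qed

text \<open>Interpolates between \<open>CO n\<close> (for \<open>j = 1\<close>) and \<open>PC_plus n\<close> (for \<open>j = n\<close>).\<close>

definition CO_upto :: "nat \<Rightarrow> nat \<Rightarrow> nat set set set" where
  "CO_upto j n = {\<pi> \<in> CO n. \<forall>k\<in>{1..<j}. \<not> same_block \<pi> k (k + 1)}"

text \<open>Closed intervals never separate j from j + 1, so they correspond to closed intervals
  after merging. The smaller partition is unconstrained at j: the merged point may again lie with
  its successor, which is the origin of higher powers of the trace.\<close>

lemma CO_upto_merge_eq:
  assumes j: "j \<in> {1..<n}"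
  shows "{\<pi> \<in> CO_upto j n. same_block \<pi> j (j + 1)} = pullback n (merge_succ j) ` CO_upto j (n - 1)"
proof -
  note d = merge_succ_image[OF j]
  have key: "pullback n (merge_succ j) \<pi> \<in> CO_upto j n \<longleftrightarrow> \<pi> \<in> CO_upto j (n - 1)" if \<pi>: "\<pi> \<in> partitions (n - 1)" for \<pi>
  proof -
    let ?P = "pullback n (merge_succ j) \<pi>"
    have P: "?P \<in> partitions n" by (rule pullback_partition[OF \<pi> d])
    have ends: "same_block ?P j (j + 1)"
      using j same_block_refl[OF \<pi>, of j] by (auto simp: same_block_pullback merge_succ_def)
    have "?P \<in> CO n \<longleftrightarrow> \<pi> \<in> CO (n - 1)"
    proof
      assume CO: "?P \<in> CO n"
      show "\<pi> \<in> CO (n - 1)"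
        unfolding CO_iff
      proof (intro conjI allI impI \<pi>)
        fix l r assume lr: "1 \<le> l" "l \<le> r" "r \<le> n - 1" "block_closed \<pi> {l..r}"
        \<comment> \<open>The ends of the preimage of \<open>{l..r}\<close>, chosen so that j and j
          + 1 are both in or both out.\<close>
        define l' where "l' = (if l \<le> j then l else l + 1)"
        define r' where "r' = (if r < j then r else r + 1)"
        have "block_closed ?P {l'..r'}"
          using lr by (subst block_closed_pullback[OF \<pi> d, of _ "{l..r}"]) (auto simp: merge_succ_def l'_def r'_def)
        moreover have "1 \<le> l'" "l' \<le> r'" "r' \<le> n" using lr j by (auto simp: l'_def r'_def)
        ultimately have "l' = 1" "r' = n" using CO_D[OF CO] by blast+
        then show "l = 1" "r = n - 1"
          using lr j by (auto simp: l'_def r'_def split: if_splits)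
      qed
    next
      assume CO: "\<pi> \<in> CO (n - 1)"
      show "?P \<in> CO n"
        unfolding CO_iff
      proof (intro conjI allI impI P)
        fix l r assume lr: "1 \<le> l" "l \<le> r" "r \<le> n" "block_closed ?P {l..r}"
        have iff: "j \<in> {l..r} \<longleftrightarrow> j + 1 \<in> {l..r}"
          using lr(4) ends same_block_sym unfolding block_closed_def by blast
        have "block_closed \<pi> {merge_succ j l..merge_succ j r}"
          using lr(4)
        proof (subst (asm) block_closed_pullback[OF \<pi> d])
          fix i assume "i \<in> {1..n}"
          show "i \<in> {l..r} \<longleftrightarrow> merge_succ j i \<in> {merge_succ j l..merge_succ j r}"
            using iff lr by (auto simp: merge_succ_def)
        qed
        moreover have "1 \<le> merge_succ j l" "merge_succ j l \<le> merge_succ j r" "merge_succ j r \<le> n - 1"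
          using lr j by (auto simp: merge_succ_def)
        ultimately have "merge_succ j l = 1" "merge_succ j r = n - 1" using CO_D[OF CO] by blast+
        then show "l = 1" "r = n"
          using lr j iff by (auto simp: merge_succ_def split: if_splits)
      qed
    qed
    moreover have "same_block ?P k (k + 1) \<longleftrightarrow> same_block \<pi> k (k + 1)" if "k \<in> {1..<j}" for k
      using that j by (auto simp: same_block_pullback merge_succ_def)
    ultimately show ?thesis by (simp add: CO_upto_def)
  qed
  show ?thesis
  proof (intro equalityI subsetI)
    fix \<pi> assume \<pi>: "\<pi> \<in> {\<pi> \<in> CO_upto j n. same_block \<pi> j (j + 1)}"
    then have P: "\<pi> \<in> partitions n" by (simp add: CO_upto_def CO_def)
    have sb: "same_block \<pi> i k" if "i \<in> {1..n}" "k \<in> {1..n}" "merge_succ j i = merge_succ j k" for i k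
    proof -
      have "i = k \<or> (i = j \<and> k = j + 1) \<or> (i = j + 1 \<and> k = j)"
        using that by (auto simp: merge_succ_def split: if_splits)
      moreover have "same_block \<pi> j (j + 1)" "same_block \<pi> (j + 1) j"
        using \<pi> same_block_sym[of \<pi> j "j + 1"] by blast+
      ultimately show ?thesis using same_block_refl[OF P that(1)] by blast
    qed
    obtain \<pi>' where \<pi>': "\<pi>' \<in> partitions (n - 1)" "\<pi> = pullback n (merge_succ j) \<pi>'"
    proof (rule pullback_surj[OF P d])
      show "\<forall>i\<in>{1..n}. \<forall>k\<in>{1..n}. merge_succ j i = merge_succ j k \<longrightarrow> same_block \<pi> i k"
        using sb by blast
    qed (rule that)
    then show "\<pi> \<in> pullback n (merge_succ j) ` CO_upto j (n - 1)"
      using key[OF \<pi>'(1)] \<pi> by blast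
  next
    fix \<pi> assume "\<pi> \<in> pullback n (merge_succ j) ` CO_upto j (n - 1)"
    then obtain \<pi>' where \<pi>': "\<pi>' \<in> CO_upto j (n - 1)" "\<pi> = pullback n (merge_succ j) \<pi>'" by blast
    then have P: "\<pi>' \<in> partitions (n - 1)" by (simp add: CO_upto_def CO_def)
    have "same_block \<pi> j (j + 1)"
      using j same_block_refl[OF P, of j] \<pi>'(2) by (auto simp: same_block_pullback merge_succ_def)
    then show "\<pi> \<in> {\<pi> \<in> CO_upto j n. same_block \<pi> j (j + 1)}" using key[OF P] \<pi>' by simp
  qed
qed

text \<open>Interpolates between all partitions (for \<open>j = 1\<close>) and \<open>CO n\<close> (for \<open>j = n\<close>).\<close>

definition unsplit_upto :: "nat \<Rightarrow> nat \<Rightarrow> nat set set set" where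
  "unsplit_upto j n = {\<pi> \<in> partitions n.
     \<forall>p r. 1 \<le> p \<longrightarrow> p < j \<longrightarrow> p < r \<longrightarrow> r \<le> n \<longrightarrow> \<not> block_closed \<pi> {p + 1..r}}"

lemma unsplit_upto_1: "unsplit_upto 1 n = partitions n"
  by (auto simp: unsplit_upto_def)

text \<open>No interval beginning at 1 is mentioned in \<open>unsplit_upto\<close>; a proper one is
  excluded through its complement, an interval that begins later.\<close>

lemma unsplit_upto_CO:
  assumes "n \<le> j"
  shows "unsplit_upto j n = CO n"
proof (intro equalityI subsetI)
  fix \<pi> assume "\<pi> \<in> unsplit_upto j n"
  then have \<pi>: "\<pi> \<in> partitions n"
    and un: "\<And>p r. 1 \<le> p \<Longrightarrow> p < r \<Longrightarrow> r \<le> n \<Longrightarrow> \<not> block_closed \<pi> {p + 1..r}"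
    using assms by (auto simp: unsplit_upto_def)
  show "\<pi> \<in> CO n"
    unfolding CO_iff
  proof (intro conjI allI impI \<pi>)
    fix l r assume lr: "1 \<le> l" "l \<le> r" "r \<le> n" "block_closed \<pi> {l..r}"
    have l: "l = 1"
    proof (rule ccontr)
      assume "l \<noteq> 1"
      then have "1 \<le> l - 1" "l - 1 < r" "l - 1 + 1 = l" using lr by auto
      from un[OF this(1,2) lr(3)] this(3) lr(4) show False by simp
    qed
    have "block_closed \<pi> ({1..n} - {l..r})" by (rule block_closed_compl[OF \<pi> lr(4)])
    also have "{1..n} - {l..r} = {r + 1..n}" using l by auto
    finally have "r = n" using un[of r n] lr by (cases "r = n") auto
    with l show "l = 1" "r = n" by auto
  qed
next
  fix \<pi> assume CO: "\<pi> \<in> CO n"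
  have "\<not> block_closed \<pi> {p + 1..r}" if "1 \<le> p" "p < r" "r \<le> n" for p r
    using CO_D(1)[OF CO, of "p + 1" r] that by auto
  then show "\<pi> \<in> unsplit_upto j n" using CO_partitions[OF CO] by (auto simp: unsplit_upto_def)
qed

lemma block_closed_insert_at:
  assumes \<rho>: "\<rho> \<in> partitions i" and \<sigma>: "\<sigma> \<in> partitions m" and a: "a \<le> m"
  shows "block_closed (insert_at a i \<rho> \<sigma>) Y \<longleftrightarrow>
    block_closed \<rho> {k. k + a \<in> Y} \<and> block_closed \<sigma> {k. insert_pos a i k \<in> Y}"
proof
  assume *: "block_closed (insert_at a i \<rho> \<sigma>) Y"
  show "block_closed \<rho> {k. k + a \<in> Y} \<and> block_closed \<sigma> {k. insert_pos a i k \<in> Y}"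
    unfolding block_closed_def
  proof (intro conjI allI impI CollectI)
    fix k l assume "same_block \<rho> k l" "k \<in> {k. k + a \<in> Y}"
    then show "l + a \<in> Y"
      using * same_block_insert_at(1)[OF \<rho> \<sigma>] same_block_bounds[OF \<rho>] unfolding block_closed_def by blast
  next
    fix k l assume "same_block \<sigma> k l" "k \<in> {k. insert_pos a i k \<in> Y}"
    then show "insert_pos a i l \<in> Y"
      using * same_block_insert_at(2)[OF \<rho> \<sigma>] unfolding block_closed_def by blast
  qed
next
  assume *: "block_closed \<rho> {k. k + a \<in> Y} \<and> block_closed \<sigma> {k. insert_pos a i k \<in> Y}"
  show "block_closed (insert_at a i \<rho> \<sigma>) Y"
    unfolding block_closed_def
  proof (intro allI impI)
    fix k l assume kl: "same_block (insert_at a i \<rho> \<sigma>) k l" "k \<in> Y"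
    note b = same_block_bounds[OF insert_at_partition[OF \<rho> \<sigma> a] kl(1)]
    note sb = same_block_insert_at[OF \<rho> \<sigma>]
    from a b(1) show "l \<in> Y"
    proof (cases rule: insert_pos_cases)
      case k: (1 k')
      from a b(2) show ?thesis
      proof (cases rule: insert_pos_cases)
        case l: (1 l')
        then have "same_block \<rho> k' l'" using sb(1)[OF k(1) l(1)] kl k(2) by simp
        then show ?thesis using * kl(2) k l by (auto simp: block_closed_def)
      next
        case l: (2 l')
        then show ?thesis using sb(3)[OF k(1)] kl k(2) by simp
      qed
    next
      case k: (2 k')
      from a b(2) show ?thesis
      proof (cases rule: insert_pos_cases)
        case l: (1 l')
        then show ?thesis using sb(4)[OF l(1)] kl k(2) by simp
      next
        case l: (2 l')
        then have "same_block \<sigma> k' l'" using sb(2) kl k(2) by simp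
        then show ?thesis using * kl(2) k l by (auto simp: block_closed_def)
      qed
    qed
  qed
qed

lemma image_image_inverse: "(\<And>x. x \<in> A \<Longrightarrow> f (g x) = x) \<Longrightarrow> f ` g ` A = A"
  by force

text \<open>A block that meets the closed interval lies inside it. The blocks inside become \<rho>
  and the blocks outside \<sigma> after renumbering.\<close>

lemma insert_at_surj:
  assumes \<pi>: "\<pi> \<in> partitions (m + i)" and a: "a \<le> m" and closed: "block_closed \<pi> {a + 1..a + i}"
  obtains \<rho> \<sigma> where "\<rho> \<in> partitions i" "\<sigma> \<in> partitions m" "\<pi> = insert_at a i \<rho> \<sigma>"
proof -
  let ?I = "{a + 1..a + i}"
  define \<rho> where "\<rho> = (\<lambda>S. (\<lambda>k. k + a) -` S) ` {S \<in> \<pi>. S \<subseteq> ?I}"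
  define \<sigma> where "\<sigma> = (\<lambda>S. insert_pos a i -` S) ` {S \<in> \<pi>. S \<inter> ?I = {}}"
  have dich: "S \<subseteq> ?I \<or> S \<inter> ?I = {}" if "S \<in> \<pi>" for S
    using closed that unfolding block_closed_def same_block_def by blast
  have im1: "(\<lambda>k. k + a) ` ((\<lambda>k. k + a) -` S) = S" if "S \<subseteq> ?I" for S
  proof -
    have "k \<in> range (\<lambda>k. k + a)" if "k \<in> ?I" for k
      using that by (intro range_eqI[of _ _ "k - a"]) auto
    then show ?thesis using that by blast
  qed
  have im2: "insert_pos a i ` (insert_pos a i -` S) = S" if "S \<in> \<pi>" "S \<inter> ?I = {}" for S
  proof -
    have "k \<in> range (insert_pos a i)" if "k \<notin> ?I" for k
      using that by (intro range_eqI[of _ _ "if k \<le> a then k else k - i"]) (auto simp: insert_pos_def)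
    then show ?thesis using that(2) by blast
  qed
  have sub: "S \<subseteq> {1..m + i}" if "S \<in> \<pi>" for S by (rule partition_block_subset[OF \<pi> that])
  have ne: "S \<noteq> {}" if "S \<in> \<pi>" for S by (rule partitions_nonempty[OF \<pi> that])
  have "\<rho> \<in> partitions i"
  proof (rule partitionsI)
    fix S assume "S \<in> \<rho>"
    then obtain T where T: "T \<in> \<pi>" "T \<subseteq> ?I" "S = (\<lambda>k. k + a) -` T" by (auto simp: \<rho>_def)
    show "S \<noteq> {} \<and> S \<subseteq> {1..i}"
    proof
      show "S \<noteq> {}" using im1[OF T(2)] ne[OF T(1)] T(3) by blast
      show "S \<subseteq> {1..i}" using T by fastforce
    qed
  next
    fix k assume k: "k \<in> {1..i}"
    then have "k + a \<in> {1..m + i}" using a by auto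
    then obtain S where S: "S \<in> \<pi>" "k + a \<in> S" using partition_unique_block[OF \<pi>] by blast
    then have "S \<subseteq> ?I" using dich[OF S(1)] k by auto
    then show "\<exists>S\<in>\<rho>. k \<in> S" using S by (auto simp: \<rho>_def)
  next
    fix S S' k assume "S \<in> \<rho>" "S' \<in> \<rho>" "k \<in> S" "k \<in> S'"
    then obtain T T' where T: "T \<in> \<pi>" "S = (\<lambda>k. k + a) -` T" "T' \<in> \<pi>" "S' = (\<lambda>k. k + a) -` T'"
      "k + a \<in> T" "k + a \<in> T'" by (auto simp: \<rho>_def)
    then show "S = S'" using partition_block_eq[OF \<pi> T(1,3,5,6)] by simp
  qed
  moreover have "\<sigma> \<in> partitions m"
  proof (rule partitionsI)
    fix S assume "S \<in> \<sigma>"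
    then obtain T where T: "T \<in> \<pi>" "T \<inter> ?I = {}" "S = insert_pos a i -` T" by (auto simp: \<sigma>_def)
    show "S \<noteq> {} \<and> S \<subseteq> {1..m}"
    proof
      show "S \<noteq> {}" using im2[OF T(1,2)] ne[OF T(1)] T(3) by blast
      show "S \<subseteq> {1..m}"
      proof
        fix k assume "k \<in> S"
        then have "insert_pos a i k \<in> {1..m + i}" using T sub by blast
        then show "k \<in> {1..m}" using a by (auto simp: insert_pos_def split: if_splits)
      qed
    qed
  next
    fix k assume k: "k \<in> {1..m}"
    then have "insert_pos a i k \<in> {1..m + i}" by (auto simp: insert_pos_def)
    then obtain S where S: "S \<in> \<pi>" "insert_pos a i k \<in> S" using partition_unique_block[OF \<pi>] by blast
    moreover have "insert_pos a i k \<notin> ?I" by (auto simp: insert_pos_def)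
    ultimately have "S \<inter> ?I = {}" using dich[OF S(1)] by blast
    then show "\<exists>S\<in>\<sigma>. k \<in> S" using S by (auto simp: \<sigma>_def)
  next
    fix S S' k assume "S \<in> \<sigma>" "S' \<in> \<sigma>" "k \<in> S" "k \<in> S'"
    then obtain T T' where T: "T \<in> \<pi>" "S = insert_pos a i -` T" "T' \<in> \<pi>" "S' = insert_pos a i -` T'"
      "insert_pos a i k \<in> T" "insert_pos a i k \<in> T'" by (auto simp: \<sigma>_def)
    then show "S = S'" using partition_block_eq[OF \<pi> T(1,3,5,6)] by simp
  qed
  moreover have "\<pi> = insert_at a i \<rho> \<sigma>"
  proof -
    have "(\<lambda>S. (\<lambda>k. k + a) ` S) ` \<rho> = {S \<in> \<pi>. S \<subseteq> ?I}"
      unfolding \<rho>_def by (rule image_image_inverse) (use im1 in simp)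
    moreover have "(\<lambda>S. insert_pos a i ` S) ` \<sigma> = {S \<in> \<pi>. S \<inter> ?I = {}}"
      unfolding \<sigma>_def by (rule image_image_inverse) (use im2 in simp)
    ultimately have "insert_at a i \<rho> \<sigma> = {S \<in> \<pi>. S \<subseteq> ?I} \<union> {S \<in> \<pi>. S \<inter> ?I = {}}"
      unfolding insert_at_def by (simp only:)
    also have "\<dots> = \<pi>" using dich by blast
    finally show ?thesis ..
  qed
  ultimately show thesis by (rule that)
qed

lemma insert_at_unsplit:
  assumes \<rho>: "\<rho> \<in> partitions i" and \<sigma>: "\<sigma> \<in> unsplit_upto (j + 1) m" and j: "1 \<le> j" "j \<le> m"
  shows "insert_at j i \<rho> \<sigma> \<in> unsplit_upto j (m + i)"
proof -
  have \<sigma>': "\<sigma> \<in> partitions m" using \<sigma> by (simp add: unsplit_upto_def)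
  have "\<not> block_closed (insert_at j i \<rho> \<sigma>) {p + 1..r}" if p: "1 \<le> p" "p < j" "p < r" "r \<le> m + i" for p r
  proof
    assume "block_closed (insert_at j i \<rho> \<sigma>) {p + 1..r}"
    then have *: "block_closed \<sigma> {k. insert_pos j i k \<in> {p + 1..r}}"
      using block_closed_insert_at[OF \<rho> \<sigma>' j(2)] by blast
    \<comment> \<open>The right end after the inserted points have been deleted. Since p < j, the
      point p + 1 survives and the interval stays nonempty.\<close>
    define q where "q = (if r \<le> j then r else if r \<le> j + i then j else r - i)"
    have "{k. insert_pos j i k \<in> {p + 1..r}} = {p + 1..q}"
      using p by (auto simp: insert_pos_def q_def split: if_splits)
    moreover have "p < q" "q \<le> m" using p j by (auto simp: q_def)
    ultimately show False using * \<sigma> p by (auto simp: unsplit_upto_def)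
  qed
  then show ?thesis using insert_at_partition[OF \<rho> \<sigma>' j(2)] by (simp add: unsplit_upto_def)
qed

text \<open>The partition \<open>\<rho>\<close> is recovered from the longest block-closed interval that starts at \<open>j + 1\<close>.\<close>

lemma bij_betw_insert_at:
  assumes j: "1 \<le> j"
  shows "bij_betw (\<lambda>(i, \<rho>, \<sigma>). insert_at j i \<rho> \<sigma>)
    (SIGMA i:{..l}. partitions i \<times> unsplit_upto (j + 1) (j + l - i)) (unsplit_upto j (j + l))"
  unfolding bij_betw_def
proof
  let ?f = "\<lambda>(i, \<rho>, \<sigma>). insert_at j i \<rho> \<sigma>"
  let ?A = "SIGMA i:{..l}. partitions i \<times> unsplit_upto (j + 1) (j + l - i)"
  \<comment> \<open>The longer closed interval, of length i', loses its first i points when \<rho>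
    is removed and becomes a nonempty closed interval of \<sigma> beginning at j + 1, which
    \<open>unsplit_upto (j + 1)\<close> forbids.\<close>
  have le: False if eq: "insert_at j i \<rho> \<sigma> = insert_at j i' \<rho>' \<sigma>'" and "i < i'" "i' \<le> l"
    and \<rho>: "\<rho> \<in> partitions i" "\<rho>' \<in> partitions i'" and \<sigma>: "\<sigma> \<in> unsplit_upto (j + 1) (j + l - i)"
      "\<sigma>' \<in> unsplit_upto (j + 1) (j + l - i')" for i i' \<rho> \<rho>' \<sigma> \<sigma>'
  proof -
    have \<sigma>P: "\<sigma> \<in> partitions (j + l - i)" "\<sigma>' \<in> partitions (j + l - i')"
      using \<sigma> by (auto simp: unsplit_upto_def)
    have "block_closed (insert_at j i' \<rho>' \<sigma>') {j + 1..j + i'}"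
    proof (subst block_closed_insert_at[OF \<rho>(2) \<sigma>P(2)])
      show "j \<le> j + l - i'" using that by simp
      have "{k. insert_pos j i' k \<in> {j + 1..j + i'}} = {}" by (auto simp: insert_pos_def)
      moreover have "{k. k + j \<in> {j + 1..j + i'}} = {1..i'}" by auto
      ultimately show "block_closed \<rho>' {k. k + j \<in> {j + 1..j + i'}} \<and>
          block_closed \<sigma>' {k. insert_pos j i' k \<in> {j + 1..j + i'}}"
        using same_block_bounds[OF \<rho>(2)] by (auto simp: block_closed_def)
    qed
    then have "block_closed \<sigma> {k. insert_pos j i k \<in> {j + 1..j + i'}}"
      using block_closed_insert_at[OF \<rho>(1) \<sigma>P(1), of j] eq that by auto
    moreover have "{k. insert_pos j i k \<in> {j + 1..j + i'}} = {j + 1..j + (i' - i)}"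
      using \<open>i < i'\<close> by (auto simp: insert_pos_def split: if_splits)
    ultimately show False using \<sigma>(1) j that by (auto simp: unsplit_upto_def)
  qed
  show "inj_on ?f ?A"
  proof (rule inj_onI)
    fix x x' assume x: "x \<in> ?A" "x' \<in> ?A" "?f x = ?f x'"
    obtain i \<rho> \<sigma> i' \<rho>' \<sigma>' where xeq: "x = (i, \<rho>, \<sigma>)" "x' = (i', \<rho>', \<sigma>')"
      by (cases x, cases x') blast
    have i: "i \<le> l" "i' \<le> l" and \<rho>: "\<rho> \<in> partitions i" "\<rho>' \<in> partitions i'"
      and \<sigma>: "\<sigma> \<in> unsplit_upto (j + 1) (j + l - i)" "\<sigma>' \<in> unsplit_upto (j + 1) (j + l - i')"
      and eq: "insert_at j i \<rho> \<sigma> = insert_at j i' \<rho>' \<sigma>'"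
      using x unfolding xeq by auto
    have ii: "i = i'"
      using le[OF eq _ _ \<rho> \<sigma>] le[OF eq[symmetric] _ _ \<rho>(2,1) \<sigma>(2,1)] i by (meson linorder_neqE_nat)
    have \<sigma>P: "\<sigma> \<in> partitions (j + l - i)" "\<sigma>' \<in> partitions (j + l - i)"
      using \<sigma> ii by (auto simp: unsplit_upto_def)
    have "\<rho> = \<rho>'"
    proof (rule partition_eqI[OF \<rho>(1)])
      show "\<rho>' \<in> partitions i" using \<rho>(2) ii by simp
      then show "same_block \<rho> k k' \<longleftrightarrow> same_block \<rho>' k k'" if "k \<in> {1..i}" "k' \<in> {1..i}" for k k'
        using same_block_insert_at(1)[OF \<rho>(1) \<sigma>P(1) that, of j] same_block_insert_at(1)[OF _ \<sigma>P(2) that, of \<rho>' j]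
          eq ii by simp
    qed
    moreover have "\<sigma> = \<sigma>'"
    proof (rule partition_eqI[OF \<sigma>P])
      show "same_block \<sigma> k k' \<longleftrightarrow> same_block \<sigma>' k k'" for k k'
        using same_block_insert_at(2)[OF \<rho>(1) \<sigma>P(1), of j k k'] same_block_insert_at(2)[OF _ \<sigma>P(2), of \<rho>' i j k k']
          \<rho>(2) eq ii by simp
    qed
    ultimately show "x = x'" using ii xeq by simp
  qed
  show "?f ` ?A = unsplit_upto j (j + l)"
  proof (intro equalityI subsetI)
    fix \<pi> assume "\<pi> \<in> ?f ` ?A"
    then obtain i \<rho> \<sigma> where i: "i \<le> l" and \<rho>: "\<rho> \<in> partitions i" and \<sigma>: "\<sigma> \<in> unsplit_upto (j + 1) (j + l - i)"
      and \<pi>: "\<pi> = insert_at j i \<rho> \<sigma>" by auto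
    have "j \<le> j + l - i" "j + l - i + i = j + l" using i by auto
    then show "\<pi> \<in> unsplit_upto j (j + l)" using insert_at_unsplit[OF \<rho> \<sigma> j] \<pi> by simp
  next
    fix \<pi> assume \<pi>: "\<pi> \<in> unsplit_upto j (j + l)"
    then have P: "\<pi> \<in> partitions (j + l)" by (simp add: unsplit_upto_def)
    \<comment> \<open>The empty interval, i = 0, is closed, so the maximum is taken over a nonempty
      set.\<close>
    define i where "i = Max {i. i \<le> l \<and> block_closed \<pi> {j + 1..j + i}}"
    have fin: "finite {i. i \<le> l \<and> block_closed \<pi> {j + 1..j + i}}" by simp
    have "0 \<in> {i. i \<le> l \<and> block_closed \<pi> {j + 1..j + i}}" by (simp add: block_closed_def)
    then have "i \<in> {i. i \<le> l \<and> block_closed \<pi> {j + 1..j + i}}"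
      unfolding i_def using fin by (intro Max_in) auto
    then have i: "i \<le> l" "block_closed \<pi> {j + 1..j + i}" by auto
    have max: "i' \<le> i" if "i' \<le> l" "block_closed \<pi> {j + 1..j + i'}" for i'
      unfolding i_def using that fin by (intro Max_ge) auto
    define m where "m = j + l - i"
    have m: "j + l = m + i" "j \<le> m" using i by (auto simp: m_def)
    obtain \<rho> \<sigma> where \<rho>: "\<rho> \<in> partitions i" and \<sigma>: "\<sigma> \<in> partitions m" and eq: "\<pi> = insert_at j i \<rho> \<sigma>"
      using insert_at_surj[of \<pi> m i j] P m i(2) by metis
    have "\<not> block_closed \<sigma> {p + 1..r}" if p: "1 \<le> p" "p < j + 1" "p < r" "r \<le> m" for p r
    proof
      assume c: "block_closed \<sigma> {p + 1..r}"
      \<comment> \<open>A closed interval of \<sigma> lifts to \<pi> together with all the inserted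
        points or with none of them.\<close>
      have lift: "block_closed \<pi> Y" if "{k. insert_pos j i k \<in> Y} = {p + 1..r}" "Y \<inter> {j + 1..j + i} = {} \<or> {j + 1..j + i} \<subseteq> Y" for Y
        unfolding eq block_closed_insert_at[OF \<rho> \<sigma> m(2)] that(1)
      proof (intro conjI c)
        show "block_closed \<rho> {k. k + j \<in> Y}"
          unfolding block_closed_def
        proof (intro allI impI CollectI)
          fix k k' assume k: "same_block \<rho> k k'" "k \<in> {k. k + j \<in> Y}"
          from same_block_bounds[OF \<rho> k(1)] have "k + j \<in> {j + 1..j + i}" "k' + j \<in> {j + 1..j + i}" by auto
          then show "k' + j \<in> Y" using that(2) k(2) by blast
        qed
      qed
      show False
      proof (cases "r \<le> j")
        case True
        have "block_closed \<pi> {p + 1..r}"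
          by (rule lift) (use True p in \<open>auto simp: insert_pos_def split: if_splits\<close>)
        then show False using \<pi> p True by (auto simp: unsplit_upto_def)
      next
        case False
        have cl: "block_closed \<pi> {p + 1..r + i}"
          by (rule lift) (use False p in \<open>auto simp: insert_pos_def split: if_splits\<close>)
        show False
        \<comment> \<open>For p = j the lifted interval extends the inserted one, against
          maximality; for p < j it contradicts the choice of \<pi>.\<close>
        proof (cases "p = j")
          case True
          then have "block_closed \<pi> {j + 1..j + (r + i - j)}" using cl False by simp
          moreover have "r + i - j \<le> l" using False m p by linarith
          ultimately have "r + i - j \<le> i" using max by blast
          then show False using \<open>\<not> r \<le> j\<close> by linarith
        next
          case False
          then show False using cl \<pi> p m by (auto simp: unsplit_upto_def)
        qed
      qed
    qed
    then have "\<sigma> \<in> unsplit_upto (j + 1) m" using \<sigma> by (simp add: unsplit_upto_def)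
    then have "(i, \<rho>, \<sigma>) \<in> ?A" using i \<rho> by (simp add: m_def)
    then show "\<pi> \<in> ?f ` ?A" using eq by (intro image_eqI[of _ _ "(i, \<rho>, \<sigma>)"]) simp_all
  qed
qed

section \<open>Sums over partitions\<close>

lemma Lambda_prod_cong:
  assumes "\<And>k. k \<in> {1..n} \<Longrightarrow> H k = H' k"
  shows "Lambda_prod n \<pi> H x = Lambda_prod n \<pi> H' x"
  unfolding Lambda_prod_def
  by (rule Bochner_Integration.integral_cong[OF refl], rule prod.cong[OF refl]) (simp only: assms)

lemma C01_zero: "(\<lambda>x. 0) \<in> C01"
  by (simp add: C01_def)

lemma C01_const01: "const01 c \<in> C01"
proof -
  have "continuous_on {0..1} (const01 c) \<longleftrightarrow> continuous_on {0..1} (\<lambda>x::real. c)"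
    by (rule continuous_on_cong) (auto simp: const01_def)
  then show ?thesis by (simp add: C01_def const01_def)
qed

lemma C01_comb: "f \<in> C01 \<Longrightarrow> g \<in> C01 \<Longrightarrow> (\<lambda>x. a * f x + b * g x) \<in> C01"
  by (auto simp: C01_def intro!: continuous_intros)

lemma C01_scale: "f \<in> C01 \<Longrightarrow> (\<lambda>x. a * f x) \<in> C01"
  using C01_comb[of f f a 0] by simp

lemma C01_sum: "(\<And>i. i \<in> I \<Longrightarrow> f i \<in> C01) \<Longrightarrow> (\<lambda>x. \<Sum>i\<in>I. f i x) \<in> C01"
  by (auto simp: C01_def intro!: continuous_intros)

lemma C01_integrable: "f \<in> C01 \<Longrightarrow> integrable lborel f"
proof -
  assume f: "f \<in> C01"
  then have "integrable lborel (\<lambda>x. indicator {0..1} x *\<^sub>R f x)"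
    by (intro borel_integrable_compact) (auto simp: C01_def)
  moreover have "(\<lambda>x. indicator {0..1} x *\<^sub>R f x) = f"
    using f by (auto simp: C01_def indicator_def fun_eq_iff)
  ultimately show ?thesis by (simp only:)
qed

lemma trace01_sum:
  assumes "\<And>i. i \<in> I \<Longrightarrow> f i \<in> C01"
  shows "trace01 (\<lambda>x. \<Sum>i\<in>I. f i x) = (\<Sum>i\<in>I. trace01 (f i))"
proof -
  have "trace01 (\<lambda>x. \<Sum>i\<in>I. f i x) = (LINT x|lborel. (\<Sum>i\<in>I. f i x))"
    by (rule trace01_C01[OF C01_sum]) (rule assms)
  also have "\<dots> = (\<Sum>i\<in>I. (LINT x|lborel. f i x))"
    by (rule Bochner_Integration.integral_sum) (use assms C01_integrable in blast)
  also have "\<dots> = (\<Sum>i\<in>I. trace01 (f i))"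
    by (rule sum.cong) (use assms trace01_C01 in auto)
  finally show ?thesis .
qed

text \<open>For nonempty lists over \<open>C01\<close> this is \<open>partition_series P\<close>,
  freed from \<open>SOME\<close>. The degree is read off the list because the reductions shorten
  both together.\<close>

definition Lambda_sum :: "(nat \<Rightarrow> nat set set set) \<Rightarrow> (real \<Rightarrow> complex) list \<Rightarrow> real \<Rightarrow> complex" where
  "Lambda_sum P hs x = (\<Sum>\<pi>\<in>P (length hs). Lambda_prod (length hs) \<pi> (\<lambda>k. hs ! (k - 1)) x)"

lemma nth_C01: "set hs \<subseteq> C01 \<Longrightarrow> \<forall>k\<in>{1..length hs}. hs ! (k - 1) \<in> C01"
  by (auto intro!: subsetD[OF _ nth_mem])

lemma partition_series_Lambda_sum:
  assumes "P n \<subseteq> partitions n" "length hs = n" "0 < n" "set hs \<subseteq> C01"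
  shows "partition_series P n hs = Lambda_sum P hs"
  unfolding partition_series_def Lambda_sum_def
  using assms Lambda_eq_prod[OF _ assms(3,2,4)] by (auto simp: fun_eq_iff intro!: sum.cong)

lemma Lambda_sum_C01:
  assumes "P (length hs) \<subseteq> partitions (length hs)" "hs \<noteq> []" "set hs \<subseteq> C01"
  shows "Lambda_sum P hs \<in> C01"
proof -
  have "(\<lambda>x. Lambda_sum P hs x) \<in> C01"
    unfolding Lambda_sum_def by (intro C01_sum Lambda_prod_C01 nth_C01) (use assms in auto)
  then show ?thesis by simp
qed

lemma Lambda_prod_list_update:
  "i < length hs \<Longrightarrow> Lambda_prod (length hs) \<pi> (\<lambda>k. hs[i := u] ! (k - 1)) x =
    Lambda_prod (length hs) \<pi> ((\<lambda>k. hs ! (k - 1))(Suc i := u)) x"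
  by (rule Lambda_prod_cong) (auto simp: nth_list_update)

lemma Lambda_sum_list_update:
  assumes "P (length hs) \<subseteq> partitions (length hs)" "set hs \<subseteq> C01" "i < length hs" "u \<in> C01" "v \<in> C01"
  shows "Lambda_sum P (hs[i := (\<lambda>y. a * u y + b * v y)]) x =
    a * Lambda_sum P (hs[i := u]) x + b * Lambda_sum P (hs[i := v]) x"
  unfolding Lambda_sum_def length_list_update sum_distrib_left sum.distrib[symmetric]
proof (rule sum.cong[OF refl])
  fix \<pi> assume "\<pi> \<in> P (length hs)"
  then have \<pi>: "\<pi> \<in> partitions (length hs)" using assms(1) by blast
  have len: "0 < length hs" using assms(3) by (cases hs) auto
  show "Lambda_prod (length hs) \<pi> (\<lambda>k. hs[i := (\<lambda>y. a * u y + b * v y)] ! (k - 1)) x =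
      a * Lambda_prod (length hs) \<pi> (\<lambda>k. hs[i := u] ! (k - 1)) x + b * Lambda_prod (length hs) \<pi> (\<lambda>k. hs[i := v] ! (k - 1)) x"
    unfolding Lambda_prod_list_update[OF assms(3)]
    by (rule Lambda_prod_comb[OF \<pi> len nth_C01[OF assms(2)] _ assms(4,5)]) (use assms(3) in auto)
qed

lemma set_list_update_C01: "set hs \<subseteq> C01 \<Longrightarrow> u \<in> C01 \<Longrightarrow> set (hs[i := u]) \<subseteq> C01"
  using set_update_subset_insert[of hs i u] by blast

section \<open>Multilinearity of the series\<close>

lemma formal_partition_series:
  assumes P: "\<And>n. P n \<subseteq> partitions n"
  shows "formal_series (partition_series P)"
  unfolding formal_series_def
proof
  fix n
  show "multilinear n (partition_series P n)"
  proof (cases "n = 0")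
    case True
    then show ?thesis by (simp add: multilinear_def partition_series_def C01_zero)
  next
    case False
    then have ps: "partition_series P n hs = Lambda_sum P hs" if "length hs = n" "set hs \<subseteq> C01" for hs
      using that P[of n] partition_series_Lambda_sum[of P n hs] by simp
    show ?thesis
      unfolding multilinear_def
    proof (intro allI impI, elim conjE, intro conjI allI impI ballI)
      fix gs :: "(real \<Rightarrow> complex) list" assume gs: "length gs = n" "set gs \<subseteq> C01"
      show "partition_series P n gs \<in> C01"
        using ps[OF gs] Lambda_sum_C01[of P gs] P gs False by auto
      fix i u v and a b :: complex assume i: "i < n" and uv: "u \<in> C01" "v \<in> C01"
      show "partition_series P n (gs[i := (\<lambda>y. a * u y + b * v y)]) =
          (\<lambda>y. a * partition_series P n (gs[i := u]) y + b * partition_series P n (gs[i := v]) y)"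
        using Lambda_sum_list_update[of P gs i u v a b] P gs i uv
        by (simp add: ps set_list_update_C01 C01_comb fun_eq_iff)
    qed
  qed
qed

lemma formal_series_one: "formal_series s_one"
  by (simp add: formal_series_def multilinear_def s_one_def C01_zero C01_const01)

lemma formal_series_var: "formal_series s_var"
  unfolding formal_series_def multilinear_def s_var_def
  by (auto simp: C01_zero length_Suc_conv)

lemma formal_seriesD1:
  "formal_series f \<Longrightarrow> length gs = n \<Longrightarrow> set gs \<subseteq> C01 \<Longrightarrow> f n gs \<in> C01"
  unfolding formal_series_def multilinear_def by blast

lemma formal_seriesD2:
  assumes "formal_series f" "length gs = n" "set gs \<subseteq> C01" "i < n" "u \<in> C01" "v \<in> C01"
  shows "f n (gs[i := (\<lambda>y. a * u y + b * v y)]) x = a * f n (gs[i := u]) x + b * f n (gs[i := v]) x"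
proof -
  have "f n (gs[i := (\<lambda>y. a * u y + b * v y)]) = (\<lambda>y. a * f n (gs[i := u]) y + b * f n (gs[i := v]) y)"
    using assms unfolding formal_series_def multilinear_def by blast
  then show ?thesis by simp
qed

lemma formal_seriesI:
  assumes "\<And>n gs. length gs = n \<Longrightarrow> set gs \<subseteq> C01 \<Longrightarrow> f n gs \<in> C01"
    "\<And>n gs i u v a b x. length gs = n \<Longrightarrow> set gs \<subseteq> C01 \<Longrightarrow> i < n \<Longrightarrow> u \<in> C01 \<Longrightarrow> v \<in> C01 \<Longrightarrow>
      f n (gs[i := (\<lambda>y. a * u y + b * v y)]) x = a * f n (gs[i := u]) x + b * f n (gs[i := v]) x"
  shows "formal_series f"
  unfolding formal_series_def multilinear_def using assms by (simp add: fun_eq_iff)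

lemma formal_series_add:
  assumes f: "formal_series f" and g: "formal_series g"
  shows "formal_series (f \<oplus> g)"
proof (rule formal_seriesI)
  fix n and gs :: "(real \<Rightarrow> complex) list" assume gs: "length gs = n" "set gs \<subseteq> C01"
  show "(f \<oplus> g) n gs \<in> C01"
    using C01_comb[OF formal_seriesD1[OF f gs] formal_seriesD1[OF g gs], of 1 1] by (simp add: s_add_def)
  fix i u v a b x assume "i < n" "u \<in> C01" "v \<in> C01"
  then show "(f \<oplus> g) n (gs[i := (\<lambda>y. a * u y + b * v y)]) x =
      a * (f \<oplus> g) n (gs[i := u]) x + b * (f \<oplus> g) n (gs[i := v]) x"
    by (simp add: s_add_def formal_seriesD2[OF f gs] formal_seriesD2[OF g gs] algebra_simps)
qed

lemma formal_series_uminus: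
  assumes f: "formal_series f"
  shows "formal_series (s_uminus f)"
proof (rule formal_seriesI)
  fix n and gs :: "(real \<Rightarrow> complex) list" assume gs: "length gs = n" "set gs \<subseteq> C01"
  show "s_uminus f n gs \<in> C01"
    using C01_scale[OF formal_seriesD1[OF f gs], of "-1"] by (simp add: s_uminus_def)
  fix i u v a b x assume "i < n" "u \<in> C01" "v \<in> C01"
  then show "s_uminus f n (gs[i := (\<lambda>y. a * u y + b * v y)]) x =
      a * s_uminus f n (gs[i := u]) x + b * s_uminus f n (gs[i := v]) x"
    by (simp add: s_uminus_def formal_seriesD2[OF f gs])
qed

lemma set_take_C01: "set gs \<subseteq> C01 \<Longrightarrow> set (take i gs) \<subseteq> C01"
  by (meson order_trans set_take_subset)

lemma set_drop_C01: "set gs \<subseteq> C01 \<Longrightarrow> set (drop i gs) \<subseteq> C01"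
  by (meson order_trans set_drop_subset)

lemma formal_series_mult:
  assumes f: "formal_series f" and g: "formal_series g"
  shows "formal_series (f \<otimes> g)"
proof (rule formal_seriesI)
  fix n and gs :: "(real \<Rightarrow> complex) list" assume gs: "length gs = n" "set gs \<subseteq> C01"
  show "(f \<otimes> g) n gs \<in> C01"
    unfolding s_mult_def
    by (intro C01_sum C01_mult formal_seriesD1[OF f] formal_seriesD1[OF g] set_take_C01 set_drop_C01) (use gs in auto)
  fix p u v a b x assume p: "p < n" and uv: "u \<in> C01" "v \<in> C01"
  show "(f \<otimes> g) n (gs[p := (\<lambda>y. a * u y + b * v y)]) x =
      a * (f \<otimes> g) n (gs[p := u]) x + b * (f \<otimes> g) n (gs[p := v]) x"
    unfolding s_mult_def sum_distrib_left sum.distrib[symmetric]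
  proof (rule sum.cong[OF refl])
    fix i assume i: "i \<in> {..n}"
    have len: "length (take i gs) = i" "length (drop i gs) = n - i" using i gs by auto
    show "f i (take i (gs[p := (\<lambda>y. a * u y + b * v y)])) x * g (n - i) (drop i (gs[p := (\<lambda>y. a * u y + b * v y)])) x =
      a * (f i (take i (gs[p := u])) x * g (n - i) (drop i (gs[p := u])) x) +
      b * (f i (take i (gs[p := v])) x * g (n - i) (drop i (gs[p := v])) x)"
    proof (cases "p < i")
      case True
      then show ?thesis
        by (simp add: take_update_swap formal_seriesD2[OF f len(1) set_take_C01[OF gs(2)] _ uv] algebra_simps)
    next
      case False
      then have "p - i < n - i" using p by simp
      with False show ?thesis
        by (simp add: drop_update_swap formal_seriesD2[OF g len(2) set_drop_C01[OF gs(2)] _ uv] algebra_simps)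
    qed
  qed
qed

lemma formal_series_power: "formal_series f \<Longrightarrow> formal_series (s_power f k)"
  by (induction k) (simp_all add: formal_series_one formal_series_mult)

lemma formal_series_geometric:
  assumes f: "formal_series f"
  shows "formal_series (s_geometric f)"
proof (rule formal_seriesI)
  note fp = formal_series_power[OF f]
  fix n and gs :: "(real \<Rightarrow> complex) list" assume gs: "length gs = n" "set gs \<subseteq> C01"
  show "s_geometric f n gs \<in> C01"
    unfolding s_geometric_def by (intro C01_sum formal_seriesD1[OF fp gs])
  fix i u v a b x assume "i < n" "u \<in> C01" "v \<in> C01"
  then show "s_geometric f n (gs[i := (\<lambda>y. a * u y + b * v y)]) x =
      a * s_geometric f n (gs[i := u]) x + b * s_geometric f n (gs[i := v]) x"
    by (simp add: s_geometric_def formal_seriesD2[OF fp gs] sum_distrib_left sum.distrib)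
qed

lemma CO_sub: "CO n \<subseteq> partitions n" and PC_plus_sub: "PC_plus n \<subseteq> partitions n"
  and PC_sub: "PC n \<subseteq> partitions n"
  by (auto simp: PC_def PC_plus_def CO_def)

lemma formal_A: "formal_series A_series"
  unfolding A_series_def by (rule formal_partition_series[OF PC_sub])

lemma formal_B: "formal_series B_series"
  unfolding B_series_def by (rule formal_partition_series[OF PC_plus_sub])

lemma formal_C: "formal_series C_series"
  unfolding C_series_def by (rule formal_partition_series[OF CO_sub])

lemma formal_D: "formal_series D_series"
  unfolding D_series_def by (intro formal_series_add formal_series_one formal_partition_series order_refl)

lemma formal_F: "formal_series F_series"
  unfolding F_series_def by (intro formal_series_mult formal_series_var formal_D)

section \<open>Integer compositions and the equation for D\<close>

definition compositions :: "nat \<Rightarrow> nat list set" where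
  "compositions n = {ks. sum_list ks = n \<and> 0 \<notin> set ks}"

lemma compositions_0: "compositions 0 = {[]}"
proof -
  have "ks = []" if "sum_list ks = 0" "0 \<notin> set ks" for ks :: "nat list"
    using that by (cases ks) auto
  then show ?thesis by (auto simp: compositions_def)
qed

text \<open>Splitting off the first part is the recursion along which the composition sums
  unfold.\<close>

lemma compositions_Suc:
  "compositions (Suc m) = (\<lambda>(i, ks). Suc i # ks) ` (SIGMA i:{..m}. compositions (m - i))"
proof (intro equalityI subsetI)
  fix ks assume ks: "ks \<in> compositions (Suc m)"
  then obtain k ks' where "ks = k # ks'" by (cases ks) (auto simp: compositions_def)
  moreover from this ks obtain i where "k = Suc i" by (cases k) (auto simp: compositions_def)
  ultimately show "ks \<in> (\<lambda>(i, ks). Suc i # ks) ` (SIGMA i:{..m}. compositions (m - i))"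
    using ks by (intro image_eqI[of _ _ "(i, ks')"]) (auto simp: compositions_def)
qed (auto simp: compositions_def)

lemma finite_compositions: "finite (compositions n)"
proof (induction n rule: less_induct)
  case (less n)
  show ?case
  proof (cases n)
    case (Suc m)
    then show ?thesis unfolding Suc compositions_Suc using less Suc by (intro finite_imageI finite_SigmaI) auto
  qed (simp add: compositions_0)
qed

lemma sum_compositions_Suc:
  "(\<Sum>ks\<in>compositions (Suc m). f ks) = (\<Sum>i\<le>m. \<Sum>ks\<in>compositions (m - i). f (Suc i # ks))"
proof -
  have "inj_on (\<lambda>(i, ks). Suc i # ks) (SIGMA i:{..m}. compositions (m - i))"
    by (auto simp: inj_on_def)
  then have "(\<Sum>ks\<in>compositions (Suc m). f ks) = (\<Sum>(i, ks)\<in>(SIGMA i:{..m}. compositions (m - i)). f (Suc i # ks))"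
    unfolding compositions_Suc by (subst sum.reindex) (auto simp: case_prod_unfold)
  then show ?thesis by (subst sum.Sigma) (auto simp: finite_compositions)
qed

lemma Lambda_prod_sum:
  assumes \<pi>: "\<pi> \<in> partitions n" "0 < n" and H: "\<forall>k\<in>{1..n}. H k \<in> C01" and j: "j \<in> {1..n}"
    and I: "finite I" "\<And>i. i \<in> I \<Longrightarrow> f i \<in> C01"
  shows "Lambda_prod n \<pi> (H(j := (\<lambda>y. \<Sum>i\<in>I. f i y))) x = (\<Sum>i\<in>I. Lambda_prod n \<pi> (H(j := f i)) x)"
  using I
proof (induction I rule: finite_induct)
  case empty
  \<comment> \<open>The zero function is written as a combination with coefficients 0, so that
    linearity applies.\<close>
  have "Lambda_prod n \<pi> (H(j := (\<lambda>y. 0 * 0 + 0 * 0))) x = 0 * Lambda_prod n \<pi> (H(j := (\<lambda>y. 0))) x + 0 * Lambda_prod n \<pi> (H(j := (\<lambda>y. 0))) x"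
    by (rule Lambda_prod_comb[OF \<pi> H j C01_zero C01_zero])
  then show ?case by (simp add: fun_upd_def)
next
  case (insert i I)
  have "Lambda_prod n \<pi> (H(j := (\<lambda>y. 1 * f i y + 1 * (\<Sum>i\<in>I. f i y)))) x =
      1 * Lambda_prod n \<pi> (H(j := f i)) x + 1 * Lambda_prod n \<pi> (H(j := (\<lambda>y. \<Sum>i\<in>I. f i y))) x"
    by (rule Lambda_prod_comb[OF \<pi> H j]) (use insert in \<open>auto intro: C01_sum\<close>)
  then show ?case using insert by (simp add: fun_upd_def)
qed

lemma partitions_0: "partitions 0 = {{}}"
  by (auto simp: partitions_def partition_on_def)

lemma insert_at_empty: "insert_at a 0 {} \<sigma> = \<sigma>"
proof -
  have "insert_pos a 0 = (\<lambda>k. k)" by (auto simp: insert_pos_def)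
  then show ?thesis by (simp add: insert_at_def)
qed

lemma D_series_Lambda_sum:
  assumes "0 < i" "length gs = i" "set gs \<subseteq> C01"
  shows "D_series i gs y = (\<Sum>\<rho>\<in>partitions i. Lambda_prod i \<rho> (\<lambda>k. gs ! (k - 1)) y)"
  using assms partition_series_Lambda_sum[of partitions i gs]
  by (simp add: D_series_def s_add_def s_one_def Lambda_sum_def)

lemma D_series_0: "D_series 0 gs = const01 1"
  by (simp add: D_series_def s_add_def s_one_def partition_series_def fun_eq_iff)

text \<open>Summation over all \<rho> turns the inserted factors into D evaluated at the i arguments
  after h, and this value multiplies h. The case i = 0 is the constant term 1 of D.\<close>

lemma sum_insert_at:
  assumes \<sigma>: "\<sigma> \<in> partitions m" and m: "m + i = length (pre @ h # rest)" and i: "i \<le> length rest"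
    and C: "set (pre @ h # rest) \<subseteq> C01"
  shows "(\<Sum>\<rho>\<in>partitions i. Lambda_prod (m + i) (insert_at (length pre + 1) i \<rho> \<sigma>) (\<lambda>k. (pre @ h # rest) ! (k - 1)) x) =
    Lambda_prod m \<sigma> (\<lambda>k. (pre @ (\<lambda>y. h y * D_series i (take i rest) y) # drop i rest) ! (k - 1)) x"
proof (cases "i = 0")
  case True
  have "(\<lambda>y. h y * const01 1 y) = h"
    using C by (auto simp: C01_def const01_def fun_eq_iff)
  then show ?thesis using True by (simp add: partitions_0 insert_at_empty D_series_0)
next
  case False
  let ?j = "length pre + 1" and ?H = "\<lambda>k. (pre @ h # rest) ! (k - 1)"
  have j: "1 \<le> ?j" "?j \<le> m" using m i by auto
  have i0: "0 < i" using False by simp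
  have H: "\<forall>k\<in>{1..m + i}. ?H k \<in> C01"
    using nth_C01[OF C] m by simp
  have H': "\<forall>k\<in>{1..m}. (?H \<circ> insert_pos ?j i) k \<in> C01"
    using H by (auto simp: insert_pos_def)
  have shift: "Lambda_prod i \<rho> (\<lambda>l. ?H (l + ?j)) y = Lambda_prod i \<rho> (\<lambda>k. take i rest ! (k - 1)) y" for \<rho> y
  proof (rule Lambda_prod_cong)
    fix k assume "k \<in> {1..i}"
    then have "k - 1 < i" "1 \<le> k" by auto
    then show "?H (k + ?j) = take i rest ! (k - 1)" by (simp add: nth_append nth_Cons')
  qed
  have f: "(\<lambda>y. ?H ?j y * Lambda_prod i \<rho> (\<lambda>l. ?H (l + ?j)) y) \<in> C01" if "\<rho> \<in> partitions i" for \<rho>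
    using insert_fun_C01[OF that j i0 H, rule_format, of ?j] j by (simp add: insert_fun_def)
  have "(\<Sum>\<rho>\<in>partitions i. Lambda_prod (m + i) (insert_at ?j i \<rho> \<sigma>) ?H x) =
      (\<Sum>\<rho>\<in>partitions i. Lambda_prod m \<sigma> ((?H \<circ> insert_pos ?j i)(?j := (\<lambda>y. ?H ?j y * Lambda_prod i \<rho> (\<lambda>l. ?H (l + ?j)) y))) x)"
    by (rule sum.cong[OF refl], subst Lambda_prod_insert_at[OF _ \<sigma> j i0 H]) (simp_all add: insert_fun_def)
  also have "\<dots> = Lambda_prod m \<sigma> ((?H \<circ> insert_pos ?j i)(?j := (\<lambda>y. \<Sum>\<rho>\<in>partitions i. ?H ?j y * Lambda_prod i \<rho> (\<lambda>l. ?H (l + ?j)) y))) x"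
    by (rule Lambda_prod_sum[symmetric, OF \<sigma> _ H' _ finite_partitions f]) (use j in auto)
  also have "\<dots> = Lambda_prod m \<sigma> (\<lambda>k. (pre @ (\<lambda>y. h y * D_series i (take i rest) y) # drop i rest) ! (k - 1)) x"
  proof (rule Lambda_prod_cong)
    fix k assume k: "k \<in> {1..m}"
    have D: "D_series i (take i rest) y = (\<Sum>\<rho>\<in>partitions i. Lambda_prod i \<rho> (\<lambda>k. take i rest ! (k - 1)) y)" for y
      using i0 i C set_take_C01[of rest i] by (intro D_series_Lambda_sum) auto
    consider "k < ?j" | "k = ?j" | "?j < k" by linarith
    then show "((?H \<circ> insert_pos ?j i)(?j := (\<lambda>y. \<Sum>\<rho>\<in>partitions i. ?H ?j y * Lambda_prod i \<rho> (\<lambda>l. ?H (l + ?j)) y))) k =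
        (pre @ (\<lambda>y. h y * D_series i (take i rest) y) # drop i rest) ! (k - 1)"
    proof cases
      case 1
      then have "k - 1 < length pre" "insert_pos ?j i k = k" "k \<noteq> ?j"
        using k by (auto simp: insert_pos_def)
      then show ?thesis by (simp add: nth_append)
    next
      case 2
      then show ?thesis unfolding shift by (simp add: D sum_distrib_left nth_append)
    next
      case 3
      then obtain p where p: "k = ?j + Suc p" using less_imp_Suc_add by (metis add_Suc_right)
      then show ?thesis using i by (simp add: insert_pos_def nth_append nth_Cons' add.commute)
    qed
  qed
  finally show ?thesis .
qed

text \<open>Each \<pi> is decomposed at position \<open>length pre + 1\<close>. Summing over \<rho>
  first leaves a sum over \<sigma> with a shortened argument list.\<close>

lemma Lambda_sum_unsplit_step:
  assumes C: "set (pre @ h # rest) \<subseteq> C01"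
  shows "Lambda_sum (unsplit_upto (length pre + 1)) (pre @ h # rest) x =
    (\<Sum>i\<le>length rest. Lambda_sum (unsplit_upto (length pre + 2))
       (pre @ (\<lambda>y. h y * D_series i (take i rest) y) # drop i rest) x)"
proof -
  let ?j = "length pre + 1" and ?l = "length rest" and ?H = "\<lambda>k. (pre @ h # rest) ! (k - 1)"
  have fin: "finite (unsplit_upto j n)" for j n
    by (rule finite_subset[OF _ finite_partitions]) (auto simp: unsplit_upto_def)
  have "Lambda_sum (unsplit_upto ?j) (pre @ h # rest) x = (\<Sum>\<pi>\<in>unsplit_upto ?j (?j + ?l). Lambda_prod (?j + ?l) \<pi> ?H x)"
    by (simp add: Lambda_sum_def)
  also have "\<dots> = (\<Sum>(i, \<rho>, \<sigma>)\<in>(SIGMA i:{..?l}. partitions i \<times> unsplit_upto (?j + 1) (?j + ?l - i)).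
      Lambda_prod (?j + ?l) (insert_at ?j i \<rho> \<sigma>) ?H x)"
    by (subst sum.reindex_bij_betw[OF bij_betw_insert_at, symmetric]) (auto simp: case_prod_unfold)
  also have "\<dots> = (\<Sum>i\<le>?l. \<Sum>(\<rho>, \<sigma>)\<in>partitions i \<times> unsplit_upto (?j + 1) (?j + ?l - i).
      Lambda_prod (?j + ?l) (insert_at ?j i \<rho> \<sigma>) ?H x)"
    by (subst sum.Sigma) (auto simp: fin finite_partitions)
  also have "\<dots> = (\<Sum>i\<le>?l. Lambda_sum (unsplit_upto (?j + 1)) (pre @ (\<lambda>y. h y * D_series i (take i rest) y) # drop i rest) x)"
  proof (rule sum.cong[OF refl])
    fix i assume "i \<in> {..?l}"
    then have i: "i \<le> ?l" by simp
    let ?m = "?j + ?l - i"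
    have m: "?m + i = ?j + ?l" using i by simp
    have "(\<Sum>(\<rho>, \<sigma>)\<in>partitions i \<times> unsplit_upto (?j + 1) ?m. Lambda_prod (?j + ?l) (insert_at ?j i \<rho> \<sigma>) ?H x) =
        (\<Sum>\<sigma>\<in>unsplit_upto (?j + 1) ?m. \<Sum>\<rho>\<in>partitions i. Lambda_prod (?j + ?l) (insert_at ?j i \<rho> \<sigma>) ?H x)"
      by (subst sum.cartesian_product[symmetric]) (rule sum.swap)
    also have "\<dots> = (\<Sum>\<sigma>\<in>unsplit_upto (?j + 1) ?m.
        Lambda_prod ?m \<sigma> (\<lambda>k. (pre @ (\<lambda>y. h y * D_series i (take i rest) y) # drop i rest) ! (k - 1)) x)"
    proof (rule sum.cong[OF refl])
      fix \<sigma> assume "\<sigma> \<in> unsplit_upto (?j + 1) ?m"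
      then have \<sigma>: "\<sigma> \<in> partitions ?m" by (simp add: unsplit_upto_def)
      have "?m + i = length (pre @ h # rest)" using m by simp
      from sum_insert_at[OF \<sigma> this i C, of x]
      show "(\<Sum>\<rho>\<in>partitions i. Lambda_prod (?j + ?l) (insert_at ?j i \<rho> \<sigma>) ?H x) =
          Lambda_prod ?m \<sigma> (\<lambda>k. (pre @ (\<lambda>y. h y * D_series i (take i rest) y) # drop i rest) ! (k - 1)) x"
        unfolding m .
    qed
    also have "\<dots> = Lambda_sum (unsplit_upto (?j + 1)) (pre @ (\<lambda>y. h y * D_series i (take i rest) y) # drop i rest) x"
    proof -
      have "length (pre @ (\<lambda>y. h y * D_series i (take i rest) y) # drop i rest) = ?m" using i by simp
      then show ?thesis unfolding Lambda_sum_def by (simp only:)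
    qed
    finally show "(\<Sum>(\<rho>, \<sigma>)\<in>partitions i \<times> unsplit_upto (?j + 1) ?m. Lambda_prod (?j + ?l) (insert_at ?j i \<rho> \<sigma>) ?H x) =
      Lambda_sum (unsplit_upto (?j + 1)) (pre @ (\<lambda>y. h y * D_series i (take i rest) y) # drop i rest) x" .
  qed
  finally show ?thesis by simp
qed

lemma F_series_Cons: "F_series (Suc i) (g # gs) = (\<lambda>y. g y * D_series i gs y)"
proof
  fix y
  have "F_series (Suc i) (g # gs) y = (\<Sum>p\<le>Suc i. if p = 1 then g y * D_series i gs y else 0)"
    unfolding F_series_def s_mult_def by (rule sum.cong) (auto simp: s_var_def)
  then show "F_series (Suc i) (g # gs) y = g y * D_series i gs y" by simp
qed

text \<open>The list \<open>pre\<close> holds the positions already treated, and a composition of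
  the remaining length records how many arguments each later position absorbs: its own together with
  those fed to D. Induction is on the number of arguments after h.\<close>

lemma Lambda_sum_unsplit_unroll:
  assumes "set (pre @ h # rest) \<subseteq> C01"
  shows "Lambda_sum (unsplit_upto (length pre + 1)) (pre @ h # rest) x =
    (\<Sum>i\<le>length rest. \<Sum>ks\<in>compositions (length rest - i).
       C_series (length pre + 1 + length ks)
         (pre @ (\<lambda>y. h y * D_series i (take i rest) y) #
            map2 F_series ks (split_list_at ks (drop i rest))) x)"
  using assms
proof (induction "length rest" arbitrary: pre h rest rule: less_induct)
  case less
  let ?h = "\<lambda>i y. h y * D_series i (take i rest) y"
  let ?C = "\<lambda>i ks. C_series (length pre + 1 + length ks)
         (pre @ ?h i # map2 F_series ks (split_list_at ks (drop i rest))) x"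
  have hC: "?h i \<in> C01" if "i \<le> length rest" for i
    using less.prems that set_take_C01[of rest i]
    by (intro C01_mult formal_seriesD1[OF formal_D]) auto
  have "Lambda_sum (unsplit_upto (length pre + 2)) (pre @ ?h i # drop i rest) x = (\<Sum>ks\<in>compositions (length rest - i). ?C i ks)"
    if i: "i \<le> length rest" for i
  proof (cases "drop i rest")
    \<comment> \<open>Every position has been treated: \<open>length pre + 2\<close> exceeds the
      length of the list, so the remaining partitions are those in \<open>CO\<close>.\<close>
    case Nil
    then have li: "length rest - i = 0" by simp
    have C: "set (pre @ [?h i]) \<subseteq> C01" using less.prems hC[OF i] by auto
    have "Lambda_sum (unsplit_upto (length pre + 2)) (pre @ [?h i]) x = Lambda_sum CO (pre @ [?h i]) x"
      unfolding Lambda_sum_def by (subst unsplit_upto_CO) auto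
    also have "\<dots> = C_series (length pre + 1) (pre @ [?h i]) x"
      unfolding C_series_def by (subst partition_series_Lambda_sum[OF CO_sub _ _ C]) auto
    finally show ?thesis by (simp add: Nil li compositions_0)
  next
    case (Cons g rest')
    then have len: "length rest - i = Suc (length rest')" by (metis length_Cons length_drop)
    have rest': "set (g # rest') \<subseteq> C01" using Cons less.prems set_drop_C01[of rest i] by auto
    have "Lambda_sum (unsplit_upto (length (pre @ [?h i]) + 1)) ((pre @ [?h i]) @ g # rest') x =
      (\<Sum>i'\<le>length rest'. \<Sum>ks\<in>compositions (length rest' - i').
         C_series (length (pre @ [?h i]) + 1 + length ks)
         ((pre @ [?h i]) @ (\<lambda>y. g y * D_series i' (take i' rest') y) #
            map2 F_series ks (split_list_at ks (drop i' rest'))) x)"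
      using less.prems rest' hC[OF i] len by (intro less.hyps) auto
    also have "\<dots> = (\<Sum>i'\<le>length rest'. \<Sum>ks\<in>compositions (length rest' - i'). ?C i (Suc i' # ks))"
      by (intro sum.cong refl) (simp add: Cons F_series_Cons)
    also have "\<dots> = (\<Sum>ks\<in>compositions (length rest - i). ?C i ks)"
      unfolding len by (rule sum_compositions_Suc[symmetric])
    finally show ?thesis by (simp add: Cons)
  qed
  then show ?case
    unfolding Lambda_sum_unsplit_step[OF less.prems] by (intro sum.cong) auto
qed

text \<open>The equality holds for arbitrary arguments and not only on the diagonal, so it can be substituted
  on the left of a composition without polarization.\<close>

lemma D_series_eq:
  assumes "length gs = n" "set gs \<subseteq> C01"
  shows "D_series n gs = (s_one \<oplus> C_series \<odot> F_series) n gs"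
proof (cases gs)
  case Nil
  then have "n = 0" using assms by simp
  have "(C_series \<odot> F_series) 0 [] x = 0" for x
    using compositions_0 by (simp add: s_comp_def compositions_def C_series_def partition_series_def)
  then show ?thesis
    using Nil \<open>n = 0\<close> by (simp add: s_add_def D_series_0 s_one_def)
next
  case (Cons g rest)
  then have n: "n = Suc (length rest)" using assms by simp
  show ?thesis
  proof
    fix x
    have "D_series n gs x = Lambda_sum partitions gs x"
      using D_series_Lambda_sum[of n gs x] assms n by (simp add: Lambda_sum_def)
    also have "\<dots> = Lambda_sum (unsplit_upto (length ([] :: (real \<Rightarrow> complex) list) + 1)) ([] @ g # rest) x"
      using Cons by (simp add: Lambda_sum_def unsplit_upto_1[unfolded One_nat_def])
    also have "\<dots> = (\<Sum>i\<le>length rest. \<Sum>ks\<in>compositions (length rest - i).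
       C_series (Suc (length ks)) ((\<lambda>y. g y * D_series i (take i rest) y) #
            map2 F_series ks (split_list_at ks (drop i rest))) x)"
      using assms Cons by (subst Lambda_sum_unsplit_unroll) auto
    also have "\<dots> = (\<Sum>i\<le>length rest. \<Sum>ks\<in>compositions (length rest - i).
        C_series (length (Suc i # ks)) (map2 F_series (Suc i # ks) (split_list_at (Suc i # ks) gs)) x)"
      by (intro sum.cong refl) (simp add: Cons F_series_Cons)
    also have "\<dots> = (\<Sum>ks\<in>compositions n. C_series (length ks) (map2 F_series ks (split_list_at ks gs)) x)"
      unfolding n by (rule sum_compositions_Suc[symmetric])
    also have "\<dots> = (C_series \<odot> F_series) n gs x"
      by (simp add: s_comp_def compositions_def)
    finally show "D_series n gs x = (s_one \<oplus> C_series \<odot> F_series) n gs x"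
      using n by (simp add: s_add_def s_one_def)
  qed
qed

section \<open>The equation for C\<close>

text \<open>Either the positions j and j + 1 lie in different blocks, and the scan moves on, or they
  are merged at the cost of a factor \<open>trace01 h\<close>, and position j is examined again with
  h' in place of h.\<close>

lemma Lambda_sum_CO_upto_step:
  assumes C: "set (pre @ h # h' # rest) \<subseteq> C01"
  shows "Lambda_sum (CO_upto (length pre + 1)) (pre @ h # h' # rest) x =
    Lambda_sum (CO_upto (length pre + 2)) (pre @ h # h' # rest) x +
    trace01 h * Lambda_sum (CO_upto (length pre + 1)) (pre @ h' # rest) x"
proof -
  let ?j = "length pre + 1" and ?n = "length pre + length rest + 2"
  let ?H = "\<lambda>k. (pre @ h # h' # rest) ! (k - 1)"
  have len: "length (pre @ h # h' # rest) = ?n" "length (pre @ h' # rest) = ?n - 1" by auto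
  have j: "?j \<in> {1..<?n}" by auto
  let ?M = "{\<pi> \<in> CO_upto ?j ?n. same_block \<pi> ?j (?j + 1)}"
  have fin: "finite (CO_upto j n)" for j n
    by (rule finite_subset[OF _ finite_partitions]) (auto simp: CO_upto_def CO_def)
  have split: "CO_upto ?j ?n = CO_upto (?j + 1) ?n \<union> ?M" "CO_upto (?j + 1) ?n \<inter> ?M = {}"
    by (auto simp: CO_upto_def less_Suc_eq atLeastLessThanSuc)
  have "(\<Sum>\<pi>\<in>?M. Lambda_prod ?n \<pi> ?H x) = trace01 h * Lambda_sum (CO_upto ?j) (pre @ h' # rest) x"
  proof -
    have inj: "inj_on (pullback ?n (merge_succ ?j)) (CO_upto ?j (?n - 1))"
      by (rule inj_on_subset[OF pullback_inj[OF merge_succ_image[OF j]]]) (auto simp: CO_upto_def CO_def)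
    have "(\<Sum>\<pi>\<in>?M. Lambda_prod ?n \<pi> ?H x) = (\<Sum>\<pi>\<in>CO_upto ?j (?n - 1). Lambda_prod ?n (pullback ?n (merge_succ ?j) \<pi>) ?H x)"
      unfolding CO_upto_merge_eq[OF j] by (subst sum.reindex[OF inj]) (simp only: comp_def)
    also have "\<dots> = (\<Sum>\<pi>\<in>CO_upto ?j (?n - 1). trace01 h * Lambda_prod (?n - 1) \<pi> (\<lambda>k. (pre @ h' # rest) ! (k - 1)) x)"
    proof (rule sum.cong[OF refl])
      fix \<pi> assume "\<pi> \<in> CO_upto ?j (?n - 1)"
      then have \<pi>: "\<pi> \<in> partitions (?n - 1)" by (simp add: CO_upto_def CO_def)
      have H: "\<forall>k\<in>{1..?n}. ?H k \<in> C01" using nth_C01[OF C] len by simp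
      have "Lambda_prod ?n (pullback ?n (merge_succ ?j) \<pi>) ?H x = trace01 (?H ?j) * Lambda_prod (?n - 1) \<pi> (?H \<circ> skip ?j) x"
        by (rule Lambda_prod_merge[OF j \<pi> H])
      also have "Lambda_prod (?n - 1) \<pi> (?H \<circ> skip ?j) x = Lambda_prod (?n - 1) \<pi> (\<lambda>k. (pre @ h' # rest) ! (k - 1)) x"
      proof (rule Lambda_prod_cong)
        fix k assume k: "k \<in> {1..?n - 1}"
        show "(?H \<circ> skip ?j) k = (pre @ h' # rest) ! (k - 1)"
        proof (cases "k < ?j")
          case True
          then have "k - 1 < length pre" "skip ?j k = k" using k by (auto simp: skip_def)
          then show ?thesis by (simp add: nth_append)
        next
          case False
          then obtain p where "k = ?j + p" by (metis le_iff_add not_less)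
          then show ?thesis by (simp add: skip_def nth_append)
        qed
      qed
      also have "?H ?j = h" by (simp add: nth_append)
      finally show "Lambda_prod ?n (pullback ?n (merge_succ ?j) \<pi>) ?H x =
          trace01 h * Lambda_prod (?n - 1) \<pi> (\<lambda>k. (pre @ h' # rest) ! (k - 1)) x" .
    qed
    finally show ?thesis by (simp only: Lambda_sum_def len sum_distrib_left)
  qed
  moreover have "(\<Sum>\<pi>\<in>CO_upto ?j ?n. Lambda_prod ?n \<pi> ?H x) =
      (\<Sum>\<pi>\<in>CO_upto (?j + 1) ?n. Lambda_prod ?n \<pi> ?H x) + (\<Sum>\<pi>\<in>?M. Lambda_prod ?n \<pi> ?H x)"
    by (subst split(1), rule sum.union_disjoint) (use fin split(2) in auto)
  ultimately show ?thesis by (simp only: Lambda_sum_def len) (simp add: add.commute)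
qed

lemma B_series_Lambda_sum: "set hs \<subseteq> C01 \<Longrightarrow> hs \<noteq> [] \<Longrightarrow> B_series (length hs) hs = Lambda_sum PC_plus hs"
  unfolding B_series_def by (rule partition_series_Lambda_sum[OF PC_plus_sub]) auto

lemma formal_series_slot_scale:
  assumes "formal_series f" "set (pre @ u # post) \<subseteq> C01" "n = length (pre @ u # post)"
  shows "f n (pre @ (\<lambda>y. c * u y) # post) x = c * f n (pre @ u # post) x"
  using formal_seriesD2[OF assms(1) assms(3)[symmetric] assms(2), of "length pre" u u c 0 x] assms by simp

text \<open>Merging k - 1 times at one position leaves a single g with factor
  \<open>trace01 g ^ (k - 1)\<close>, the term of degree k of g/(1 - \<tau>(g)). The parts of the
  composition count the arguments absorbed at each position.\<close>

lemma Lambda_sum_CO_unroll: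
  assumes g: "g \<in> C01" and pre: "set pre \<subseteq> C01"
  defines "G \<equiv> \<lambda>k y. trace01 g ^ (k - 1) * g y"
  shows "Lambda_sum (CO_upto (length pre + 1)) (pre @ g # replicate l g) x =
    (\<Sum>ks\<in>compositions (Suc l). B_series (length pre + length ks) (pre @ map G ks) x)"
  using pre
proof (induction l arbitrary: pre)
  case 0
  have "CO_upto (length pre + 1) (length pre + 1) = PC_plus (length pre + 1)"
    by (simp add: CO_upto_def PC_plus_def)
  moreover have "(\<Sum>ks\<in>compositions (Suc 0). B_series (length pre + length ks) (pre @ map G ks) x)
      = B_series (length pre + 1) (pre @ [G 1]) x"
    by (simp add: sum_compositions_Suc compositions_0)
  moreover have "B_series (length pre + 1) (pre @ [G 1]) = Lambda_sum PC_plus (pre @ [G 1])"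
    using B_series_Lambda_sum[of "pre @ [G 1]"] 0 g by (simp add: G_def)
  moreover have "G 1 = g" by (simp add: G_def)
  ultimately show ?case by (simp add: Lambda_sum_def)
next
  case (Suc l)
  let ?B = "\<lambda>ks. B_series (length pre + length ks) (pre @ map G ks) x"
  have GC: "G k \<in> C01" for k unfolding G_def by (rule C01_scale[OF g])
  have G1: "G (Suc 0) = g" by (simp add: G_def)
  have GS: "G (Suc (Suc i)) = (\<lambda>y. trace01 g * G (Suc i) y)" for i by (simp add: G_def mult.assoc)
  have C: "set (pre @ g # g # replicate l g) \<subseteq> C01" using Suc.prems g by auto
  have "Lambda_sum (CO_upto (length pre + 1)) (pre @ g # g # replicate l g) x =
    Lambda_sum (CO_upto (length (pre @ [g]) + 1)) ((pre @ [g]) @ g # replicate l g) x +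
    trace01 g * Lambda_sum (CO_upto (length pre + 1)) (pre @ g # replicate l g) x"
    using Lambda_sum_CO_upto_step[OF C, of x] by simp
  also have "Lambda_sum (CO_upto (length (pre @ [g]) + 1)) ((pre @ [g]) @ g # replicate l g) x =
      (\<Sum>ks\<in>compositions (Suc l). ?B (Suc 0 # ks))"
    by (subst Suc.IH) (use Suc.prems g in \<open>auto simp: G1 intro!: sum.cong\<close>)
  also have "trace01 g * Lambda_sum (CO_upto (length pre + 1)) (pre @ g # replicate l g) x =
      (\<Sum>ks\<in>compositions (Suc l). trace01 g * ?B ks)"
    by (subst Suc.IH[OF Suc.prems]) (rule sum_distrib_left)
  \<comment> \<open>The trace factor is moved into the first slot and raises the first part by one.
    Together with the sum whose first part is 1, this exhausts all compositions.\<close>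
  also have "\<dots> = (\<Sum>i\<le>l. \<Sum>ks\<in>compositions (l - i). ?B (Suc (Suc i) # ks))"
    unfolding sum_compositions_Suc
  proof (intro sum.cong refl)
    fix i ks
    have "set (pre @ G (Suc i) # map G ks) \<subseteq> C01" using Suc.prems GC by auto
    from formal_series_slot_scale[OF formal_B this refl, of "trace01 g" x]
    show "trace01 g * ?B (Suc i # ks) = ?B (Suc (Suc i) # ks)" by (simp add: GS)
  qed
  also have "(\<Sum>ks\<in>compositions (Suc l). ?B (Suc 0 # ks)) + (\<Sum>i\<le>l. \<Sum>ks\<in>compositions (l - i). ?B (Suc (Suc i) # ks))
      = (\<Sum>i\<le>Suc l. \<Sum>ks\<in>compositions (Suc l - i). ?B (Suc i # ks))"
    by (simp add: sum.atMost_Suc_shift del: sum.atMost_Suc)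
  also have "\<dots> = (\<Sum>ks\<in>compositions (Suc (Suc l)). ?B ks)"
    by (rule sum_compositions_Suc[symmetric])
  finally show ?case by simp
qed

lemma series_term_power_trace:
  assumes g: "g \<in> C01"
  shows "series_term (s_power (s_trace s_var) k) n g x = (if n = k then const01 (trace01 g ^ k) x else 0)"
proof (induction k arbitrary: n)
  case 0
  then show ?case by (simp add: series_term_def s_one_def)
next
  case (Suc k)
  have tr0: "trace01 (\<lambda>x. 0) = 0" by (simp add: trace01_def)
  have tr: "series_term (s_trace s_var) i g x = (if i = 1 then const01 (trace01 g) x else 0)" for i
    by (auto simp: series_term_def s_trace_def s_var_def tr0 const01_def)
  have "series_term (s_power (s_trace s_var) (Suc k)) n g x =
      (\<Sum>i\<le>n. if i = 1 then const01 (trace01 g) x * (if n - 1 = k then const01 (trace01 g ^ k) x else 0) else 0)"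
    unfolding s_power.simps series_term_s_mult by (rule sum.cong[OF refl]) (simp add: tr Suc)
  also have "\<dots> = (if n = Suc k then const01 (trace01 g ^ Suc k) x else 0)"
    by (cases n) (auto simp: const01_def)
  finally show ?case .
qed

lemma series_term_var: "series_term s_var n g = (if n = 1 then g else (\<lambda>x. 0))"
  by (auto simp: series_term_def s_var_def)

lemma series_term_var_mult:
  "series_term (s_var \<otimes> f) n g x = (if n = 0 then 0 else g x * series_term f (n - 1) g x)"
proof -
  have "series_term (s_var \<otimes> f) n g x = (\<Sum>i\<le>n. if i = 1 then g x * series_term f (n - 1) g x else 0)"
    unfolding series_term_s_mult series_term_var by (rule sum.cong) auto
  then show ?thesis by auto
qed

lemma series_term_G:
  assumes g: "g \<in> C01" and k: "0 < k"
  shows "series_term (s_var \<otimes> s_geometric (s_trace s_var)) k g = (\<lambda>y. trace01 g ^ (k - 1) * g y)"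
proof
  fix y
  have "series_term (s_geometric (s_trace s_var)) n g y = const01 (trace01 g ^ n) y" for n
    using series_term_power_trace[OF g] by (simp add: series_term_def s_geometric_def)
  then have "series_term (s_var \<otimes> s_geometric (s_trace s_var)) k g y = g y * const01 (trace01 g ^ (k - 1)) y"
    using k by (simp add: series_term_var_mult)
  then show "series_term (s_var \<otimes> s_geometric (s_trace s_var)) k g y = trace01 g ^ (k - 1) * g y"
    using g by (auto simp: C01_def const01_def)
qed

lemma C_series_eq: "C_series \<doteq> B_series \<odot> (s_var \<otimes> s_geometric (s_trace s_var))"
  unfolding series_eq_def
proof (intro allI ballI ext)
  fix n g x assume g: "g \<in> C01"
  let ?G = "s_var \<otimes> s_geometric (s_trace s_var)"
  have *: "series_term (B_series \<odot> ?G) n g x =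
      (\<Sum>ks\<in>compositions n. B_series (length ks) (map (\<lambda>k y. trace01 g ^ (k - 1) * g y) ks) x)"
    unfolding series_term_s_comp compositions_def
  proof (rule sum.cong[OF refl])
    fix ks assume "ks \<in> {ks. sum_list ks = n \<and> 0 \<notin> set ks}"
    then have "map (\<lambda>k. series_term ?G k g) ks = map (\<lambda>k y. trace01 g ^ (k - 1) * g y) ks"
      using series_term_G[OF g] by (intro map_cong[OF refl]) (metis (mono_tags, lifting) gr0I mem_Collect_eq)
    then show "B_series (length ks) (map (\<lambda>k. series_term ?G k g) ks) x =
        B_series (length ks) (map (\<lambda>k y. trace01 g ^ (k - 1) * g y) ks) x" by (simp only:)
  qed
  show "series_term C_series n g x = series_term (B_series \<odot> ?G) n g x"
  proof (cases n)
    case 0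
    then show ?thesis
      unfolding * by (simp add: compositions_0 series_term_def C_series_def B_series_def partition_series_def)
  next
    case (Suc l)
    have "series_term C_series n g = Lambda_sum CO (replicate n g)"
      unfolding series_term_def C_series_def
      by (rule partition_series_Lambda_sum[OF CO_sub]) (use Suc g in auto)
    moreover have "CO_upto (length ([] :: (real \<Rightarrow> complex) list) + 1) m = CO m" for m
      by (simp add: CO_upto_def)
    ultimately show ?thesis
      unfolding * using Lambda_sum_CO_unroll[OF g, of "[]" l x] Suc by (simp add: Lambda_sum_def)
  qed
qed

section \<open>The equation for B\<close>

lemma partitions_1: "partitions 1 = {{{1}}}"
proof -
  have "\<pi> = {{1}}" if P: "\<pi> \<in> partitions 1" for \<pi>
  proof -
    have "S = {1}" if "S \<in> \<pi>" for S
      using partition_block_subset[OF \<open>\<pi> \<in> partitions 1\<close> that] partitions_nonempty[OF \<open>\<pi> \<in> partitions 1\<close> that] by auto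
    moreover obtain S where "S \<in> \<pi>" using partition_unique_block[OF P, of 1] by auto
    ultimately show ?thesis by blast
  qed
  moreover have "{{1}} \<in> partitions 1"
    by (rule partitionsI) auto
  ultimately show ?thesis by blast
qed

text \<open>There are no coordinates, so the integral is over a one-point space of mass 1, and t 1 =
  t 0 = x.\<close>

lemma Lambda_prod_1: "Lambda_prod 1 {{1}} H x = H 1 x"
proof -
  have P: "{{1}} \<in> partitions 1" unfolding partitions_1 by blast
  have J: "std_coords 1 {{1}} = {}" by (auto simp: std_coords_def)
  have "std_point 1 {{1}} x s 0 = x" for s
    by (rule V_point_spec(2)[OF free_coords_std[OF P]]) simp
  then have "Lambda_prod 1 {{1}} H x = (LINT s|(\<Pi>\<^sub>M j\<in>({} :: nat set). (lborel :: real measure)). H 1 x)"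
    unfolding Lambda_prod_def J by simp
  also have "\<dots> = H 1 x"
  proof -
    interpret product_sigma_finite "\<lambda>_::nat. lborel :: real measure" ..
    have "emeasure (\<Pi>\<^sub>M j\<in>({} :: nat set). (lborel :: real measure)) (space (\<Pi>\<^sub>M j\<in>({} :: nat set). (lborel :: real measure))) = 1"
      using emeasure_PiM[of "{}" "\<lambda>_. UNIV"] by (simp add: space_PiM)
    then show ?thesis by (simp add: measure_def)
  qed
  finally show ?thesis .
qed

text \<open>In degree 1 condition (c) compares 1 with itself and fails. This is why g appears as a
  summand of its own in the equation for B.\<close>

lemma PC_1: "PC 1 = {}" and PC_plus_1: "PC_plus 1 = {{{1}}}"
proof -
  have "{{1}} \<in> CO 1" unfolding CO_iff using partitions_1 by auto
  then show "PC_plus 1 = {{{1}}}" using partitions_1 PC_plus_sub[of 1] by (auto simp: PC_plus_def)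
  moreover have "same_block {{1}} 1 1" by (simp add: same_block_def)
  ultimately show "PC 1 = {}" by (auto simp: PC_def)
qed

text \<open>The partitions are sorted by whether 1 and n share a block. Those that do are closed up
  from \<open>PC (n - 1)\<close>, and each contributes g(x) times a trace.\<close>

lemma Lambda_sum_PC_plus:
  assumes g: "g \<in> C01" and n: "2 \<le> n"
  shows "Lambda_sum PC_plus (replicate n g) x =
    Lambda_sum PC (replicate n g) x + trace01 (Lambda_sum PC (replicate (n - 1) g)) * g x"
proof -
  let ?M = "{\<pi> \<in> PC_plus n. same_block \<pi> 1 n}" and ?H = "\<lambda>_::nat. g"
  have rep: "Lambda_prod m \<pi> (\<lambda>k. replicate m g ! (k - 1)) y = Lambda_prod m \<pi> ?H y" for m \<pi> y
    by (rule Lambda_prod_cong) auto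
  have fin: "finite (PC m)" for m by (rule finite_subset[OF PC_sub finite_partitions])
  have fin': "finite ?M" by (rule finite_subset[OF _ finite_partitions]) (auto simp: PC_plus_def CO_def)
  have split: "PC_plus n = PC n \<union> ?M" "PC n \<inter> ?M = {}" by (auto simp: PC_def)
  have "(\<Sum>\<pi>\<in>?M. Lambda_prod n \<pi> ?H x) = (\<Sum>\<pi>\<in>PC (n - 1). g x * trace01 (Lambda_prod (n - 1) \<pi> ?H))"
  proof -
    have inj: "inj_on (pullback n (close_end n)) (PC (n - 1))"
      by (rule inj_on_subset[OF pullback_inj[OF close_end_image[OF n]] PC_sub])
    show ?thesis
      unfolding PC_plus_closed_eq[OF n]
      by (subst sum.reindex[OF inj], rule sum.cong[OF refl])
         (use Lambda_prod_close[OF n, of _ ?H x] g PC_sub in auto)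
  qed
  also have "\<dots> = g x * (\<Sum>\<pi>\<in>PC (n - 1). trace01 (Lambda_prod (n - 1) \<pi> ?H))"
    by (rule sum_distrib_left[symmetric])
  also have "(\<Sum>\<pi>\<in>PC (n - 1). trace01 (Lambda_prod (n - 1) \<pi> ?H)) = trace01 (\<lambda>y. \<Sum>\<pi>\<in>PC (n - 1). Lambda_prod (n - 1) \<pi> ?H y)"
    by (rule trace01_sum[symmetric]) (use PC_sub g n in \<open>auto intro!: Lambda_prod_C01\<close>)
  finally have "(\<Sum>\<pi>\<in>?M. Lambda_prod n \<pi> ?H x) = g x * trace01 (Lambda_sum PC (replicate (n - 1) g))"
    by (simp only: Lambda_sum_def[abs_def] length_replicate rep)
  moreover have "(\<Sum>\<pi>\<in>PC_plus n. Lambda_prod n \<pi> ?H x) = (\<Sum>\<pi>\<in>PC n. Lambda_prod n \<pi> ?H x) + (\<Sum>\<pi>\<in>?M. Lambda_prod n \<pi> ?H x)"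
    by (subst split(1), rule sum.union_disjoint) (use fin fin' split(2) in auto)
  ultimately have "Lambda_sum PC_plus (replicate n g) x =
      Lambda_sum PC (replicate n g) x + g x * trace01 (Lambda_sum PC (replicate (n - 1) g))"
    unfolding Lambda_sum_def[of _ "replicate n g"] length_replicate rep by (simp only:)
  then show ?thesis by (simp only: mult.commute)
qed

lemma B_series_eq: "B_series \<doteq> s_var \<oplus> s_trace A_series \<otimes> s_var \<oplus> A_series"
  unfolding series_eq_def
proof (intro allI ballI ext)
  fix n g x assume g: "g \<in> C01"
  have mult: "series_term (s_trace A_series \<otimes> s_var) n g x =
      (if n = 0 then 0 else const01 (trace01 (series_term A_series (n - 1) g)) x * g x)"
  proof -
    have "series_term (s_trace A_series \<otimes> s_var) n g x =
        (\<Sum>i\<le>n. if n - i = 1 then const01 (trace01 (series_term A_series i g)) x * g x else 0)"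
      unfolding series_term_s_mult by (rule sum.cong) (auto simp: series_term_def s_var_def s_trace_def)
    also have "\<dots> = (\<Sum>i\<le>n. if i = n - 1 \<and> n \<noteq> 0 then const01 (trace01 (series_term A_series i g)) x * g x else 0)"
      by (rule sum.cong) auto
    finally show ?thesis by simp
  qed
  have c: "const01 c x * g x = c * g x" for c using g by (auto simp: C01_def const01_def)
  have eq: "series_term (s_var \<oplus> s_trace A_series \<otimes> s_var \<oplus> A_series) n g x =
      series_term s_var n g x + series_term (s_trace A_series \<otimes> s_var) n g x + series_term A_series n g x"
    by (simp add: series_term_def s_add_def)
  consider "n = 0" | "n = 1" | "2 \<le> n" by linarith
  then show "series_term B_series n g x = series_term (s_var \<oplus> s_trace A_series \<otimes> s_var \<oplus> A_series) n g x"
  proof cases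
    case 1
    then show ?thesis
      unfolding eq mult by (simp add: series_term_def B_series_def A_series_def partition_series_def s_var_def)
  next
    case 2
    have "series_term A_series 0 g = (\<lambda>x. 0)" "series_term A_series 1 g x = 0"
      by (simp_all add: series_term_def A_series_def partition_series_def PC_1[unfolded One_nat_def])
    moreover have "trace01 (\<lambda>x. 0) = 0" by (simp add: trace01_def)
    moreover have "series_term B_series 1 g x = g x"
    proof -
      have "series_term B_series 1 g x = Lambda_sum PC_plus [g] x"
        using B_series_Lambda_sum[of "[g]"] g by (simp add: series_term_def)
      also have "\<dots> = g x"
        using Lambda_prod_1[of "\<lambda>k. [g] ! (k - 1)" x] by (simp add: Lambda_sum_def PC_plus_1[unfolded One_nat_def])
      finally show ?thesis .
    qed
    ultimately show ?thesis unfolding eq mult by (simp add: 2 c series_term_var)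
  next
    case 3
    have A: "series_term A_series m g = Lambda_sum PC (replicate m g)" if "0 < m" for m
      unfolding series_term_def A_series_def
      by (rule partition_series_Lambda_sum[OF PC_sub]) (use that g in auto)
    have "series_term B_series n g = Lambda_sum PC_plus (replicate n g)"
      unfolding series_term_def B_series_def
      by (rule partition_series_Lambda_sum[OF PC_plus_sub]) (use 3 g in auto)
    then show ?thesis
      unfolding eq mult using 3 by (simp add: A c Lambda_sum_PC_plus[OF g 3] series_term_var)
  qed
qed

section \<open>Composition of formal power series\<close>

lemma series_term_C01: "formal_series f \<Longrightarrow> g \<in> C01 \<Longrightarrow> series_term f n g \<in> C01"
  unfolding series_term_def by (rule formal_seriesD1) auto

lemma set_terms_C01: "formal_series G \<Longrightarrow> g \<in> C01 \<Longrightarrow> set (map (\<lambda>k. series_term G k g) ks) \<subseteq> C01"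
  using series_term_C01[of G g] by auto

lemma series_term_comp:
  "series_term (f \<odot> G) n g x = (\<Sum>ks\<in>compositions n. f (length ks) (map (\<lambda>k. series_term G k g) ks) x)"
  by (simp add: series_term_s_comp compositions_def)

lemma comp_term_C01:
  assumes "formal_series f" "formal_series G" "g \<in> C01"
  shows "series_term (f \<odot> G) n g \<in> C01"
proof -
  have "(\<lambda>x. series_term (f \<odot> G) n g x) \<in> C01"
    unfolding series_term_comp
    by (intro C01_sum formal_seriesD1[OF assms(1)] set_terms_C01 assms) auto
  then show ?thesis by simp
qed

text \<open>Agreement is assumed on all lists, since a composition evaluates its left series at
  lists of different terms of G.\<close>

lemma comp_cong_left:
  assumes "\<And>n gs. length gs = n \<Longrightarrow> set gs \<subseteq> C01 \<Longrightarrow> f n gs = f' n gs" "formal_series G" "g \<in> C01"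
  shows "series_term (f \<odot> G) n g = series_term (f' \<odot> G) n g"
  unfolding fun_eq_iff series_term_comp
  by (intro allI sum.cong refl) (simp only: assms(1)[OF _ set_terms_C01[OF assms(2,3)]] length_map)

lemma set_replicate_C01: "g \<in> C01 \<Longrightarrow> set (replicate n g) \<subseteq> C01"
  by auto

lemma D_series_diag: "g \<in> C01 \<Longrightarrow> series_term D_series n g = series_term (s_one \<oplus> C_series \<odot> F_series) n g"
  unfolding series_term_def by (rule D_series_eq[OF length_replicate set_replicate_C01])

text \<open>A composition of n with a cut between its parts is the same as a pair of compositions of
  m and n - m.\<close>

lemma comp_mult:
  "series_term ((a \<otimes> b) \<odot> G) n g x = series_term ((a \<odot> G) \<otimes> (b \<odot> G)) n g x"
proof -
  let ?u = "\<lambda>ks. map (\<lambda>k. series_term G k g) ks"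
  have "series_term ((a \<otimes> b) \<odot> G) n g x =
      (\<Sum>(ks, i)\<in>(SIGMA ks:compositions n. {..length ks}).
        a i (?u (take i ks)) x * b (length ks - i) (?u (drop i ks)) x)"
    unfolding series_term_comp s_mult_def
    by (subst sum.Sigma[symmetric]) (auto simp: finite_compositions take_map drop_map)
  also have "\<dots> = (\<Sum>(m, k1, k2)\<in>(SIGMA m:{..n}. compositions m \<times> compositions (n - m)).
        a (length k1) (?u k1) x * b (length k2) (?u k2) x)"
  proof (rule sum.reindex_bij_witness[where
        i = "\<lambda>(m, k1, k2). (k1 @ k2, length k1)" and j = "\<lambda>(ks, i). (sum_list (take i ks), take i ks, drop i ks)"], goal_cases)
    case (1 p)
    then show ?case by (auto simp: compositions_def)
  next
    case (2 p)
    then obtain ks i where p: "p = (ks, i)" "ks \<in> compositions n" "i \<le> length ks" by auto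
    have "sum_list (take i ks) + sum_list (drop i ks) = n"
      using p by (metis (mono_tags, lifting) append_take_drop_id compositions_def mem_Collect_eq sum_list_append)
    then show ?case
      using p by (auto simp: compositions_def dest: in_set_takeD in_set_dropD)
  next
    case (3 p)
    then show ?case by (auto simp: compositions_def)
  next
    case (4 p)
    then show ?case by (auto simp: compositions_def)
  next
    case (5 p)
    then show ?case by (auto simp: min_absorb2)
  qed
  also have "\<dots> = (\<Sum>m\<le>n. \<Sum>(k1, k2)\<in>compositions m \<times> compositions (n - m).
        a (length k1) (?u k1) x * b (length k2) (?u k2) x)"
    by (subst sum.Sigma) (auto simp: finite_compositions)
  also have "\<dots> = series_term ((a \<odot> G) \<otimes> (b \<odot> G)) n g x"
    unfolding series_term_s_mult series_term_comp sum_product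
    by (intro sum.cong refl) (rule sum.cartesian_product[symmetric])
  finally show ?thesis .
qed

lemma formal_series_slot_sum:
  assumes f: "formal_series f" and C: "set (pre @ post) \<subseteq> C01" and n: "n = Suc (length pre + length post)"
    and I: "finite I" "\<And>i. i \<in> I \<Longrightarrow> u i \<in> C01"
  shows "f n (pre @ (\<lambda>y. \<Sum>i\<in>I. u i y) # post) x = (\<Sum>i\<in>I. f n (pre @ u i # post) x)"
  using I
proof (induction I rule: finite_induct)
  case empty
  have "f n (pre @ (\<lambda>y. 0 * 0) # post) x = 0 * f n (pre @ (\<lambda>y. 0) # post) x"
    by (rule formal_series_slot_scale[OF f]) (use C n in \<open>auto simp: C01_zero\<close>)
  then show ?case by simp
next
  case (insert i I)
  have S: "(\<lambda>y. \<Sum>i\<in>I. u i y) \<in> C01" using insert by (intro C01_sum) auto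
  have "f n ((pre @ u i # post)[length pre := (\<lambda>y. 1 * u i y + 1 * (\<Sum>i\<in>I. u i y))]) x =
      1 * f n ((pre @ u i # post)[length pre := u i]) x +
      1 * f n ((pre @ u i # post)[length pre := (\<lambda>y. \<Sum>i\<in>I. u i y)]) x"
    by (rule formal_seriesD2[OF f]) (use C n insert S in auto)
  then show ?case using insert by simp
qed

lemma finite_listset: "(\<And>A. A \<in> set As \<Longrightarrow> finite A) \<Longrightarrow> finite (listset As)"
proof (induction As)
  case (Cons A As)
  have "listset (A # As) = (\<lambda>(a, as). a # as) ` (A \<times> listset As)" by (auto simp: set_Cons_def)
  then show ?case using Cons by simp
qed simp

lemma sum_set_Cons: "(\<Sum>as\<in>set_Cons A B. h as) = (\<Sum>a\<in>A. \<Sum>as\<in>B. h (a # as))"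
proof -
  have "set_Cons A B = (\<lambda>(a, as). a # as) ` (A \<times> B)" by (auto simp: set_Cons_def)
  moreover have "inj_on (\<lambda>(a, as). a # as) (A \<times> B)" by (auto simp: inj_on_def)
  ultimately have "(\<Sum>as\<in>set_Cons A B. h as) = (\<Sum>(a, as)\<in>A \<times> B. h (a # as))"
    by (simp add: sum.reindex case_prod_unfold)
  then show ?thesis by (simp add: sum.cartesian_product)
qed

text \<open>Multilinear expansion, slot by slot; \<open>pre\<close> holds the slots expanded so
  far.\<close>

lemma formal_series_expand:
  assumes f: "formal_series f" and fin: "\<And>m. finite (A m)" and u: "\<And>a. u a \<in> C01"
    and pre: "set pre \<subseteq> C01"
  shows "f (length pre + length ms) (pre @ map (\<lambda>m y. \<Sum>a\<in>A m. u a y) ms) x =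
    (\<Sum>as\<in>listset (map A ms). f (length pre + length ms) (pre @ map u as) x)"
  using pre
proof (induction ms arbitrary: pre)
  case (Cons m ms)
  have S: "(\<lambda>y. \<Sum>a\<in>A m. u a y) \<in> C01" for m by (intro C01_sum u)
  have "f (length pre + length (m # ms)) (pre @ map (\<lambda>m y. \<Sum>a\<in>A m. u a y) (m # ms)) x =
      (\<Sum>a\<in>A m. f (length pre + length (m # ms)) (pre @ u a # map (\<lambda>m y. \<Sum>a\<in>A m. u a y) ms) x)"
    unfolding list.map by (rule formal_series_slot_sum[OF f]) (use Cons.prems S fin u in auto)
  also have "\<dots> = (\<Sum>a\<in>A m. \<Sum>as\<in>listset (map A ms). f (length pre + length (m # ms)) (pre @ map u (a # as)) x)"
  proof (rule sum.cong[OF refl])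
    fix a
    have "set (pre @ [u a]) \<subseteq> C01" using Cons.prems u by auto
    from Cons.IH[OF this]
    show "f (length pre + length (m # ms)) (pre @ u a # map (\<lambda>m y. \<Sum>a\<in>A m. u a y) ms) x =
        (\<Sum>as\<in>listset (map A ms). f (length pre + length (m # ms)) (pre @ map u (a # as)) x)" by simp
  qed
  finally show ?case by (simp add: sum_set_Cons)
qed simp

lemma concat_split_list_at: "sum_list ls = length xs \<Longrightarrow> concat (split_list_at ls xs) = xs"
  by (induction ls arbitrary: xs) auto

lemma map_length_split_list_at: "sum_list ls = length xs \<Longrightarrow> map length (split_list_at ls xs) = ls"
  by (induction ls arbitrary: xs) auto

lemma split_list_at_concat: "split_list_at (map length xss) (concat xss) = xss"
  by (induction xss) auto

lemma map2_split_list_at: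
  "sum_list ls = length ks \<Longrightarrow>
    map2 F ls (split_list_at ls (map h ks)) = map (\<lambda>ks. F (length ks) (map h ks)) (split_list_at ls ks)"
  by (induction ls arbitrary: ks) (auto simp: take_map drop_map min_absorb2)

lemma listset_compositions:
  "kss \<in> listset (map compositions ms) \<longleftrightarrow> map sum_list kss = ms \<and> (\<forall>ks\<in>set kss. 0 \<notin> set ks)"
  by (induction ms arbitrary: kss) (auto simp: set_Cons_def compositions_def)

lemma sum_list_concat: "sum_list (concat xss) = sum_list (map sum_list xss)"
  for xss :: "nat list list"
  by (induction xss) auto

text \<open>Both sides are sums over two-level compositions of n. On the left such an object is a
  composition together with a grouping of its parts; on the right it is the list of the group sums
  together with a composition of each. Multilinearity of f expands the inner sums on the
  right.\<close>

lemma comp_assoc: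
  assumes f: "formal_series f" and F: "formal_series F" and G: "formal_series G" and g: "g \<in> C01"
  shows "series_term ((f \<odot> F) \<odot> G) n g x = series_term (f \<odot> (F \<odot> G)) n g x"
proof -
  let ?h = "\<lambda>k. series_term G k g"
  define u where "u = (\<lambda>ks. F (length ks) (map ?h ks))"
  \<comment> \<open>The common index set: lists of nonempty groups of positive parts with total
    n.\<close>
  define K where "K = {kss. sum_list (map sum_list kss) = n \<and> (\<forall>ks\<in>set kss. ks \<noteq> [] \<and> 0 \<notin> set ks)}"
  have uC: "u ks \<in> C01" for ks
    unfolding u_def by (rule formal_seriesD1[OF F _ set_terms_C01[OF G g]]) simp
  have "series_term ((f \<odot> F) \<odot> G) n g x =
      (\<Sum>(ks, ls)\<in>(SIGMA ks:compositions n. compositions (length ks)).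
        f (length ls) (map2 F ls (split_list_at ls (map ?h ks))) x)"
    unfolding series_term_comp s_comp_def compositions_def[symmetric]
    by (rule sum.Sigma) (auto simp: finite_compositions)
  also have "\<dots> = (\<Sum>kss\<in>K. f (length kss) (map u kss) x)"
  proof (rule sum.reindex_bij_witness[where i = "\<lambda>kss. (concat kss, map length kss)"
        and j = "\<lambda>(ks, ls). split_list_at ls ks"], goal_cases)
    case (1 p)
    then show ?case
      by (auto simp: compositions_def concat_split_list_at map_length_split_list_at)
  next
    case (2 p)
    then obtain ks ls where p: "p = (ks, ls)" "ks \<in> compositions n" "ls \<in> compositions (length ks)" by auto
    then have len: "sum_list ls = length ks" by (simp add: compositions_def)
    note c = concat_split_list_at[OF len] map_length_split_list_at[OF len]
    have "0 \<notin> set k \<and> k \<noteq> []" if "k \<in> set (split_list_at ls ks)" for k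
    proof
      have "set k \<subseteq> set (concat (split_list_at ls ks))" using that by auto
      then show "0 \<notin> set k" using p(2) c(1) by (auto simp: compositions_def)
      have "length k \<in> set (map length (split_list_at ls ks))" using that by simp
      then have "length k \<in> set ls" using c(2) by simp
      then show "k \<noteq> []" using p(3) by (auto simp: compositions_def)
    qed
    moreover have "sum_list (map sum_list (split_list_at ls ks)) = n"
      unfolding sum_list_concat[symmetric] c(1) using p(2) by (simp add: compositions_def)
    ultimately show ?case using p(1) by (simp add: K_def)
  next
    case (3 kss)
    then show ?case by (simp add: split_list_at_concat)
  next
    case (4 kss)
    then show ?case by (auto simp: K_def compositions_def sum_list_concat length_concat)
  next
    case (5 p)
    then obtain ks ls where p: "p = (ks, ls)" "ks \<in> compositions n" "ls \<in> compositions (length ks)" by auto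
    then have len: "sum_list ls = length ks" by (simp add: compositions_def)
    have "length (split_list_at ls ks) = length ls"
      using arg_cong[OF map_length_split_list_at[OF len], of length] by simp
    then show ?case using p(1) by (simp add: map2_split_list_at[OF len] u_def)
  qed
  also have "\<dots> = (\<Sum>(ms, kss)\<in>(SIGMA ms:compositions n. listset (map compositions ms)). f (length ms) (map u kss) x)"
  proof (rule sum.reindex_bij_witness[where i = snd and j = "\<lambda>kss. (map sum_list kss, kss)"], goal_cases)
    case (1 kss)
    then show ?case by simp
  next
    case (2 kss)
    have "kss \<in> listset (map compositions (map sum_list kss))"
      unfolding listset_compositions using 2 by (auto simp: K_def)
    moreover have "sum_list ks \<noteq> 0" if "ks \<in> set kss" for ks
      using 2 that by (cases ks) (auto simp: K_def)
    then have "0 \<notin> set (map sum_list kss)" by (metis imageE list.set_map)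
    then have "map sum_list kss \<in> compositions n"
      using 2 unfolding K_def compositions_def by blast
    ultimately show ?case by (auto simp del: map_map)
  next
    case (3 p)
    then show ?case by (auto simp: listset_compositions)
  next
    case (4 p)
    then show ?case
      by (auto simp: K_def compositions_def listset_compositions dest: imageI[of "[]" _ sum_list])
  next
    case (5 kss)
    then show ?case by simp
  qed
  also have "\<dots> = (\<Sum>ms\<in>compositions n. \<Sum>kss\<in>listset (map compositions ms). f (length ms) (map u kss) x)"
    by (rule sum.Sigma[symmetric]) (auto simp: finite_compositions intro!: finite_listset)
  also have "\<dots> = (\<Sum>ms\<in>compositions n. f (length ms) (map (\<lambda>m y. \<Sum>ks\<in>compositions m. u ks y) ms) x)"
  proof (rule sum.cong[OF refl])
    fix ms
    show "(\<Sum>kss\<in>listset (map compositions ms). f (length ms) (map u kss) x) =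
        f (length ms) (map (\<lambda>m y. \<Sum>ks\<in>compositions m. u ks y) ms) x"
      using formal_series_expand[where f = f and A = compositions and u = u and pre = "[]" and ms = ms and x = x]
        f finite_compositions uC by simp
  qed
  also have "\<dots> = series_term (f \<odot> (F \<odot> G)) n g x"
    unfolding series_term_comp[of f] by (simp add: series_term_comp[abs_def] u_def)
  finally show ?thesis .
qed

text \<open>Only compositions with a single part contribute. The assumption settles degree 0, where
  a composition sum never evaluates G.\<close>

lemma comp_var_left:
  assumes "series_term G 0 g = (\<lambda>x. 0)"
  shows "series_term (s_var \<odot> G) n g x = series_term G n g x"
proof (cases n)
  case 0
  then show ?thesis using assms by (simp add: series_term_comp compositions_0 s_var_def)
next
  case (Suc m)
  have "series_term (s_var \<odot> G) n g x =
      (\<Sum>i\<le>m. \<Sum>ks\<in>compositions (m - i). if ks = [] then series_term G (Suc i) g x else 0)"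
    unfolding series_term_comp Suc sum_compositions_Suc by (intro sum.cong refl) (auto simp: s_var_def)
  also have "\<dots> = (\<Sum>i\<le>m. if i = m then series_term G (Suc i) g x else 0)"
  proof (rule sum.cong[OF refl])
    fix i assume "i \<in> {..m}"
    then have "[] \<in> compositions (m - i) \<longleftrightarrow> i = m" by (auto simp: compositions_def)
    then show "(\<Sum>ks\<in>compositions (m - i). if ks = [] then series_term G (Suc i) g x else 0) =
        (if i = m then series_term G (Suc i) g x else 0)"
      by (simp add: finite_compositions)
  qed
  finally show ?thesis using Suc by simp
qed

lemma comp_one_left: "series_term (s_one \<odot> G) n g x = series_term s_one n g x"
proof -
  have "series_term (s_one \<odot> G) n g x = (\<Sum>ks\<in>compositions n. if ks = [] then const01 1 x else 0)"
    unfolding series_term_comp by (intro sum.cong refl) (auto simp: s_one_def)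
  also have "\<dots> = (if [] \<in> compositions n then const01 1 x else 0)" by (simp add: finite_compositions)
  also have "\<dots> = series_term s_one n g x" by (auto simp: compositions_def series_term_def s_one_def)
  finally show ?thesis .
qed

lemma comp_add_left: "series_term ((a \<oplus> b) \<odot> G) n g x = series_term (a \<odot> G) n g x + series_term (b \<odot> G) n g x"
  by (simp add: series_term_comp s_add_def sum.distrib)

lemma comp_uminus_left: "series_term (s_uminus a \<odot> G) n g x = - series_term (a \<odot> G) n g x"
  by (simp add: series_term_comp s_uminus_def sum_negf)

text \<open>A part different from 1 puts the zero function into a slot of f, so only the composition
  into ones survives.\<close>

lemma comp_var_right:
  assumes f: "formal_series f" and g: "g \<in> C01"
  shows "series_term (f \<odot> s_var) n g x = series_term f n g x"
proof -
  have one: "replicate n 1 \<in> compositions n" by (simp add: compositions_def sum_list_replicate)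
  have "f (length ks) (map (\<lambda>k. series_term s_var k g) ks) x = (if ks = replicate n 1 then series_term f n g x else 0)"
    if ks: "ks \<in> compositions n" for ks
  proof (cases "ks = replicate n 1")
    case True
    then show ?thesis by (simp add: series_term_def s_var_def)
  next
    case False
    have "\<exists>k\<in>set ks. k \<noteq> 1"
    proof (rule ccontr)
      assume "\<not> (\<exists>k\<in>set ks. k \<noteq> 1)"
      then have "ks = replicate (length ks) 1"
        by (intro replicate_length_same[symmetric]) blast
      then obtain m where m: "ks = replicate m 1" by blast
      then have "m = n" using ks by (simp add: compositions_def sum_list_replicate)
      then show False using False m by simp
    qed
    then obtain k where k: "k \<in> set ks" "k \<noteq> 1" by blast
    then obtain as bs where split: "ks = as @ k # bs" by (meson split_list)
    let ?m = "map (\<lambda>k. series_term s_var k g)"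
    have "f (length ks) (?m as @ (\<lambda>y. 0 * 0) # ?m bs) x = 0 * f (length ks) (?m as @ (\<lambda>y. 0) # ?m bs) x"
      by (rule formal_series_slot_scale[OF f])
         (use set_terms_C01[OF formal_series_var g] split C01_zero in auto)
    then show ?thesis using False k split by (simp add: series_term_var)
  qed
  then have "series_term (f \<odot> s_var) n g x = (\<Sum>ks\<in>compositions n. if ks = replicate n 1 then series_term f n g x else 0)"
    unfolding series_term_comp by (rule sum.cong[OF refl])
  then show ?thesis using one by (simp add: finite_compositions)
qed

text \<open>The restriction to degrees from 1 to n is what permits induction on the degree.\<close>

lemma comp_cong_right:
  assumes "\<And>k. 0 < k \<Longrightarrow> k \<le> n \<Longrightarrow> series_term G k g = series_term G' k g"
  shows "series_term (f \<odot> G) n g x = series_term (f \<odot> G') n g x"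
  unfolding series_term_comp
proof (rule sum.cong[OF refl])
  fix ks assume ks: "ks \<in> compositions n"
  have "map (\<lambda>k. series_term G k g) ks = map (\<lambda>k. series_term G' k g) ks"
  proof (rule map_cong[OF refl])
    fix k assume k: "k \<in> set ks"
    then have "k \<le> n" "0 < k" using ks member_le_sum_list[of k ks] by (auto simp: compositions_def intro: gr0I)
    then show "series_term G k g = series_term G' k g" using assms by simp
  qed
  then show "f (length ks) (map (\<lambda>k. series_term G k g) ks) x = f (length ks) (map (\<lambda>k. series_term G' k g) ks) x"
    by (simp only:)
qed

text \<open>Each of the k factors has degree at least 1.\<close>

lemma s_power_zero:
  assumes "f 0 [] = (\<lambda>x. 0)"
  shows "length gs = n \<Longrightarrow> n < k \<Longrightarrow> s_power f k n gs x = 0"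
proof (induction k arbitrary: n gs)
  case (Suc k)
  have z: "f i (take i gs) x * s_power f k (n - i) (drop i gs) x = 0" if "i \<le> n" for i
  proof (cases "i = 0")
    case True
    then show ?thesis using assms by simp
  next
    case False
    then have "n - i < k" "length (drop i gs) = n - i" using Suc.prems that by auto
    then show ?thesis using Suc.IH[of "drop i gs" "n - i"] by simp
  qed
  show ?case
    unfolding s_power.simps s_mult_def by (rule sum.neutral, rule ballI, rule z) simp
qed simp

text \<open>Multiplication by f shifts the powers by one. As it holds for all lists, the identity
  may be substituted on the left of a composition.\<close>

lemma geometric_eq:
  assumes f: "f 0 [] = (\<lambda>x. 0)" and gs: "length gs = n"
  shows "s_geometric f n gs = (s_one \<oplus> f \<otimes> s_geometric f) n gs"
proof
  fix x
  have inner: "f i (take i gs) x * (\<Sum>k<n. s_power f k (n - i) (drop i gs) x) =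
      f i (take i gs) x * s_geometric f (n - i) (drop i gs) x" if i: "i \<le> n" for i
  proof (cases "i = 0")
    case True
    then show ?thesis using f by simp
  next
    case False
    \<comment> \<open>For i > 0 the range \<open>k < n\<close> exceeds \<open>k \<le> n - i\<close>
      only by powers that have no term of degree n - i.\<close>
    have "(\<Sum>k<n. s_power f k (n - i) (drop i gs) x) = (\<Sum>k\<le>n - i. s_power f k (n - i) (drop i gs) x)"
      using False i gs by (intro sum.mono_neutral_right) (auto intro!: s_power_zero[where f = f, OF f])
    then show ?thesis by (simp add: s_geometric_def)
  qed
  have "s_geometric f n gs x = s_one n gs x + (\<Sum>k<n. s_power f (Suc k) n gs x)"
    unfolding s_geometric_def by (simp add: sum.atMost_shift)
  also have "(\<Sum>k<n. s_power f (Suc k) n gs x) =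
      (\<Sum>i\<le>n. f i (take i gs) x * (\<Sum>k<n. s_power f k (n - i) (drop i gs) x))"
    unfolding s_power.simps s_mult_def sum_distrib_left by (rule sum.swap)
  also have "\<dots> = (f \<otimes> s_geometric f) n gs x"
    unfolding s_mult_def using inner by (intro sum.cong) auto
  finally show "s_geometric f n gs x = (s_one \<oplus> f \<otimes> s_geometric f) n gs x"
    by (simp add: s_add_def)
qed

section \<open>Pointwise reduction to complex power series and the compositional inverse\<close>

text \<open>For fixed g and x, products of series become products of power series over the complex
  numbers, an integral domain in which the final equations can be solved.\<close>

definition pointwise_fps :: "series \<Rightarrow> (real \<Rightarrow> complex) \<Rightarrow> real \<Rightarrow> complex fps" where
  "pointwise_fps f g x = Abs_fps (\<lambda>n. series_term f n g x)"

lemma pointwise_fps_mult: "pointwise_fps (a \<otimes> b) g x = pointwise_fps a g x * pointwise_fps b g x"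
  by (simp add: pointwise_fps_def fps_eq_iff fps_mult_nth series_term_s_mult atLeast0AtMost)

lemma pointwise_fps_add: "pointwise_fps (a \<oplus> b) g x = pointwise_fps a g x + pointwise_fps b g x"
  by (simp add: pointwise_fps_def fps_eq_iff series_term_def s_add_def)

lemma pointwise_fps_uminus: "pointwise_fps (s_uminus a) g x = - pointwise_fps a g x"
  by (simp add: pointwise_fps_def fps_eq_iff series_term_def s_uminus_def)

lemma pointwise_fps_one: "x \<in> {0..1} \<Longrightarrow> pointwise_fps s_one g x = 1"
  by (auto simp: pointwise_fps_def fps_eq_iff series_term_def s_one_def const01_def)

lemma pointwise_fps_eqI:
  "(\<And>n. series_term a n g x = series_term b n g x) \<Longrightarrow> pointwise_fps a g x = pointwise_fps b g x"
  by (simp add: pointwise_fps_def)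

text \<open>Points outside the unit interval are treated apart because \<open>s_one\<close> is 0
  there, not 1.\<close>

lemma series_eqI:
  assumes "\<And>n g. g \<in> C01 \<Longrightarrow> series_term a n g \<in> C01" "\<And>n g. g \<in> C01 \<Longrightarrow> series_term b n g \<in> C01"
    and eq: "\<And>g x. g \<in> C01 \<Longrightarrow> x \<in> {0..1} \<Longrightarrow> pointwise_fps a g x = pointwise_fps b g x"
  shows "a \<doteq> b"
  unfolding series_eq_def
proof (intro allI ballI ext)
  fix n g x assume g: "g \<in> C01"
  show "series_term a n g x = series_term b n g x"
  proof (cases "x \<in> {0..1}")
    case True
    from eq[OF g this] show ?thesis by (simp add: pointwise_fps_def fps_eq_iff)
  next
    case False
    then show ?thesis using assms(1,2)[OF g, of n] by (simp add: C01_def)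
  qed
qed

text \<open>The candidate h (1 + C(h))^(-1) for the inverse of F.\<close>

definition H_series :: series where
  "H_series = s_var \<otimes> s_geometric (s_uminus C_series)"

lemma formal_H: "formal_series H_series"
  unfolding H_series_def
  by (intro formal_series_mult formal_series_var formal_series_geometric formal_series_uminus formal_C)

lemma C_series_0: "s_uminus C_series 0 [] = (\<lambda>x. 0)"
  by (simp add: s_uminus_def C_series_def partition_series_def)

lemma H_series_0: "series_term H_series 0 g = (\<lambda>x. 0)"
  by (simp add: H_series_def fun_eq_iff series_term_var_mult)

lemma F_series_0: "series_term F_series 0 g = (\<lambda>x. 0)"
  by (simp add: F_series_def fun_eq_iff series_term_var_mult)

lemma H_mult:
  assumes "x \<in> {0..1}"
  shows "pointwise_fps H_series g x * (1 + pointwise_fps C_series g x) = pointwise_fps s_var g x"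
proof -
  let ?Z = "pointwise_fps (s_geometric (s_uminus C_series)) g x"
  have "?Z = pointwise_fps (s_one \<oplus> s_uminus C_series \<otimes> s_geometric (s_uminus C_series)) g x"
    by (rule pointwise_fps_eqI) (simp add: series_term_def geometric_eq[where f = "s_uminus C_series", OF C_series_0])
  then have "?Z = 1 - pointwise_fps C_series g x * ?Z"
    using assms by (simp add: pointwise_fps_add pointwise_fps_mult pointwise_fps_uminus pointwise_fps_one)
  then have "?Z * (1 + pointwise_fps C_series g x) = 1"
    by (simp add: algebra_simps)
  then show ?thesis by (simp add: H_series_def pointwise_fps_mult mult.assoc)
qed

lemma F_comp:
  assumes G: "formal_series G" "series_term G 0 g = (\<lambda>x. 0)" and g: "g \<in> C01"
  shows "series_term (F_series \<odot> G) n g x =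
    series_term (G \<otimes> (s_one \<oplus> C_series \<odot> (F_series \<odot> G))) n g x"
proof -
  have D: "series_term (D_series \<odot> G) m g x = series_term (s_one \<oplus> C_series \<odot> (F_series \<odot> G)) m g x" for m
  proof -
    have "series_term (D_series \<odot> G) m g = series_term ((s_one \<oplus> C_series \<odot> F_series) \<odot> G) m g"
      by (rule comp_cong_left[OF D_series_eq G(1) g])
    then show ?thesis
      by (simp add: comp_add_left comp_one_left comp_assoc[OF formal_C formal_F G(1) g])
         (simp add: series_term_def s_add_def)
  qed
  have "series_term (F_series \<odot> G) n g x = series_term ((s_var \<odot> G) \<otimes> (D_series \<odot> G)) n g x"
    unfolding F_series_def by (rule comp_mult)
  then show ?thesis
    by (simp add: series_term_s_mult comp_var_left[OF G(2)] D)
qed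

text \<open>Strong induction on the degree in F(H) = H (1 + C(F(H))). As H has no constant term,
  degree n on the right involves F(H) only in lower degrees, where it equals h already; so the right
  side agrees in degree n with H (1 + C) = h.\<close>

lemma F_comp_H: "F_series \<odot> H_series \<doteq> s_var"
proof -
  have "series_term (F_series \<odot> H_series) n g = series_term s_var n g" if g: "g \<in> C01" for n g
  proof (induction n rule: less_induct)
    case (less n)
    show ?case
    proof
      fix x
      show "series_term (F_series \<odot> H_series) n g x = series_term s_var n g x"
      proof (cases "x \<in> {0..1}")
        case False
        then show ?thesis
          using comp_term_C01[OF formal_F formal_H g, of n] series_term_C01[OF formal_series_var g, of n]
          by (simp add: C01_def)
      next
        case True
        have "series_term (F_series \<odot> H_series) n g x =
            (\<Sum>i\<le>n. series_term H_series i g x * series_term (s_one \<oplus> C_series \<odot> (F_series \<odot> H_series)) (n - i) g x)"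
          by (simp add: F_comp[OF formal_H H_series_0 g] series_term_s_mult)
        also have "\<dots> = (\<Sum>i\<le>n. series_term H_series i g x * series_term (s_one \<oplus> C_series) (n - i) g x)"
        proof (rule sum.cong[OF refl])
          fix i assume i: "i \<in> {..n}"
          show "series_term H_series i g x * series_term (s_one \<oplus> C_series \<odot> (F_series \<odot> H_series)) (n - i) g x =
              series_term H_series i g x * series_term (s_one \<oplus> C_series) (n - i) g x"
          proof (cases "i = 0")
            case True
            then show ?thesis by (simp add: H_series_0)
          next
            case False
            have "series_term (C_series \<odot> (F_series \<odot> H_series)) (n - i) g x = series_term (C_series \<odot> s_var) (n - i) g x"
              by (rule comp_cong_right) (use less False i in auto)
            then have "series_term (C_series \<odot> (F_series \<odot> H_series)) (n - i) g x = series_term C_series (n - i) g x"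
              by (simp add: comp_var_right[OF formal_C g])
            then show ?thesis by (simp add: series_term_def s_add_def)
          qed
        qed
        also have "\<dots> = fps_nth (pointwise_fps (H_series \<otimes> (s_one \<oplus> C_series)) g x) n"
          by (simp add: pointwise_fps_def series_term_s_mult)
        also have "\<dots> = series_term s_var n g x"
          using H_mult[OF True, of g] by (simp add: pointwise_fps_mult pointwise_fps_add pointwise_fps_one[OF True])
            (simp add: pointwise_fps_def)
        finally show ?thesis .
      qed
    qed
  qed
  then show ?thesis by (simp add: series_eq_def)
qed

text \<open>H(F) is F times the inverse of 1 + C(F). Since D = 1 + C(F) and F = g D, the factor D
  cancels.\<close>

lemma H_comp_F: "H_series \<odot> F_series \<doteq> s_var"
proof (rule series_eqI)
  fix g and x :: real assume g: "g \<in> C01" and x: "x \<in> {0..1}"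
  let ?geo = "s_geometric (s_uminus C_series)"
  let ?Y = "pointwise_fps (?geo \<odot> F_series) g x" and ?D = "pointwise_fps D_series g x"
  have "pointwise_fps (H_series \<odot> F_series) g x = pointwise_fps ((s_var \<odot> F_series) \<otimes> (?geo \<odot> F_series)) g x"
    unfolding H_series_def by (rule pointwise_fps_eqI) (rule comp_mult)
  also have "\<dots> = pointwise_fps F_series g x * ?Y"
    unfolding pointwise_fps_mult by (simp add: pointwise_fps_def comp_var_left[OF F_series_0])
  also have "pointwise_fps F_series g x = pointwise_fps s_var g x * ?D"
    by (simp add: F_series_def pointwise_fps_mult)
  finally have HF: "pointwise_fps (H_series \<odot> F_series) g x = pointwise_fps s_var g x * (?D * ?Y)"
    by (simp add: mult.assoc)
  have "?Y = pointwise_fps ((s_one \<oplus> s_uminus C_series \<otimes> ?geo) \<odot> F_series) g x"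
    by (rule pointwise_fps_eqI)
       (simp add: comp_cong_left[OF geometric_eq[where f = "s_uminus C_series", OF C_series_0] formal_F g])
  also have "\<dots> = pointwise_fps s_one g x + pointwise_fps ((s_uminus C_series \<odot> F_series) \<otimes> (?geo \<odot> F_series)) g x"
    by (simp add: pointwise_fps_def fps_eq_iff comp_add_left comp_one_left comp_mult)
  also have "\<dots> = 1 - pointwise_fps (C_series \<odot> F_series) g x * ?Y"
    unfolding pointwise_fps_mult pointwise_fps_one[OF x]
    by (simp add: pointwise_fps_def comp_uminus_left fps_eq_iff fps_mult_nth sum_negf)
  finally have Y: "?Y = 1 - pointwise_fps (C_series \<odot> F_series) g x * ?Y" .
  have "?D = pointwise_fps (s_one \<oplus> C_series \<odot> F_series) g x"
    by (rule pointwise_fps_eqI) (simp only: D_series_diag[OF g])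
  then have "?D = 1 + pointwise_fps (C_series \<odot> F_series) g x"
    by (simp add: pointwise_fps_add pointwise_fps_one[OF x])
  with Y have "?D * ?Y = 1" by (simp add: algebra_simps)
  then show "pointwise_fps (H_series \<odot> F_series) g x = pointwise_fps s_var g x" by (simp add: HF)
qed (use comp_term_C01[OF formal_H formal_F] series_term_C01[OF formal_series_var] in auto)

text \<open>The equation G (1 + C) = h has H as a solution too, and 1 + C may be cancelled because
  its constant coefficient is 1.\<close>

lemma comp_inverse_F_unique:
  assumes "comp_inverse F_series G"
  shows "G \<doteq> H_series"
proof (rule series_eqI)
  have G: "formal_series G" "F_series \<odot> G \<doteq> s_var" and G0: "series_term G 0 g = (\<lambda>x. 0)" for g
    using assms by (simp_all add: comp_inverse_def zero_constant_term_def series_term_def)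
  show "series_term G n g \<in> C01" if "g \<in> C01" for n g by (rule series_term_C01[OF G(1) that])
  show "series_term H_series n g \<in> C01" if "g \<in> C01" for n g by (rule series_term_C01[OF formal_H that])
  fix g and x :: real assume g: "g \<in> C01" and x: "x \<in> {0..1}"
  have FG: "series_term (F_series \<odot> G) n g = series_term s_var n g" for n
    using G(2) g by (simp add: series_eq_def)
  have C: "series_term (C_series \<odot> (F_series \<odot> G)) n g x = series_term C_series n g x" for n
    using comp_cong_right[of n "F_series \<odot> G" g s_var C_series x] FG comp_var_right[OF formal_C g, of n x] by simp
  have "pointwise_fps s_var g x = pointwise_fps (F_series \<odot> G) g x"
    by (simp add: pointwise_fps_def FG)
  also have "\<dots> = pointwise_fps (G \<otimes> (s_one \<oplus> C_series \<odot> (F_series \<odot> G))) g x"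
    by (rule pointwise_fps_eqI) (rule F_comp[OF G(1) G0 g])
  also have "\<dots> = pointwise_fps G g x * (1 + pointwise_fps C_series g x)"
    unfolding pointwise_fps_mult pointwise_fps_add pointwise_fps_one[OF x]
    by (simp add: pointwise_fps_def C)
  finally have "pointwise_fps G g x * (1 + pointwise_fps C_series g x) =
      pointwise_fps H_series g x * (1 + pointwise_fps C_series g x)"
    by (simp add: H_mult[OF x])
  moreover have "1 + pointwise_fps C_series g x \<noteq> 0"
  proof -
    have "fps_nth (1 + pointwise_fps C_series g x) 0 = 1"
      by (simp add: pointwise_fps_def series_term_def C_series_def partition_series_def)
    then show ?thesis by (metis fps_zero_nth zero_neq_one)
  qed
  ultimately show "pointwise_fps G g x = pointwise_fps H_series g x" by simp
qed

theorem proposition3p1: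
  shows "formal_series A_series \<and> formal_series B_series \<and>
     formal_series C_series \<and> formal_series D_series \<and>
     B_series \<doteq> s_var \<oplus> s_trace A_series \<otimes> s_var \<oplus> A_series \<and>
     C_series \<doteq> B_series \<odot> (s_var \<otimes> s_geometric (s_trace s_var)) \<and>
     D_series \<doteq> s_one \<oplus> C_series \<odot> (s_var \<otimes> D_series) \<and>
     comp_inverse F_series (s_var \<otimes> s_geometric (s_uminus C_series)) \<and>
     (\<forall>G. comp_inverse F_series G \<longrightarrow> G \<doteq> s_var \<otimes> s_geometric (s_uminus C_series))"
proof -
  have "D_series \<doteq> s_one \<oplus> C_series \<odot> (s_var \<otimes> D_series)"
    unfolding series_eq_def F_series_def[symmetric] by (intro allI ballI D_series_diag)
  moreover have "comp_inverse F_series H_series"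
    unfolding comp_inverse_def zero_constant_term_def
    using formal_H F_comp_H H_comp_F H_series_0 by (simp add: series_term_def)
  ultimately show ?thesis
    using formal_A formal_B formal_C formal_D B_series_eq C_series_eq comp_inverse_F_unique
    unfolding H_series_def[symmetric] by blast
qed

end
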